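(* Let $\beta\in(0,1)$, $x^*>1$ and let $T>0$ satisfy $T>\frac{\sup_{x\in I}|x-x^*|}{\beta}$. Let $a,b,c,d\in L^\infty_{\mathcal F}(\Omega;L^\infty(\overline{\mathcal M}\times\overline{\mathcal N}))$, let $\overline g\in L^2_{\mathcal F}(\Omega;L^2(\mathcal M))$ be a known function, let $R>0$, and let $$\begin{aligned}\mathcal W=\Big\{&(g,y_0,y_1)\in L^2_{\mathcal F}(\Omega;L^2(\mathcal M\times\mathcal N))\times L^2_{\mathcal F}(\Omega;H^1(\mathcal M))\times L^2_{\mathcal F}(\Omega;L^2(\mathcal M)):\ g(T)=\overline g\ \ \mathbb P\text{-a.s.},\\ &\|g\|_{L^2_{\mathcal F}(\Omega;L^2(\mathcal M\times\mathcal N))}+\|y_0\|_{L^2_{\mathcal F}(\Omega;H^1(\mathcal M))}+\|y_1\|_{L^2_{\mathcal F}(\Omega;L^2(\mathcal M))}\le R\Big\}.\end{aligned}$$ Let $(g^{(j)},y_0^{(j)},y_1^{(j)})\in\mathcal W$ for $j=1,2$, and let $y^{(j)}$ be the solution, with $(g,y_0,y_1)=(g^{(j)},y_0^{(j)},y_1^{(j)})$, of $$\begin{cases}\mathbf d_tz-\mathbf D_x^2y\,\Delta t=\big(ay+b\,\mathbf A_x\mathbf D_xy+c\,\mathbf t^-(z)\big)\Delta t+(dy+g)\,\mathbf t^+(\mathbf d_tB), & (x,t)\in\mathcal M\times\mathcal N,\\ z=\mathbf D_ty,\\ y(0,t)=y(1,t)=0, & t\in\mathcal N,\\ y(x,0)=y_0,\quad\mathbf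 t^+(z)(x,0)=y_1, & x\in\overline{\mathcal M}.\end{cases}$$ Then there exist a positive constant $C$ and sufficiently small $\widehat{\Delta x}>0$ and $\varepsilon>0$, depending on $x^*,\beta,M_0,R,T$ (and on the $L^\infty$-norms of $a,b,c,d$), such that $$\begin{aligned} &\big\|\sqrt{T-t}\,(g^{(1)}-g^{(2)})\big\|_{L^2_{\mathcal F}(\Omega;L^2(\mathcal M\times\mathcal N))}+\big\|y_0^{(1)}-y_0^{(2)}\big\|_{L^2_{\mathcal F}(\Omega;H^1(\mathcal M))}+\big\|y_1^{(1)}-y_1^{(2)}\big\|_{L^2_{\mathcal F}(\Omega;L^2(\mathcal M))}\\ &\le C\big\|\mathbf{tr}(\mathbf D_xy^{(1)})|_{x=0}-\mathbf{tr}(\mathbf D_xy^{(2)})|_{x=0}\big\|_{L^2_{\mathcal F}(\Omega;L^2(\mathcal N))}+C\big\|y^{(1)}(T)-y^{(2)}(T)\big\|^{1/2}_{L^2_{\mathcal F}(\Omega;H^1(\mathcal M))}\\ &\quad+C\big\|\Delta x\,\big(\mathbf D_t\mathbf D_xy^{(1)}-\mathbf D_t\mathbf D_xy^{(2)}\big)\big\|_{L^2_{\mathcal F}(\Omega;L^2(\mathcal M^*\times\mathcal N^* ))} \end{aligned}$$ for all $0<\Delta x\le\widehat{\Delta x}$ and $\Delta t=\varepsilon\,\mathcal O\big((\Delta x)^2\big)$.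
   Context: Probability. $(\Omega,\mathcal F,\{\mathcal F_t\}_{t\ge0},\mathbb P)$ is a complete filtered probability space carrying a one-dimensional standard Brownian motion $B$, and $\{\mathcal F_t\}$ is the natural filtration of $B$ augmented by all $\mathbb P$-null sets. Meshes. $I=(0,1)$, $Q=I\times(0,T)$. For positive integers $M,N$ put $\Delta x=\frac1{M+1}$, $\Delta t=\frac TN$, $x_j=j\Delta x$, $t^n=n\Delta t$ (also for half-integers $j,n$). $\mathcal M=\{x_1,\dots,x_M\}$, $\overline{\mathcal M}=\{x_0,\dots,x_{M+1}\}$, $\mathcal M^*=\{x_{j+1/2}:0\le j\le M\}$, $\mathcal N=\{t^1,\dots,t^N\}$, $\overline{\mathcal N}=\mathcal N\cup\{0\}$, $\mathcal N^*=\{t^{n+1/2}:0\le n\le N-1\}$. Because the scheme is imposed at $t=t^1,\dots,t^N$, $y$ is defined at $t^0,\dots,t^{N+1}$, with homogeneous boundary values at all these times (in particular $y_0$ vanishes at $x=0,1$). Operators. $\mathbf s_\pm u(x,t)=u(x\pm\frac{\Delta x}2,t)$, $\mathbf t^\pm u(x,t)=u(x,t\pm\frac{\Delta t}2)$, $\mathbf A_xu=\frac{\mathbf s_+u+\mathbf s_-u}2$, $\mathbf D_xu=\frac{\mathbf s_+u-\mathbf s_-u}{\Delta x}$, $\mathbf D_tu=\frac{\mathbf t^+u-\mathbf t^-u}{\Delta t}$, $\mathbf d_tu=\Delta t\,\mathbf D_tu=\mathbf t^+u-\mathbf t^-u$. Thus $\mathbf t^+(\mathbf d_tB)$ at $t^n$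 equals $B(t^{n+1})-B(t^n)$, and $\mathbf t^+(z)(x,0)=(y(x,t^1)-y(x,0))/\Delta t$. The trace $\mathbf{tr}(u)$ at $x=0$ is $u(\frac{\Delta x}2)$. Norms. $\|u\|_{L^2(\mathcal M)}^2=\sum_{x\in\mathcal M}|u|^2\Delta x$, $\|u\|_{H^1(\mathcal M)}^2=\sum_{x\in\mathcal M^*}|\mathbf D_xu|^2\Delta x+\sum_{x\in\mathcal M}|u|^2\Delta x$, $\|v\|_{L^2(\mathcal N)}^2=\sum_{t\in\mathcal N}|v|^2\Delta t$, $\|u\|_{L^2(\mathcal M\times\mathcal N)}^2=\sum_{x\in\mathcal M}\sum_{t\in\mathcal N}|u|^2\Delta x\Delta t$, and similarly on $\mathcal M^*\times\mathcal N^*$. For a discrete Banach space $\mathcal Y$, $L^2_{\mathcal F}(\Omega;\mathcal Y)$ is the space of progressively measurable (adapted: the value at $t^n$ is $\mathcal F_{t^n}$-measurable) processes $\zeta$ with $\mathbb E\|\zeta\|_{\mathcal Y}^2<\infty$, with norm $(\mathbb E\|\zeta\|_{\mathcal Y}^2)^{1/2}$; $L^\infty_{\mathcal F}(\Omega;\mathcal Y)$ is the analogous space of essentially bounded processes; initial data are $\mathcal F_0$-measurable. Parameters. $x^*,\beta,M_0$ are the parameters of the function $\phi(x,t)=|x-x^*|^2-\beta|t-T|^2+M_0$, where $M_0>0$ is a large constant such that $\phi>0$ on $Q$. The condition $\Delta t=\varepsilon\,\mathcal O((\Delta x)^2)$ means $\Delta t\le C_0\,\varepsilon(\Delta x)^2$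 for a fixed constant $C_0>0$. The constants $C,\widehat{\Delta x},\varepsilon$ do not depend on $\Delta x,\Delta t$. *)

theory Defs
  imports "HOL-Probability.Probability"
begin

section \<open>Probabilistic setting\<close>

locale brownian_space = prob_space P + complete_measure P
  for P :: "'a measure" +
  fixes B :: "real \<Rightarrow> 'a \<Rightarrow> real"
  assumes B_measurable: "\<And>t. 0 \<le> t \<Longrightarrow> B t \<in> borel_measurable P"
    and B_start: "AE \<omega> in P. B 0 \<omega> = 0"
    and B_indep_increments:
      "\<And>(s :: nat \<Rightarrow> real) n. 0 \<le> s 0 \<Longrightarrow> strict_mono_on {..n} s \<Longrightarrow>
         indep_vars (\<lambda>_. borel) (\<lambda>i \<omega>. B (s (Suc i)) \<omega> - B (s i) \<omega>) {..<n}"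
    and B_normal_increments:
      "\<And>s t. 0 \<le> s \<Longrightarrow> s < t \<Longrightarrow>
         distributed P lborel (\<lambda>\<omega>. B t \<omega> - B s \<omega>) (normal_density 0 (sqrt (t - s)))"
    and B_continuous: "AE \<omega> in P. continuous_on {0..} (\<lambda>t. B t \<omega>)"

text \<open>The natural filtration of \<open>B\<close>, augmented by the null sets of \<open>P\<close>.\<close>

definition augfilt :: "'a measure \<Rightarrow> (real \<Rightarrow> 'a \<Rightarrow> real) \<Rightarrow> real \<Rightarrow> 'a measure" where
  "augfilt P B t =
     sigma (space P)
       ({B s -` A \<inter> space P | s A. 0 \<le> s \<and> s \<le> t \<and> A \<in> sets borel} \<union> null_sets P)"

section \<open>Meshes\<close>

text \<open>
  Mesh functions are functions of the real coordinates \<open>x\<close> and \<open>t\<close>; only their values on the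
  meshes matter. A random mesh function takes the sample point as its first argument.
\<close>

definition dx :: "nat \<Rightarrow> real" where
  "dx M = 1 / (real M + 1)"

definition dt :: "real \<Rightarrow> nat \<Rightarrow> real" where
  "dt T N = T / real N"

definition xmesh :: "nat \<Rightarrow> real set" where
  "xmesh M = (\<lambda>j. real j * dx M) ` {1..M}"

definition xmesh_bar :: "nat \<Rightarrow> real set" where
  "xmesh_bar M = (\<lambda>j. real j * dx M) ` {0..M + 1}"

definition xmesh_star :: "nat \<Rightarrow> real set" where
  "xmesh_star M = (\<lambda>j. (real j + 1/2) * dx M) ` {0..M}"

definition tmesh :: "real \<Rightarrow> nat \<Rightarrow> real set" where
  "tmesh T N = (\<lambda>n. real n * dt T N) ` {1..N}"

definition tmesh_bar :: "real \<Rightarrow> nat \<Rightarrow> real set" where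
  "tmesh_bar T N = (\<lambda>n. real n * dt T N) ` {0..N}"

definition tmesh_star :: "real \<Rightarrow> nat \<Rightarrow> real set" where
  "tmesh_star T N = (\<lambda>n. (real n + 1/2) * dt T N) ` {..<N}"

text \<open>The times \<open>t\<^sup>0, \<dots>, t\<^sup>N\<^sup>+\<^sup>1\<close> at which solutions of the scheme live.\<close>

definition tmesh_ext :: "real \<Rightarrow> nat \<Rightarrow> real set" where
  "tmesh_ext T N = (\<lambda>n. real n * dt T N) ` {0..N + 1}"

section \<open>Difference and averaging operators\<close>

text \<open>In one variable, with step \<open>h\<close>.\<close>

definition shift_pos :: "real \<Rightarrow> (real \<Rightarrow> real) \<Rightarrow> real \<Rightarrow> real" where
  "shift_pos h f s = f (s + h / 2)"

definition shift_neg :: "real \<Rightarrow> (real \<Rightarrow> real) \<Rightarrow> real \<Rightarrow> real" where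
  "shift_neg h f s = f (s - h / 2)"

definition average :: "real \<Rightarrow> (real \<Rightarrow> real) \<Rightarrow> real \<Rightarrow> real" where
  "average h f s = (shift_pos h f s + shift_neg h f s) / 2"

definition increment :: "real \<Rightarrow> (real \<Rightarrow> real) \<Rightarrow> real \<Rightarrow> real" where
  "increment h f s = shift_pos h f s - shift_neg h f s"

definition diffquot :: "real \<Rightarrow> (real \<Rightarrow> real) \<Rightarrow> real \<Rightarrow> real" where
  "diffquot h f s = (shift_pos h f s - shift_neg h f s) / h"

text \<open>Acting on the space or time variable of functions of \<open>(x, t)\<close>.\<close>

definition Ax :: "real \<Rightarrow> (real \<Rightarrow> real \<Rightarrow> real) \<Rightarrow> real \<Rightarrow> real \<Rightarrow> real" where
  "Ax h u = (\<lambda>x t. average h (\<lambda>\<xi>. u \<xi> t) x)"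

definition Dx :: "real \<Rightarrow> (real \<Rightarrow> real \<Rightarrow> real) \<Rightarrow> real \<Rightarrow> real \<Rightarrow> real" where
  "Dx h u = (\<lambda>x t. diffquot h (\<lambda>\<xi>. u \<xi> t) x)"

definition Dt :: "real \<Rightarrow> (real \<Rightarrow> real \<Rightarrow> real) \<Rightarrow> real \<Rightarrow> real \<Rightarrow> real" where
  "Dt k u = (\<lambda>x t. diffquot k (u x) t)"

definition incr_t :: "real \<Rightarrow> (real \<Rightarrow> real \<Rightarrow> real) \<Rightarrow> real \<Rightarrow> real \<Rightarrow> real" where
  "incr_t k u = (\<lambda>x t. increment k (u x) t)"

definition t_pos :: "real \<Rightarrow> (real \<Rightarrow> real \<Rightarrow> real) \<Rightarrow> real \<Rightarrow> real \<Rightarrow> real" where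
  "t_pos k u = (\<lambda>x t. shift_pos k (u x) t)"

definition t_neg :: "real \<Rightarrow> (real \<Rightarrow> real \<Rightarrow> real) \<Rightarrow> real \<Rightarrow> real \<Rightarrow> real" where
  "t_neg k u = (\<lambda>x t. shift_neg k (u x) t)"

text \<open>The trace at \<open>x = 0\<close> of a function on the dual mesh.\<close>

definition trace0 :: "real \<Rightarrow> (real \<Rightarrow> real \<Rightarrow> real) \<Rightarrow> real \<Rightarrow> real" where
  "trace0 h u t = u (h / 2) t"

section \<open>Norms and spaces\<close>

definition L2_xnorm :: "nat \<Rightarrow> (real \<Rightarrow> real) \<Rightarrow> real" where
  "L2_xnorm M v = sqrt (\<Sum>x\<in>xmesh M. \<bar>v x\<bar>\<^sup>2 * dx M)"

definition H1_xnorm :: "nat \<Rightarrow> (real \<Rightarrow> real) \<Rightarrow> real" where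
  "H1_xnorm M v =
     sqrt ((\<Sum>x\<in>xmesh_star M. \<bar>diffquot (dx M) v x\<bar>\<^sup>2 * dx M) + (\<Sum>x\<in>xmesh M. \<bar>v x\<bar>\<^sup>2 * dx M))"

definition L2_tnorm :: "real \<Rightarrow> nat \<Rightarrow> (real \<Rightarrow> real) \<Rightarrow> real" where
  "L2_tnorm T N v = sqrt (\<Sum>t\<in>tmesh T N. \<bar>v t\<bar>\<^sup>2 * dt T N)"

definition L2_norm :: "nat \<Rightarrow> real \<Rightarrow> nat \<Rightarrow> (real \<Rightarrow> real \<Rightarrow> real) \<Rightarrow> real" where
  "L2_norm M T N u = sqrt (\<Sum>x\<in>xmesh M. \<Sum>t\<in>tmesh T N. \<bar>u x t\<bar>\<^sup>2 * dx M * dt T N)"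

definition L2_norm_star :: "nat \<Rightarrow> real \<Rightarrow> nat \<Rightarrow> (real \<Rightarrow> real \<Rightarrow> real) \<Rightarrow> real" where
  "L2_norm_star M T N u =
     sqrt (\<Sum>x\<in>xmesh_star M. \<Sum>t\<in>tmesh_star T N. \<bar>u x t\<bar>\<^sup>2 * dx M * dt T N)"

text \<open>The norm of \<open>L\<^sup>2(\<Omega>; Y)\<close>, where \<open>nrm\<close> is the norm of the discrete space \<open>Y\<close>.\<close>

definition L2\<Omega>_norm :: "'a measure \<Rightarrow> ('y \<Rightarrow> real) \<Rightarrow> ('a \<Rightarrow> 'y) \<Rightarrow> real" where
  "L2\<Omega>_norm P nrm \<zeta> = sqrt (\<integral>\<omega>. (nrm (\<zeta> \<omega>))\<^sup>2 \<partial>P)"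

definition adapted ::
  "'a measure \<Rightarrow> (real \<Rightarrow> 'a \<Rightarrow> real) \<Rightarrow> real set \<Rightarrow> real set \<Rightarrow> ('a \<Rightarrow> real \<Rightarrow> real \<Rightarrow> real) \<Rightarrow> bool"
where
  "adapted P B X S u \<longleftrightarrow>
     (\<forall>x\<in>X. \<forall>t\<in>S. (\<lambda>\<omega>. u \<omega> x t) \<in> borel_measurable (augfilt P B t))"

definition L2F ::
  "'a measure \<Rightarrow> (real \<Rightarrow> 'a \<Rightarrow> real) \<Rightarrow> nat \<Rightarrow> real \<Rightarrow> nat \<Rightarrow> ('a \<Rightarrow> real \<Rightarrow> real \<Rightarrow> real) set"
where
  "L2F P B M T N =
     {u. adapted P B (xmesh M) (tmesh T N) u \<and> integrable P (\<lambda>\<omega>. (L2_norm M T N (u \<omega>))\<^sup>2)}"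

text \<open>
  Random functions of \<open>x\<close> alone are measurable with respect to the \<open>\<sigma>\<close>-algebra at the time \<open>\<tau>\<close>
  at which they are prescribed: \<open>\<tau> = 0\<close> for initial data, \<open>\<tau> = T\<close> for terminal data.
  The discrete \<open>H\<^sup>1\<close> norm involves the boundary nodes.
\<close>

definition L2F_x ::
  "'a measure \<Rightarrow> (real \<Rightarrow> 'a \<Rightarrow> real) \<Rightarrow> nat \<Rightarrow> real \<Rightarrow> ('a \<Rightarrow> real \<Rightarrow> real) set"
where
  "L2F_x P B M \<tau> =
     {v. (\<forall>x\<in>xmesh M. (\<lambda>\<omega>. v \<omega> x) \<in> borel_measurable (augfilt P B \<tau>)) \<and>
         integrable P (\<lambda>\<omega>. (L2_xnorm M (v \<omega>))\<^sup>2)}"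

definition H1F_x ::
  "'a measure \<Rightarrow> (real \<Rightarrow> 'a \<Rightarrow> real) \<Rightarrow> nat \<Rightarrow> real \<Rightarrow> ('a \<Rightarrow> real \<Rightarrow> real) set"
where
  "H1F_x P B M \<tau> =
     {v. (\<forall>x\<in>xmesh_bar M. (\<lambda>\<omega>. v \<omega> x) \<in> borel_measurable (augfilt P B \<tau>)) \<and>
         integrable P (\<lambda>\<omega>. (H1_xnorm M (v \<omega>))\<^sup>2)}"

definition LinfF_norm ::
  "'a measure \<Rightarrow> nat \<Rightarrow> real \<Rightarrow> nat \<Rightarrow> ('a \<Rightarrow> real \<Rightarrow> real \<Rightarrow> real) \<Rightarrow> ereal"
where
  "LinfF_norm P M T N u =
     esssup P (\<lambda>\<omega>. SUP x\<in>xmesh_bar M. SUP t\<in>tmesh_bar T N. ereal \<bar>u \<omega> x t\<bar>)"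

definition LinfF ::
  "'a measure \<Rightarrow> (real \<Rightarrow> 'a \<Rightarrow> real) \<Rightarrow> nat \<Rightarrow> real \<Rightarrow> nat \<Rightarrow> ('a \<Rightarrow> real \<Rightarrow> real \<Rightarrow> real) set"
where
  "LinfF P B M T N =
     {u. adapted P B (xmesh_bar M) (tmesh_bar T N) u \<and> LinfF_norm P M T N u < \<infinity>}"

section \<open>The inverse problem\<close>

definition weight_phi :: "real \<Rightarrow> real \<Rightarrow> real \<Rightarrow> real \<Rightarrow> real \<Rightarrow> real \<Rightarrow> real" where
  "weight_phi xs \<beta> T M0 x t = \<bar>x - xs\<bar>\<^sup>2 - \<beta> * \<bar>t - T\<bar>\<^sup>2 + M0"

definition admissible ::
  "'a measure \<Rightarrow> (real \<Rightarrow> 'a \<Rightarrow> real) \<Rightarrow> nat \<Rightarrow> real \<Rightarrow> nat \<Rightarrow> real \<Rightarrow> ('a \<Rightarrow> real \<Rightarrow> real) \<Rightarrow>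
     (('a \<Rightarrow> real \<Rightarrow> real \<Rightarrow> real) \<times> ('a \<Rightarrow> real \<Rightarrow> real) \<times> ('a \<Rightarrow> real \<Rightarrow> real)) set"
where
  "admissible P B M T N R gbar =
     {(g, y0, y1).
        g \<in> L2F P B M T N \<and> y0 \<in> H1F_x P B M 0 \<and> y1 \<in> L2F_x P B M 0 \<and>
        (AE \<omega> in P. \<forall>x\<in>xmesh M. g \<omega> x T = gbar \<omega> x) \<and>
        L2\<Omega>_norm P (L2_norm M T N) g + L2\<Omega>_norm P (H1_xnorm M) y0
          + L2\<Omega>_norm P (L2_xnorm M) y1 \<le> R}"

text \<open>
  Boundary values vanish at all times \<open>t\<^sup>0, \<dots>, t\<^sup>N\<^sup>+\<^sup>1\<close>, so that the initial conditions force
  \<open>y0\<close> and \<open>y1\<close> to vanish at \<open>x = 0, 1\<close>. Square integrability of \<open>y\<close> is not demanded: it follows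
  from the recursion, since \<open>B (t\<^sup>n\<^sup>+\<^sup>1) - B (t\<^sup>n)\<close> is independent of the past.
\<close>

definition scheme_solution ::
  "'a measure \<Rightarrow> (real \<Rightarrow> 'a \<Rightarrow> real) \<Rightarrow> nat \<Rightarrow> real \<Rightarrow> nat \<Rightarrow>
     ('a \<Rightarrow> real \<Rightarrow> real \<Rightarrow> real) \<Rightarrow> ('a \<Rightarrow> real \<Rightarrow> real \<Rightarrow> real) \<Rightarrow>
     ('a \<Rightarrow> real \<Rightarrow> real \<Rightarrow> real) \<Rightarrow> ('a \<Rightarrow> real \<Rightarrow> real \<Rightarrow> real) \<Rightarrow>
     ('a \<Rightarrow> real \<Rightarrow> real \<Rightarrow> real) \<Rightarrow> ('a \<Rightarrow> real \<Rightarrow> real) \<Rightarrow> ('a \<Rightarrow> real \<Rightarrow> real) \<Rightarrow>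
     ('a \<Rightarrow> real \<Rightarrow> real \<Rightarrow> real) \<Rightarrow> bool"
where
  "scheme_solution P B M T N a b c d g y0 y1 y \<longleftrightarrow>
     adapted P B (xmesh_bar M) (tmesh_ext T N) y \<and>
     (AE \<omega> in P. \<forall>x\<in>xmesh M. \<forall>t\<in>tmesh T N.
        let z = Dt (dt T N) (y \<omega>) in
        incr_t (dt T N) z x t - Dx (dx M) (Dx (dx M) (y \<omega>)) x t * dt T N
        = (a \<omega> x t * y \<omega> x t + b \<omega> x t * Ax (dx M) (Dx (dx M) (y \<omega>)) x t
             + c \<omega> x t * t_neg (dt T N) z x t) * dt T N
          + (d \<omega> x t * y \<omega> x t + g \<omega> x t)
             * shift_pos (dt T N) (increment (dt T N) (\<lambda>s. B s \<omega>)) t) \<and>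
     (AE \<omega> in P. \<forall>t\<in>tmesh_ext T N. y \<omega> 0 t = 0 \<and> y \<omega> 1 t = 0) \<and>
     (AE \<omega> in P. \<forall>x\<in>xmesh_bar M.
        y \<omega> x 0 = y0 \<omega> x \<and> t_pos (dt T N) (Dt (dt T N) (y \<omega>)) x 0 = y1 \<omega> x)"

end

theory Submission
  imports Defs
begin

text \<open>
  The scheme is linear, so the difference \<open>y\<close> of the two solutions solves it with the source
  \<open>g = g1 - g2\<close> and the initial data \<open>y01 - y02\<close>, \<open>y11 - y12\<close>. Let \<open>z\<close> be its velocity, \<open>v\<close> its slope,
  and let \<open>e\<close> and \<open>p\<close> be the expectations of \<open>(z\<^sup>2 + v\<^sup>2) / 2\<close> and \<open>z v\<close>. Up to lower-order terms
  bounded by the energy, the wave operator gives two balance laws,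
  \<open>e\<^sub>t - p\<^sub>x = (dy + g)\<^sup>2 / 2\<close> (in expectation) and \<open>e\<^sub>x - p\<^sub>t = 0\<close>.
  They come from the multipliers \<open>z\<close> and \<open>v\<close>. Both are adapted, so that the martingale terms have
  mean zero; the Ito correction is present only in the first law, because \<open>v\<close> has bounded variation
  in time.

  Sideways: multiply the second law by \<open>\<theta> = exp (\<rho> (t - \<gamma> x))\<close> with \<open>1 < \<gamma> < T\<close>. As \<open>\<bar>p\<bar> \<le> e\<close>, the
  interior term is at least \<open>\<rho> (\<gamma> - 1) \<theta> e\<close>, which absorbs all lower-order terms once \<open>\<rho>\<close> is large
  (\<open>sideways_step\<close>). The boundary \<open>x = 1\<close> has a good sign, \<open>x = 0\<close> contributes the observed trace,
  \<open>t = T\<close> contributes \<open>p (T)\<close>, and \<open>t = 0\<close> contributes at most a multiple of the initial energy,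
  since \<open>\<theta> \<le> 1\<close> there. The boundary term does not grow with \<open>\<rho>\<close>, while the interior term does.

  Backwards: noise can only add energy, so the first law bounds the initial energy by the energy at
  any later time, without any knowledge of \<open>g\<close> (\<open>energy_backward\<close>). For \<open>t \<ge> \<gamma>\<close> the weight is at
  least \<open>1\<close> on the whole interval, hence the initial energy is controlled by the weighted energy
  and the bottom term is absorbed (\<open>observability\<close>). This is the use of \<open>T > 1\<close>, which
  follows from \<open>T > sup \<bar>x - xs\<bar> / \<beta>\<close> because \<open>xs > 1 > \<beta>\<close>.

  The source: the first law integrated against \<open>T - t\<close> bounds the weighted norm of \<open>dy + g\<close>, and
  with it that of \<open>g\<close>, by the energy (\<open>weighted_noise_energy\<close>); the weight removes the unknown
  energy at time \<open>T\<close>. The final momentum is at most \<open>\<parallel>z (T)\<parallel> \<parallel>v (T)\<parallel>\<close>, where only an a priori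
  bound in terms of \<open>R\<close> is known for the first factor (\<open>energy_forward\<close>): hence the square root of
  the norm of \<open>y (T)\<close>.

  Discretization: all integrations by parts in space are exact summations by parts, except that
  they produce \<open>z\<^sub>j z\<^sub>j\<^sub>+\<^sub>1\<close> in place of \<open>z\<^sub>j\<^sup>2\<close>. The defect \<open>(z\<^sub>j\<^sub>+\<^sub>1 - z\<^sub>j)\<^sup>2\<close> is the density of the third
  term on the right-hand side of the theorem. The errors of the time stepping are at most
  \<open>\<Delta>t\<close> times the energy by an inverse inequality, because \<open>\<Delta>t\<close> is of order \<open>(\<Delta>x)\<^sup>2\<close>.
\<close>

section \<open>Discrete calculus on the spatial mesh\<close>

definition slope :: "real \<Rightarrow> (nat \<Rightarrow> real) \<Rightarrow> nat \<Rightarrow> real" where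
  "slope h u i = (u (Suc i) - u i) / h"

text \<open>
  Interior nodes are numbered \<open>Suc i\<close> with \<open>i < M\<close>: the values of \<open>mid_slope\<close> and \<open>laplace\<close> at
  \<open>i\<close> belong to the node \<open>Suc i\<close>, the value of \<open>slope\<close> at \<open>i\<close> to the midpoint after node \<open>i\<close>.
\<close>

definition mid_slope :: "real \<Rightarrow> (nat \<Rightarrow> real) \<Rightarrow> nat \<Rightarrow> real" where
  "mid_slope h u i = (u (Suc (Suc i)) - u i) / (2 * h)"

definition laplace :: "real \<Rightarrow> (nat \<Rightarrow> real) \<Rightarrow> nat \<Rightarrow> real" where
  "laplace h u i = (u (Suc (Suc i)) - 2 * u (Suc i) + u i) / h\<^sup>2"

lemma mid_slope_slope: "mid_slope h u i = (slope h u i + slope h u (Suc i)) / 2"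
  by (simp add: mid_slope_def slope_def add_divide_distrib[symmetric])

lemma laplace_slope: "h \<noteq> 0 \<Longrightarrow> laplace h u i = (slope h u (Suc i) - slope h u i) / h"
  by (simp add: laplace_def slope_def field_simps power2_eq_square)

lemma abel_summation:
  fixes \<theta> c :: "nat \<Rightarrow> real"
  shows "(\<Sum>i<M. \<theta> (Suc i) * (c (Suc i) - c i))
       = (\<Sum>i<Suc M. (\<theta> i - \<theta> (Suc i)) * c i) + \<theta> (Suc M) * c M - \<theta> 0 * c 0"
  by (induction M) (simp_all add: algebra_simps)

lemma laplace_by_parts:
  assumes "h \<noteq> 0" "w 0 = 0" "w (Suc M) = 0"
  shows "(\<Sum>i<M. laplace h u i * w (Suc i)) = - (\<Sum>i<Suc M. slope h u i * slope h w i)"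
proof -
  have "(\<Sum>i<M. w (Suc i) * (slope h u (Suc i) - slope h u i))
      = (\<Sum>i<Suc M. (w i - w (Suc i)) * slope h u i)"
    using abel_summation[of w "slope h u" M] assms by simp
  moreover have "laplace h u i * w (Suc i) = w (Suc i) * (slope h u (Suc i) - slope h u i) / h" for i
    by (simp add: laplace_slope[OF assms(1)])
  moreover have "slope h u i * slope h w i = - ((w i - w (Suc i)) * slope h u i / h)" for i
    using assms(1) by (simp add: slope_def[of h w] field_simps)
  ultimately show ?thesis
    by (simp only: sum_divide_distrib[symmetric] sum_negf minus_minus)
qed

text \<open>
  Write \<open>u\<close> at a node as the sum of the slopes to the left of it and use Cauchy-Schwarz. A weight
  that decreases in space may be moved under this sum, so no derivative of the weight appears.
\<close>

lemma weighted_poincare: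
  fixes \<theta> u :: "nat \<Rightarrow> real"
  assumes h: "0 < h" "real (Suc M) * h = 1" and u0: "u 0 = 0"
    and \<theta>: "antimono \<theta>" "\<And>i. 0 \<le> \<theta> i"
  shows "(\<Sum>i<M. \<theta> (Suc i) * (u (Suc i))\<^sup>2) \<le> (\<Sum>i<Suc M. \<theta> i * (slope h u i)\<^sup>2)"
proof -
  let ?S = "\<Sum>i<Suc M. \<theta> i * (slope h u i)\<^sup>2"
  have S0: "0 \<le> ?S" by (intro sum_nonneg mult_nonneg_nonneg \<theta>) auto
  have tele: "u j = h * (\<Sum>i<j. slope h u i)" for j
    by (induction j) (use h u0 in \<open>auto simp: slope_def field_simps\<close>)
  have bound: "\<theta> j * (u j)\<^sup>2 \<le> h * ?S" if "j \<le> M" for j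
  proof -
    have "(u j)\<^sup>2 = h\<^sup>2 * (\<Sum>i<j. slope h u i)\<^sup>2"
      by (subst tele) (simp add: power_mult_distrib)
    also have "\<dots> \<le> h\<^sup>2 * (real j * (\<Sum>i<j. (slope h u i)\<^sup>2))"
      using sum_squared_le_sum_of_squares[of "\<lambda>i. slope h u i" "{..<j}"]
      by (intro mult_left_mono) (auto simp: mult.commute)
    finally have "\<theta> j * (u j)\<^sup>2 \<le> \<theta> j * (h\<^sup>2 * (real j * (\<Sum>i<j. (slope h u i)\<^sup>2)))"
      by (intro mult_left_mono \<theta>)
    also have "\<dots> = h\<^sup>2 * real j * (\<Sum>i<j. \<theta> j * (slope h u i)\<^sup>2)"
      by (simp add: sum_distrib_left mult_ac)
    also have "\<dots> \<le> h\<^sup>2 * real (Suc M) * ?S"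
    proof (intro mult_mono)
      have "(\<Sum>i<j. \<theta> j * (slope h u i)\<^sup>2) \<le> (\<Sum>i<j. \<theta> i * (slope h u i)\<^sup>2)"
        using \<theta>(1) by (intro sum_mono mult_right_mono) (auto simp: antimono_def)
      also have "\<dots> \<le> ?S"
        using that \<theta> by (intro sum_mono2) auto
      finally show "(\<Sum>i<j. \<theta> j * (slope h u i)\<^sup>2) \<le> ?S" .
    qed (use that \<theta> in \<open>auto intro!: sum_nonneg\<close>)
    also have "h\<^sup>2 * real (Suc M) = h" using h(2) by (simp add: power2_eq_square mult_ac)
    finally show ?thesis .
  qed
  have "(\<Sum>i<M. \<theta> (Suc i) * (u (Suc i))\<^sup>2) \<le> (\<Sum>i<M. h * ?S)"
    by (intro sum_mono bound) auto
  also have "\<dots> = (real M * h) * ?S" by simp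
  also have "\<dots> \<le> 1 * ?S"
    using h by (intro mult_right_mono S0) (simp add: algebra_simps)
  finally show ?thesis by simp
qed

text \<open>
  The centred slope is the mean of two neighbouring slopes, and the weight decreases.
\<close>

lemma weighted_mid_slope:
  fixes \<theta> u :: "nat \<Rightarrow> real"
  assumes \<theta>: "antimono \<theta>" "\<And>i. 0 \<le> \<theta> i"
  shows "(\<Sum>i<M. \<theta> (Suc i) * (mid_slope h u i)\<^sup>2) \<le> (\<Sum>i<Suc M. \<theta> i * (slope h u i)\<^sup>2)"
proof -
  let ?s = "\<lambda>i. (slope h u i)\<^sup>2"
  have "\<theta> (Suc i) * (mid_slope h u i)\<^sup>2 \<le> (\<theta> i * ?s i + \<theta> (Suc i) * ?s (Suc i)) / 2" for i
  proof -
    have "0 \<le> (slope h u i - slope h u (Suc i))\<^sup>2" by simp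
    then have "(mid_slope h u i)\<^sup>2 \<le> (?s i + ?s (Suc i)) / 2"
      by (simp add: mid_slope_slope power2_eq_square field_simps)
    then have "\<theta> (Suc i) * (mid_slope h u i)\<^sup>2 \<le> \<theta> (Suc i) * ((?s i + ?s (Suc i)) / 2)"
      by (intro mult_left_mono \<theta>)
    also have "\<dots> = (\<theta> (Suc i) * ?s i + \<theta> (Suc i) * ?s (Suc i)) / 2" by (simp add: field_simps)
    also have "\<dots> \<le> (\<theta> i * ?s i + \<theta> (Suc i) * ?s (Suc i)) / 2"
    proof -
      have "\<theta> (Suc i) \<le> \<theta> i" using \<theta>(1) by (simp add: antimono_def)
      then have "\<theta> (Suc i) * ?s i \<le> \<theta> i * ?s i" by (rule mult_right_mono) simp
      then show ?thesis by simp
    qed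
    finally show ?thesis .
  qed
  then have "(\<Sum>i<M. \<theta> (Suc i) * (mid_slope h u i)\<^sup>2)
      \<le> (\<Sum>i<M. (\<theta> i * ?s i + \<theta> (Suc i) * ?s (Suc i)) / 2)"
    by (rule sum_mono)
  also have "\<dots> = ((\<Sum>i<M. \<theta> i * ?s i) + (\<Sum>i<M. \<theta> (Suc i) * ?s (Suc i))) / 2"
    by (simp add: sum_divide_distrib[symmetric] sum.distrib)
  also have "\<dots> \<le> (\<Sum>i<Suc M. \<theta> i * ?s i)"
  proof -
    have "(\<Sum>i<M. \<theta> i * ?s i) \<le> (\<Sum>i<Suc M. \<theta> i * ?s i)"
      using \<theta>(2)[of M] by simp
    moreover have "(\<Sum>i<M. \<theta> (Suc i) * ?s (Suc i)) \<le> (\<Sum>i<Suc M. \<theta> i * ?s i)"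
      using \<theta>(2)[of 0] by (simp only: sum.lessThan_Suc_shift) simp
    ultimately show ?thesis by simp
  qed
  finally show ?thesis .
qed

text \<open>
  Inverse inequalities: a difference quotient costs one power of the mesh size. Under
  \<open>4 k \<le> h\<^sup>2\<close> they turn squared time-stepping errors into \<open>k\<close> times the energy.
\<close>

lemma inverse_slope:
  assumes "h \<noteq> 0" "u 0 = 0" "u (Suc M) = 0"
  shows "h\<^sup>2 * (\<Sum>i<Suc M. (slope h u i)\<^sup>2) \<le> 4 * (\<Sum>i<M. (u (Suc i))\<^sup>2)"
proof -
  have "h\<^sup>2 * (slope h u i)\<^sup>2 \<le> 2 * (u i)\<^sup>2 + 2 * (u (Suc i))\<^sup>2" for i
  proof -
    have "h\<^sup>2 * (slope h u i)\<^sup>2 = (u (Suc i) - u i)\<^sup>2"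
      using assms by (simp add: slope_def power_divide)
    moreover have "0 \<le> (u (Suc i) + u i)\<^sup>2" by simp
    ultimately show ?thesis by (simp add: power2_eq_square algebra_simps)
  qed
  then have "h\<^sup>2 * (\<Sum>i<Suc M. (slope h u i)\<^sup>2) \<le> (\<Sum>i<Suc M. 2 * (u i)\<^sup>2 + 2 * (u (Suc i))\<^sup>2)"
    unfolding sum_distrib_left by (rule sum_mono)
  also have "\<dots> = 2 * (\<Sum>i<Suc M. (u i)\<^sup>2) + 2 * (\<Sum>i<Suc M. (u (Suc i))\<^sup>2)"
    by (simp only: sum.distrib sum_distrib_left)
  also have "(\<Sum>i<Suc M. (u i)\<^sup>2) = (\<Sum>i<M. (u (Suc i))\<^sup>2)"
    using assms by (simp only: sum.lessThan_Suc_shift) simp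
  also have "(\<Sum>i<Suc M. (u (Suc i))\<^sup>2) = (\<Sum>i<M. (u (Suc i))\<^sup>2)"
    using assms by simp
  finally show ?thesis by simp
qed

lemma inverse_laplace:
  assumes "h \<noteq> 0"
  shows "h\<^sup>2 * (\<Sum>i<M. (laplace h u i)\<^sup>2) \<le> 4 * (\<Sum>i<Suc M. (slope h u i)\<^sup>2)"
proof -
  let ?s = "\<lambda>i. (slope h u i)\<^sup>2"
  have "h\<^sup>2 * (laplace h u i)\<^sup>2 \<le> 2 * ?s i + 2 * ?s (Suc i)" for i
  proof -
    have "h\<^sup>2 * (laplace h u i)\<^sup>2 = (slope h u (Suc i) - slope h u i)\<^sup>2"
      using assms by (simp add: laplace_slope power_divide)
    moreover have "0 \<le> (slope h u (Suc i) + slope h u i)\<^sup>2" by simp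
    ultimately show ?thesis by (simp add: power2_eq_square algebra_simps)
  qed
  then have "h\<^sup>2 * (\<Sum>i<M. (laplace h u i)\<^sup>2) \<le> (\<Sum>i<M. 2 * ?s i + 2 * ?s (Suc i))"
    unfolding sum_distrib_left by (rule sum_mono)
  also have "\<dots> = 2 * (\<Sum>i<M. ?s i) + 2 * (\<Sum>i<M. ?s (Suc i))"
    by (simp only: sum.distrib sum_distrib_left)
  also have "\<dots> \<le> 2 * (\<Sum>i<Suc M. ?s i) + 2 * (\<Sum>i<Suc M. ?s i)"
  proof -
    have "(\<Sum>i<M. ?s (Suc i)) \<le> (\<Sum>i<Suc M. ?s i)"
      by (simp only: sum.lessThan_Suc_shift) simp
    moreover have "(\<Sum>i<M. ?s i) \<le> (\<Sum>i<Suc M. ?s i)" by simp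
    ultimately show ?thesis by linarith
  qed
  finally show ?thesis by simp
qed

text \<open>
  The discrete form of \<open>v v\<^sub>x = (v\<^sup>2 / 2)\<^sub>x\<close>: the product of the centred slope and the second
  difference is an exact difference of squared slopes. The boundary term at \<open>x = 1\<close> is nonnegative
  and is dropped; the one at \<open>x = 0\<close> is the trace.
\<close>

lemma virial_laplace:
  fixes \<theta> u :: "nat \<Rightarrow> real"
  assumes h: "0 < h" and \<theta>: "\<And>i. \<theta> (Suc i) = \<kappa> * \<theta> i" "\<And>i. 0 \<le> \<theta> i"
  shows "(1 - \<kappa>) * (\<Sum>i<Suc M. \<theta> i * (slope h u i)\<^sup>2) - \<theta> 0 * (slope h u 0)\<^sup>2
       \<le> 2 * h * (\<Sum>i<M. \<theta> (Suc i) * (mid_slope h u i * laplace h u i))"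
proof -
  let ?s = "\<lambda>i. (slope h u i)\<^sup>2"
  have "2 * h * (\<theta> (Suc i) * (mid_slope h u i * laplace h u i)) = \<theta> (Suc i) * (?s (Suc i) - ?s i)" for i
  proof -
    have "2 * h * (mid_slope h u i * laplace h u i) = ?s (Suc i) - ?s i"
      using h by (simp add: mid_slope_slope laplace_slope power2_eq_square field_simps)
    then show ?thesis by (metis mult.left_commute)
  qed
  then have "2 * h * (\<Sum>i<M. \<theta> (Suc i) * (mid_slope h u i * laplace h u i))
      = (\<Sum>i<M. \<theta> (Suc i) * (?s (Suc i) - ?s i))"
    by (simp only: sum_distrib_left)
  also have "\<dots> = (\<Sum>i<Suc M. (\<theta> i - \<theta> (Suc i)) * ?s i) + \<theta> (Suc M) * ?s M - \<theta> 0 * ?s 0"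
    by (rule abel_summation)
  also have "(\<Sum>i<Suc M. (\<theta> i - \<theta> (Suc i)) * ?s i) = (1 - \<kappa>) * (\<Sum>i<Suc M. \<theta> i * ?s i)"
    unfolding sum_distrib_left by (intro sum.cong) (auto simp: \<theta>(1) algebra_simps)
  finally show ?thesis using \<theta>(2)[of "Suc M"] by simp
qed

text \<open>
  The discrete form of \<open>w w\<^sub>x = (w\<^sup>2 / 2)\<^sub>x\<close>. The centred difference telescopes with the products of
  neighbouring values instead of squares; their difference is the jump term on the left.
\<close>

lemma virial_velocity:
  fixes \<theta> w :: "nat \<Rightarrow> real"
  assumes w: "w 0 = 0" "w (Suc M) = 0"
    and \<theta>: "\<And>i. \<theta> (Suc i) = \<kappa> * \<theta> i" "\<And>i. 0 \<le> \<theta> i" and \<kappa>: "0 \<le> \<kappa>" "\<kappa> \<le> 1"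
  shows "(1 - \<kappa>) * ((\<Sum>i<M. \<theta> (Suc i) * (w (Suc i))\<^sup>2)
            - (\<Sum>i<Suc M. \<theta> i * (w (Suc i) - w i)\<^sup>2) / 2)
       \<le> (\<Sum>i<M. \<theta> (Suc i) * ((w (Suc (Suc i)) - w i) * w (Suc i)))"
proof -
  have "(\<Sum>i<M. \<theta> (Suc i) * ((w (Suc (Suc i)) - w i) * w (Suc i)))
      = (\<Sum>i<M. \<theta> (Suc i) * (w (Suc i) * w (Suc (Suc i)) - w i * w (Suc i)))"
    by (intro sum.cong refl arg_cong[where f="\<lambda>x. _ * x"]) (simp add: algebra_simps)
  also have "\<dots> = (\<Sum>i<Suc M. (\<theta> i - \<theta> (Suc i)) * (w i * w (Suc i)))"
    using abel_summation[of \<theta> "\<lambda>i. w i * w (Suc i)" M] w by simp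
  also have "\<dots> = (1 - \<kappa>) * (\<Sum>i<Suc M. \<theta> i * (w i * w (Suc i)))"
    unfolding sum_distrib_left by (intro sum.cong) (auto simp: \<theta>(1) algebra_simps)
  also have "(\<Sum>i<Suc M. \<theta> i * (w i * w (Suc i)))
     = (\<Sum>i<Suc M. \<theta> i * (w i)\<^sup>2) / 2 + (\<Sum>i<Suc M. \<theta> i * (w (Suc i))\<^sup>2) / 2
         - (\<Sum>i<Suc M. \<theta> i * (w (Suc i) - w i)\<^sup>2) / 2"
    unfolding sum_divide_distrib sum.distrib[symmetric] sum_subtractf[symmetric]
    by (intro sum.cong) (auto simp: power2_eq_square field_simps)
  finally have eq: "(\<Sum>i<M. \<theta> (Suc i) * ((w (Suc (Suc i)) - w i) * w (Suc i))) = (1 - \<kappa>) *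
     ((\<Sum>i<Suc M. \<theta> i * (w i)\<^sup>2) / 2 + (\<Sum>i<Suc M. \<theta> i * (w (Suc i))\<^sup>2) / 2
         - (\<Sum>i<Suc M. \<theta> i * (w (Suc i) - w i)\<^sup>2) / 2)" .
  have 1: "(\<Sum>i<Suc M. \<theta> i * (w i)\<^sup>2) = (\<Sum>i<M. \<theta> (Suc i) * (w (Suc i))\<^sup>2)"
    using w by (simp only: sum.lessThan_Suc_shift) simp
  have 2: "(\<Sum>i<M. \<theta> (Suc i) * (w (Suc i))\<^sup>2) \<le> (\<Sum>i<Suc M. \<theta> i * (w (Suc i))\<^sup>2)"
  proof -
    have "\<theta> (Suc i) \<le> \<theta> i" for i
      using mult_left_le_one_le[OF \<theta>(2) \<kappa>, of i] \<theta>(1) by simp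
    then have "(\<Sum>i<M. \<theta> (Suc i) * (w (Suc i))\<^sup>2) \<le> (\<Sum>i<M. \<theta> i * (w (Suc i))\<^sup>2)"
      by (intro sum_mono mult_right_mono) auto
    then show ?thesis using w by simp
  qed
  show ?thesis unfolding eq
  proof (rule mult_left_mono)
    show "(\<Sum>i<M. \<theta> (Suc i) * (w (Suc i))\<^sup>2) - (\<Sum>i<Suc M. \<theta> i * (w (Suc i) - w i)\<^sup>2) / 2
        \<le> (\<Sum>i<Suc M. \<theta> i * (w i)\<^sup>2) / 2 + (\<Sum>i<Suc M. \<theta> i * (w (Suc i))\<^sup>2) / 2
          - (\<Sum>i<Suc M. \<theta> i * (w (Suc i) - w i)\<^sup>2) / 2"
      using 1 2 by linarith
  qed (use \<kappa> in simp)
qed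

definition stiffness :: "nat \<Rightarrow> real \<Rightarrow> (nat \<Rightarrow> real) \<Rightarrow> real" where
  "stiffness M h u = (\<Sum>i<Suc M. (slope h u i)\<^sup>2)"

definition mass :: "nat \<Rightarrow> (nat \<Rightarrow> real) \<Rightarrow> real" where
  "mass M w = (\<Sum>i<M. (w (Suc i))\<^sup>2)"

lemma stiffness_nonneg: "0 \<le> stiffness M h u"
  by (auto simp: stiffness_def intro!: sum_nonneg simp del: sum.lessThan_Suc)

lemma mass_nonneg: "0 \<le> mass M w"
  by (auto simp: mass_def intro!: sum_nonneg)

lemma stiffness_add_le:
  assumes "\<And>j. j \<le> Suc M \<Longrightarrow> u' j = u j + c * w j"
  shows "stiffness M h u' \<le> 2 * stiffness M h u + 2 * (c\<^sup>2 * stiffness M h w)"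
proof -
  have "slope h u' i = slope h u i + c * slope h w i" if "i < Suc M" for i
    using assms[of i] assms[of "Suc i"] that
    by (simp add: slope_def diff_divide_distrib add_divide_distrib right_diff_distrib)
  moreover have "(p + c * q)\<^sup>2 \<le> 2 * p\<^sup>2 + 2 * (c\<^sup>2 * q\<^sup>2)" for p q
    using zero_le_power2[of "p - c * q"] by (simp add: power2_eq_square algebra_simps)
  ultimately have "stiffness M h u' \<le> (\<Sum>i<Suc M. 2 * (slope h u i)\<^sup>2 + 2 * (c\<^sup>2 * (slope h w i)\<^sup>2))"
    unfolding stiffness_def by (intro sum_mono) (simp only: lessThan_iff)
  then show ?thesis by (simp only: sum.distrib sum_distrib_left stiffness_def)
qed

lemma square_sum3_le:
  fixes a b c :: real
  shows "(a + b + c)\<^sup>2 \<le> 3 * (a\<^sup>2 + b\<^sup>2 + c\<^sup>2)"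
proof -
  have "3 * (a\<^sup>2 + b\<^sup>2 + c\<^sup>2) - (a + b + c)\<^sup>2 = (a - b)\<^sup>2 + (a - c)\<^sup>2 + (b - c)\<^sup>2"
    by (simp add: power2_eq_square algebra_simps)
  moreover have "0 \<le> (a - b)\<^sup>2 + (a - c)\<^sup>2 + (b - c)\<^sup>2" by simp
  ultimately show ?thesis by linarith
qed

section \<open>One time step along a path\<close>

text \<open>
  One step of the scheme for a fixed sample point: \<open>u\<close> is the displacement, \<open>z\<close> the velocity on
  the preceding time interval, \<open>f\<close> the lower-order terms and \<open>\<eta>\<close> the noise increment; primes mark
  the values after the step. The new displacement uses the new velocity, so the step is a
  symplectic Euler step.
\<close>

locale scheme_step =
  fixes M :: nat and h k K :: real and u z u' z' f \<eta> :: "nat \<Rightarrow> real"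
  assumes h_pos: "0 < h" and mesh: "real (Suc M) * h = 1"
    and k_pos: "0 < k" and cfl: "4 * k \<le> h\<^sup>2" and K_nonneg: "0 \<le> K"
    and u_bd: "u 0 = 0" "u (Suc M) = 0"
    and z_bd: "z' 0 = 0" "z' (Suc M) = 0"
    and u_step: "\<And>j. j \<le> Suc M \<Longrightarrow> u' j = u j + k * z' j"
    and z_step: "\<And>i. i < M \<Longrightarrow> z' (Suc i) = z (Suc i) + k * laplace h u i + k * f i + \<eta> i"
    and f_bound: "\<And>i. i < M \<Longrightarrow> \<bar>f i\<bar> \<le> K * (\<bar>u (Suc i)\<bar> + \<bar>mid_slope h u i\<bar> + \<bar>z (Suc i)\<bar>)"
begin

lemma h_le_1: "h \<le> 1"
proof -
  have "1 * h \<le> real (Suc M) * h" using h_pos by (intro mult_right_mono) auto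
  then show ?thesis using mesh by simp
qed

lemma k_le_1: "k \<le> 1"
proof -
  have "h\<^sup>2 \<le> 1" using h_le_1 h_pos by (simp add: power_le_one)
  then show ?thesis using cfl by simp
qed

lemma cfl_stiffness:
  assumes "w 0 = 0" "w (Suc M) = 0"
  shows "k\<^sup>2 * stiffness M h w \<le> k * mass M w"
proof -
  have "k\<^sup>2 * stiffness M h w = k * (k * stiffness M h w)" by (simp add: power2_eq_square)
  also have "\<dots> \<le> k * (h\<^sup>2 / 4 * stiffness M h w)"
    using k_pos cfl by (intro mult_left_mono mult_right_mono stiffness_nonneg) auto
  also have "\<dots> \<le> k * mass M w"
    using inverse_slope[of h w M] h_pos assms k_pos
    by (intro mult_left_mono) (auto simp: stiffness_def mass_def simp del: sum.lessThan_Suc)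
  finally show ?thesis .
qed

lemma cfl_laplace: "k\<^sup>2 * (\<Sum>i<M. (laplace h u i)\<^sup>2) \<le> k * stiffness M h u"
proof -
  have "k\<^sup>2 * (\<Sum>i<M. (laplace h u i)\<^sup>2) = k * (k * (\<Sum>i<M. (laplace h u i)\<^sup>2))"
    by (simp add: power2_eq_square)
  also have "\<dots> \<le> k * (h\<^sup>2 / 4 * (\<Sum>i<M. (laplace h u i)\<^sup>2))"
    using k_pos cfl by (intro mult_left_mono mult_right_mono sum_nonneg) auto
  also have "\<dots> \<le> k * stiffness M h u"
    using inverse_laplace[of h u M] h_pos k_pos
    by (intro mult_left_mono) (auto simp: stiffness_def simp del: sum.lessThan_Suc)
  finally show ?thesis .
qed

lemma poincare: "mass M u \<le> stiffness M h u"
  using weighted_poincare[of h M u "\<lambda>_. 1"] h_pos mesh u_bd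
  by (simp add: mass_def stiffness_def antimono_def del: sum.lessThan_Suc)

lemma mid_slope_stiffness: "(\<Sum>i<M. (mid_slope h u i)\<^sup>2) \<le> stiffness M h u"
  using weighted_mid_slope[of "\<lambda>_. 1" h u M]
  by (simp add: stiffness_def antimono_def del: sum.lessThan_Suc)

text \<open>
  The first balance law. In the sum of both energies, the terms \<open>\<langle>laplace u, z'\<rangle>\<close> cancel after a
  summation by parts. What remains, besides the exchange with \<open>f\<close> and \<open>\<eta>\<close>, are two squares of size
  \<open>k\<^sup>2\<close> with opposite signs: each of the two energy inequalities has to estimate one of them.
\<close>

lemma energy_identity:
  "stiffness M h u' + mass M z' = stiffness M h u + mass M z
     + (\<Sum>i<M. 2 * (z (Suc i) + k * f i) * \<eta> i) + (\<Sum>i<M. (\<eta> i)\<^sup>2)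
     + 2 * k * (\<Sum>i<M. z (Suc i) * f i) + k\<^sup>2 * (\<Sum>i<M. (f i)\<^sup>2)
     - k\<^sup>2 * (\<Sum>i<M. (laplace h u i)\<^sup>2) + k\<^sup>2 * stiffness M h z'"
proof -
  have "slope h u' i = slope h u i + k * slope h z' i" if "i < Suc M" for i
    using that u_step[of i] u_step[of "Suc i"] by (simp add: slope_def diff_divide_distrib add_divide_distrib right_diff_distrib)
  then have "stiffness M h u' = (\<Sum>i<Suc M. (slope h u i)\<^sup>2 + 2 * k * (slope h u i * slope h z' i)
      + k\<^sup>2 * (slope h z' i)\<^sup>2)"
    unfolding stiffness_def by (intro sum.cong refl) (auto simp: power2_eq_square algebra_simps)
  also have "\<dots> = stiffness M h u + 2 * k * (\<Sum>i<Suc M. slope h u i * slope h z' i)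
      + k\<^sup>2 * stiffness M h z'"
    by (simp only: sum.distrib sum_distrib_left stiffness_def)
  also have "(\<Sum>i<Suc M. slope h u i * slope h z' i) = - (\<Sum>i<M. laplace h u i * z' (Suc i))"
    using laplace_by_parts[of h z' M u] z_bd h_pos by simp
  finally have 1: "stiffness M h u' = stiffness M h u
      - 2 * k * (\<Sum>i<M. laplace h u i * z' (Suc i)) + k\<^sup>2 * stiffness M h z'" by simp
  have "(z' (Suc i))\<^sup>2 = (z (Suc i))\<^sup>2 + 2 * k * (laplace h u i * z' (Suc i))
      + 2 * (z (Suc i) + k * f i) * \<eta> i + (\<eta> i)\<^sup>2 + 2 * k * (z (Suc i) * f i)
      + k\<^sup>2 * (f i)\<^sup>2 - k\<^sup>2 * (laplace h u i)\<^sup>2" if "i < M" for i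
    unfolding z_step[OF that] by (simp add: power2_eq_square algebra_simps)
  then have "mass M z' = (\<Sum>i<M. (z (Suc i))\<^sup>2 + 2 * k * (laplace h u i * z' (Suc i))
      + 2 * (z (Suc i) + k * f i) * \<eta> i + (\<eta> i)\<^sup>2 + 2 * k * (z (Suc i) * f i)
      + k\<^sup>2 * (f i)\<^sup>2 - k\<^sup>2 * (laplace h u i)\<^sup>2)"
    unfolding mass_def by (intro sum.cong refl) auto
  also have "\<dots> = mass M z + 2 * k * (\<Sum>i<M. laplace h u i * z' (Suc i))
      + (\<Sum>i<M. 2 * (z (Suc i) + k * f i) * \<eta> i) + (\<Sum>i<M. (\<eta> i)\<^sup>2)
      + 2 * k * (\<Sum>i<M. z (Suc i) * f i) + k\<^sup>2 * (\<Sum>i<M. (f i)\<^sup>2)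
      - k\<^sup>2 * (\<Sum>i<M. (laplace h u i)\<^sup>2)"
    by (simp only: sum.distrib sum_subtractf sum_distrib_left mass_def)
  finally show ?thesis using 1 by simp
qed

lemma lower_order_energy:
  "\<bar>2 * (\<Sum>i<M. z (Suc i) * f i)\<bar> \<le> 4 * K * (stiffness M h u + mass M z)"
proof -
  have "2 * \<bar>z (Suc i) * f i\<bar>
      \<le> K * (4 * (z (Suc i))\<^sup>2 + (u (Suc i))\<^sup>2 + (mid_slope h u i)\<^sup>2)" if "i < M" for i
  proof -
    have "2 * \<bar>z (Suc i) * f i\<bar>
        \<le> 2 * (\<bar>z (Suc i)\<bar> * (K * (\<bar>u (Suc i)\<bar> + \<bar>mid_slope h u i\<bar> + \<bar>z (Suc i)\<bar>)))"
      using f_bound[OF that] by (auto simp: abs_mult intro!: mult_left_mono)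
    also have "\<dots> = K * (2 * \<bar>z (Suc i)\<bar> * \<bar>u (Suc i)\<bar> + 2 * \<bar>z (Suc i)\<bar> * \<bar>mid_slope h u i\<bar>
        + 2 * (z (Suc i))\<^sup>2)"
      by (simp add: algebra_simps power2_eq_square)
    also have "\<dots> \<le> K * (4 * (z (Suc i))\<^sup>2 + (u (Suc i))\<^sup>2 + (mid_slope h u i)\<^sup>2)"
      using sum_squares_bound[of "\<bar>z (Suc i)\<bar>" "\<bar>u (Suc i)\<bar>"]
        sum_squares_bound[of "\<bar>z (Suc i)\<bar>" "\<bar>mid_slope h u i\<bar>"] K_nonneg
      by (intro mult_left_mono) auto
    finally show ?thesis .
  qed
  then have "(\<Sum>i<M. 2 * \<bar>z (Suc i) * f i\<bar>)
      \<le> (\<Sum>i<M. K * (4 * (z (Suc i))\<^sup>2 + (u (Suc i))\<^sup>2 + (mid_slope h u i)\<^sup>2))"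
    by (intro sum_mono) auto
  also have "\<dots> = K * (4 * mass M z + mass M u + (\<Sum>i<M. (mid_slope h u i)\<^sup>2))"
    by (simp only: sum.distrib sum_distrib_left[symmetric] mass_def)
  also have "\<dots> \<le> K * (4 * (stiffness M h u + mass M z))"
    using poincare mid_slope_stiffness K_nonneg stiffness_nonneg[of M h u]
    by (intro mult_left_mono) auto
  finally have "(\<Sum>i<M. 2 * \<bar>z (Suc i) * f i\<bar>) \<le> 4 * K * (stiffness M h u + mass M z)"
    by (simp only: mult_ac)
  moreover have "\<bar>2 * (\<Sum>i<M. z (Suc i) * f i)\<bar> \<le> (\<Sum>i<M. 2 * \<bar>z (Suc i) * f i\<bar>)"
    unfolding abs_mult sum_distrib_left[symmetric] using sum_abs[of "\<lambda>i. z (Suc i) * f i" "{..<M}"]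
    by (simp add: abs_mult)
  ultimately show ?thesis by (rule order_trans[rotated])
qed

lemma lower_order_square:
  "(\<Sum>i<M. (f i)\<^sup>2) \<le> 6 * K\<^sup>2 * (stiffness M h u + mass M z)"
proof -
  have "(f i)\<^sup>2 \<le> 3 * K\<^sup>2 * ((u (Suc i))\<^sup>2 + (mid_slope h u i)\<^sup>2 + (z (Suc i))\<^sup>2)" if "i < M" for i
  proof -
    let ?a = "\<bar>u (Suc i)\<bar>" and ?b = "\<bar>mid_slope h u i\<bar>" and ?c = "\<bar>z (Suc i)\<bar>"
    have "(f i)\<^sup>2 \<le> (K * (?a + ?b + ?c))\<^sup>2"
      using power_mono[OF f_bound[OF that], of 2] by simp
    also have "\<dots> = K\<^sup>2 * (?a + ?b + ?c)\<^sup>2" by (simp add: power_mult_distrib)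
    also have "\<dots> \<le> K\<^sup>2 * (3 * (?a\<^sup>2 + ?b\<^sup>2 + ?c\<^sup>2))"
      by (intro mult_left_mono square_sum3_le) auto
    finally show ?thesis by (simp only: mult_ac power2_abs)
  qed
  then have "(\<Sum>i<M. (f i)\<^sup>2)
      \<le> (\<Sum>i<M. 3 * K\<^sup>2 * ((u (Suc i))\<^sup>2 + (mid_slope h u i)\<^sup>2 + (z (Suc i))\<^sup>2))"
    by (intro sum_mono) auto
  also have "\<dots> = 3 * K\<^sup>2 * (mass M u + (\<Sum>i<M. (mid_slope h u i)\<^sup>2) + mass M z)"
    by (simp only: sum.distrib sum_distrib_left[symmetric] mass_def)
  also have "\<dots> \<le> 3 * K\<^sup>2 * (2 * (stiffness M h u + mass M z))"
    using poincare mid_slope_stiffness mass_nonneg[of M z]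
    by (intro mult_left_mono) auto
  finally show ?thesis by (simp add: algebra_simps)
qed

lemma energy_lower_bound:
  "stiffness M h u' + mass M z' \<ge> (1 - (4 * K + 1) * k) * (stiffness M h u + mass M z)
     + (\<Sum>i<M. 2 * (z (Suc i) + k * f i) * \<eta> i) + (\<Sum>i<M. (\<eta> i)\<^sup>2)"
proof -
  let ?E = "stiffness M h u + mass M z"
  have "- (4 * K * ?E) \<le> 2 * (\<Sum>i<M. z (Suc i) * f i)"
    using abs_le_D2[OF lower_order_energy] by (simp only: minus_le_iff)
  then have "k * - (4 * K * ?E) \<le> k * (2 * (\<Sum>i<M. z (Suc i) * f i))"
    using k_pos by (intro mult_left_mono) auto
  then have "- (k * (4 * K * ?E)) \<le> 2 * k * (\<Sum>i<M. z (Suc i) * f i)"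
    by (simp only: mult_minus_right mult_ac)
  moreover have "0 \<le> k\<^sup>2 * (\<Sum>i<M. (f i)\<^sup>2)" "0 \<le> k\<^sup>2 * stiffness M h z'" "0 \<le> k * mass M z"
    using k_pos stiffness_nonneg mass_nonneg by (auto intro!: mult_nonneg_nonneg sum_nonneg)
  moreover have "k * ?E = k * stiffness M h u + k * mass M z" by (simp add: algebra_simps)
  moreover have "(1 - (4 * K + 1) * k) * ?E = ?E - k * (4 * K * ?E) - k * ?E"
    by (simp add: algebra_simps)
  ultimately show ?thesis using energy_identity cfl_laplace by linarith
qed

lemma energy_upper_bound:
  "(1 - k) * (stiffness M h u' + mass M z')
     \<le> (1 + (4 * K + 6 * K\<^sup>2) * k) * (stiffness M h u + mass M z)
     + (\<Sum>i<M. 2 * (z (Suc i) + k * f i) * \<eta> i) + (\<Sum>i<M. (\<eta> i)\<^sup>2)"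
proof -
  let ?E = "stiffness M h u + mass M z"
  have "k * (2 * (\<Sum>i<M. z (Suc i) * f i)) \<le> k * (4 * K * ?E)"
    using abs_le_D1[OF lower_order_energy] k_pos by (intro mult_left_mono) auto
  then have "2 * k * (\<Sum>i<M. z (Suc i) * f i) \<le> k * (4 * K * ?E)"
    by (simp only: mult_ac)
  moreover have "k\<^sup>2 * (\<Sum>i<M. (f i)\<^sup>2) \<le> k * (6 * K\<^sup>2 * ?E)"
  proof -
    have "k\<^sup>2 * (\<Sum>i<M. (f i)\<^sup>2) \<le> k * (\<Sum>i<M. (f i)\<^sup>2)"
      using k_pos k_le_1 by (intro mult_right_mono sum_nonneg) (auto simp: power2_eq_square)
    also have "\<dots> \<le> k * (6 * K\<^sup>2 * ?E)"
      using lower_order_square k_pos by (intro mult_left_mono) auto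
    finally show ?thesis .
  qed
  moreover have "0 \<le> k\<^sup>2 * (\<Sum>i<M. (laplace h u i)\<^sup>2)" "0 \<le> k * stiffness M h u'"
    using k_pos stiffness_nonneg by (auto intro!: mult_nonneg_nonneg sum_nonneg)
  moreover have "(1 - k) * (stiffness M h u' + mass M z')
      = stiffness M h u' + mass M z' - k * mass M z' - k * stiffness M h u'"
    by (simp add: algebra_simps)
  moreover have "(1 + (4 * K + 6 * K\<^sup>2) * k) * ?E = ?E + k * (4 * K * ?E) + k * (6 * K\<^sup>2 * ?E)"
    by (simp add: algebra_simps)
  ultimately show ?thesis using energy_identity cfl_stiffness[OF z_bd] by linarith
qed

text \<open>
  The second balance law, obtained from the multiplier \<open>\<theta> mid_slope u\<close>; the first two terms on the
  right are the increment of the weighted momentum. The coefficient on the left compares the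
  spatial decay \<open>1 - \<kappa>\<close> of the weight, which is gained, with its growth \<open>\<alpha> - 1\<close> in time, which is
  lost to the momentum because \<open>\<bar>p\<bar> \<le> e\<close>.
\<close>

lemma sideways_step:
  fixes \<theta> \<theta>' :: "nat \<Rightarrow> real" and \<kappa> \<alpha> :: real
  assumes \<theta>: "\<And>i. \<theta> (Suc i) = \<kappa> * \<theta> i" "\<And>i. 0 \<le> \<theta> i"
    and \<theta>': "\<And>i. \<theta>' i = \<alpha> * \<theta> i"
    and \<kappa>: "0 \<le> \<kappa>" "\<kappa> \<le> 1" and \<alpha>: "1 \<le> \<alpha>"
  defines "V \<equiv> \<Sum>i<Suc M. \<theta> i * (slope h u i)\<^sup>2"
    and "Z \<equiv> \<Sum>i<M. \<theta> (Suc i) * (z (Suc i))\<^sup>2"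
    and "Z' \<equiv> \<Sum>i<M. \<theta>' (Suc i) * (z' (Suc i))\<^sup>2"
    and "J' \<equiv> \<Sum>i<Suc M. \<theta>' i * (z' (Suc i) - z' i)\<^sup>2"
  shows "((1 - \<kappa>) * k - (\<alpha> - 1) * h) / 2 * (V + Z')
      \<le> h * (\<Sum>i<M. \<theta>' (Suc i) * (mid_slope h u' i * z' (Suc i)))
       - h * (\<Sum>i<M. \<theta> (Suc i) * (mid_slope h u i * z (Suc i)))
       + k / 2 * (\<theta> 0 * (slope h u 0)\<^sup>2) + k / 4 * (1 - \<kappa>) * J'
       + k * h * K * (5 / 2 * V + Z / 2)
       - (\<Sum>i<M. h * \<theta> (Suc i) * mid_slope h u i * \<eta> i)"
proof -
  let ?m = "mid_slope h u"
  have anti: "antimono \<theta>"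
  proof -
    have "\<theta> (Suc i) \<le> \<theta> i" for i
      using mult_left_le_one_le[OF \<theta>(2) \<kappa>, of i] \<theta>(1) by simp
    then show ?thesis by (intro decseq_SucI)
  qed
  have \<theta>'_rec: "\<theta>' (Suc i) = \<kappa> * \<theta>' i" for i by (simp add: \<theta>' \<theta>(1))
  have \<theta>'_pos: "0 \<le> \<theta>' i" for i using \<theta>(2) \<alpha> by (simp add: \<theta>')
  have m': "mid_slope h u' i = ?m i + k * (z' (Suc (Suc i)) - z' i) / (2 * h)" if "i < M" for i
    using that u_step[of i] u_step[of "Suc (Suc i)"]
    by (simp add: mid_slope_def add_divide_distrib diff_divide_distrib algebra_simps)
  have "h * (\<theta>' (Suc i) * (mid_slope h u' i * z' (Suc i))) - h * (\<theta> (Suc i) * (?m i * z (Suc i)))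
      = k * (h * (\<theta> (Suc i) * (?m i * laplace h u i)))
        + k * (h * (\<theta> (Suc i) * (?m i * f i)))
        + h * \<theta> (Suc i) * ?m i * \<eta> i
        + k / 2 * (\<theta>' (Suc i) * ((z' (Suc (Suc i)) - z' i) * z' (Suc i)))
        + (\<alpha> - 1) * (h * (\<theta> (Suc i) * (?m i * z' (Suc i))))" if "i < M" for i
  proof -
    have "h * (\<theta>' (Suc i) * (mid_slope h u' i * z' (Suc i)))
        = h * (\<theta>' (Suc i) * (?m i * z' (Suc i)))
          + k / 2 * (\<theta>' (Suc i) * ((z' (Suc (Suc i)) - z' i) * z' (Suc i)))"
      unfolding m'[OF that] using h_pos by (simp add: field_simps)
    moreover have "h * (\<theta>' (Suc i) * (?m i * z' (Suc i)))
        = h * (\<theta> (Suc i) * (?m i * z' (Suc i))) + (\<alpha> - 1) * (h * (\<theta> (Suc i) * (?m i * z' (Suc i))))"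
      unfolding \<theta>' by (simp add: algebra_simps)
    moreover have "h * (\<theta> (Suc i) * (?m i * z' (Suc i))) = h * (\<theta> (Suc i) * (?m i * z (Suc i)))
        + k * (h * (\<theta> (Suc i) * (?m i * laplace h u i))) + k * (h * (\<theta> (Suc i) * (?m i * f i)))
        + h * \<theta> (Suc i) * ?m i * \<eta> i"
      unfolding z_step[OF that] by (simp add: algebra_simps)
    ultimately show ?thesis by simp
  qed
  then have "(\<Sum>i<M. h * (\<theta>' (Suc i) * (mid_slope h u' i * z' (Suc i)))
        - h * (\<theta> (Suc i) * (?m i * z (Suc i))))
      = (\<Sum>i<M. k * (h * (\<theta> (Suc i) * (?m i * laplace h u i)))
        + k * (h * (\<theta> (Suc i) * (?m i * f i)))
        + h * \<theta> (Suc i) * ?m i * \<eta> i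
        + k / 2 * (\<theta>' (Suc i) * ((z' (Suc (Suc i)) - z' i) * z' (Suc i)))
        + (\<alpha> - 1) * (h * (\<theta> (Suc i) * (?m i * z' (Suc i)))))"
    by (intro sum.cong) auto
  \<comment> \<open>Product rule in time: the momentum changes through the velocity, the slope and the weight.\<close>
  then have identity:
    "h * (\<Sum>i<M. \<theta>' (Suc i) * (mid_slope h u' i * z' (Suc i)))
       - h * (\<Sum>i<M. \<theta> (Suc i) * (?m i * z (Suc i)))
      = k / 2 * (2 * h * (\<Sum>i<M. \<theta> (Suc i) * (?m i * laplace h u i)))
        + k * h * (\<Sum>i<M. \<theta> (Suc i) * (?m i * f i))
        + (\<Sum>i<M. h * \<theta> (Suc i) * ?m i * \<eta> i)
        + k / 2 * (\<Sum>i<M. \<theta>' (Suc i) * ((z' (Suc (Suc i)) - z' i) * z' (Suc i)))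
        + (\<alpha> - 1) * h * (\<Sum>i<M. \<theta> (Suc i) * (?m i * z' (Suc i)))"
    by (simp only: sum.distrib sum_subtractf sum_distrib_left[symmetric] mult.assoc)

  have m_V: "(\<Sum>i<M. \<theta> (Suc i) * (?m i)\<^sup>2) \<le> V"
    unfolding V_def by (rule weighted_mid_slope[OF anti \<theta>(2)])
  have u_V: "(\<Sum>i<M. \<theta> (Suc i) * (u (Suc i))\<^sup>2) \<le> V"
    unfolding V_def by (rule weighted_poincare) (use h_pos mesh u_bd anti \<theta> in auto)

  have A: "k / 2 * ((1 - \<kappa>) * V - \<theta> 0 * (slope h u 0)\<^sup>2)
      \<le> k / 2 * (2 * h * (\<Sum>i<M. \<theta> (Suc i) * (?m i * laplace h u i)))"
    unfolding V_def using k_pos by (intro mult_left_mono virial_laplace h_pos \<theta>) auto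
  have B: "k / 2 * ((1 - \<kappa>) * (Z' - J' / 2))
      \<le> k / 2 * (\<Sum>i<M. \<theta>' (Suc i) * ((z' (Suc (Suc i)) - z' i) * z' (Suc i)))"
    unfolding Z'_def J'_def using k_pos
    by (intro mult_left_mono virial_velocity z_bd \<theta>'_rec \<theta>'_pos \<kappa>) auto
  have C: "- ((\<alpha> - 1) * h * ((V + Z') / 2))
      \<le> (\<alpha> - 1) * h * (\<Sum>i<M. \<theta> (Suc i) * (?m i * z' (Suc i)))"
  proof -
    have "- (\<theta> (Suc i) * (?m i)\<^sup>2 + \<theta>' (Suc i) * (z' (Suc i))\<^sup>2) / 2 \<le> \<theta> (Suc i) * (?m i * z' (Suc i))" for i
    proof -
      have "\<theta> (Suc i) * (z' (Suc i))\<^sup>2 \<le> \<theta>' (Suc i) * (z' (Suc i))\<^sup>2"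
        unfolding \<theta>' using mult_right_mono[OF \<alpha> \<theta>(2)[of "Suc i"]] by (intro mult_right_mono) auto
      moreover have "0 \<le> \<theta> (Suc i) * (?m i + z' (Suc i))\<^sup>2" by (simp add: \<theta>(2))
      then have "- (\<theta> (Suc i) * (?m i)\<^sup>2 + \<theta> (Suc i) * (z' (Suc i))\<^sup>2) / 2 \<le> \<theta> (Suc i) * (?m i * z' (Suc i))"
        by (simp add: power2_eq_square algebra_simps)
      ultimately show ?thesis by (auto simp: field_simps)
    qed
    then have "(\<Sum>i<M. - (\<theta> (Suc i) * (?m i)\<^sup>2 + \<theta>' (Suc i) * (z' (Suc i))\<^sup>2) / 2)
        \<le> (\<Sum>i<M. \<theta> (Suc i) * (?m i * z' (Suc i)))" by (intro sum_mono)
    then have "- (((\<Sum>i<M. \<theta> (Suc i) * (?m i)\<^sup>2) + Z') / 2) \<le> (\<Sum>i<M. \<theta> (Suc i) * (?m i * z' (Suc i)))"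
      unfolding Z'_def by (simp only: sum_divide_distrib[symmetric] sum_negf sum.distrib minus_divide_left)
    then have "- ((V + Z') / 2) \<le> (\<Sum>i<M. \<theta> (Suc i) * (?m i * z' (Suc i)))"
      using m_V by (simp add: field_simps)
    then have "(\<alpha> - 1) * h * (- ((V + Z') / 2))
        \<le> (\<alpha> - 1) * h * (\<Sum>i<M. \<theta> (Suc i) * (?m i * z' (Suc i)))"
      using \<alpha> h_pos by (intro mult_left_mono) auto
    then show ?thesis by simp
  qed
  have D: "- (k * h * K * (5 / 2 * V + Z / 2)) \<le> k * h * (\<Sum>i<M. \<theta> (Suc i) * (?m i * f i))"
  proof -
    have "- (K * (\<theta> (Suc i) * (u (Suc i))\<^sup>2 / 2 + 2 * (\<theta> (Suc i) * (?m i)\<^sup>2)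
        + \<theta> (Suc i) * (z (Suc i))\<^sup>2 / 2)) \<le> \<theta> (Suc i) * (?m i * f i)" if "i < M" for i
    proof -
      let ?q = "(u (Suc i))\<^sup>2 / 2 + 2 * (?m i)\<^sup>2 + (z (Suc i))\<^sup>2 / 2"
      have "\<bar>?m i * f i\<bar> \<le> \<bar>?m i\<bar> * (K * (\<bar>u (Suc i)\<bar> + \<bar>?m i\<bar> + \<bar>z (Suc i)\<bar>))"
        using f_bound[OF that] by (auto simp: abs_mult intro!: mult_left_mono)
      also have "\<dots> = K * (\<bar>u (Suc i)\<bar> * \<bar>?m i\<bar> + (?m i)\<^sup>2 + \<bar>z (Suc i)\<bar> * \<bar>?m i\<bar>)"
        by (simp add: algebra_simps power2_eq_square)
      also have "\<dots> \<le> K * ?q"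
        using sum_squares_bound[of "\<bar>z (Suc i)\<bar>" "\<bar>?m i\<bar>"]
          sum_squares_bound[of "\<bar>u (Suc i)\<bar>" "\<bar>?m i\<bar>"] K_nonneg
        by (intro mult_left_mono) auto
      finally have "- (K * ?q) \<le> ?m i * f i" by linarith
      then have "\<theta> (Suc i) * (- (K * ?q)) \<le> \<theta> (Suc i) * (?m i * f i)"
        by (intro mult_left_mono \<theta>)
      then show ?thesis by (simp add: algebra_simps)
    qed
    then have "(\<Sum>i<M. - (K * (\<theta> (Suc i) * (u (Suc i))\<^sup>2 / 2 + 2 * (\<theta> (Suc i) * (?m i)\<^sup>2)
        + \<theta> (Suc i) * (z (Suc i))\<^sup>2 / 2))) \<le> (\<Sum>i<M. \<theta> (Suc i) * (?m i * f i))"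
      by (intro sum_mono) auto
    then have "- (K * ((\<Sum>i<M. \<theta> (Suc i) * (u (Suc i))\<^sup>2) / 2
        + 2 * (\<Sum>i<M. \<theta> (Suc i) * (?m i)\<^sup>2) + Z / 2)) \<le> (\<Sum>i<M. \<theta> (Suc i) * (?m i * f i))"
      unfolding Z_def
      by (simp only: sum_negf sum_distrib_left[symmetric] sum.distrib sum_divide_distrib[symmetric])
    moreover have "K * ((\<Sum>i<M. \<theta> (Suc i) * (u (Suc i))\<^sup>2) / 2
        + 2 * (\<Sum>i<M. \<theta> (Suc i) * (?m i)\<^sup>2) + Z / 2) \<le> K * (5 / 2 * V + Z / 2)"
      using m_V u_V K_nonneg by (intro mult_left_mono) auto
    ultimately have "- (K * (5 / 2 * V + Z / 2)) \<le> (\<Sum>i<M. \<theta> (Suc i) * (?m i * f i))" by linarith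
    then have "k * h * (- (K * (5 / 2 * V + Z / 2))) \<le> k * h * (\<Sum>i<M. \<theta> (Suc i) * (?m i * f i))"
      using k_pos h_pos by (intro mult_left_mono) auto
    then show ?thesis by (simp only: mult_minus_right mult.assoc)
  qed
  have split: "((1 - \<kappa>) * k - (\<alpha> - 1) * h) / 2 * (V + Z')
      = k / 2 * ((1 - \<kappa>) * V - \<theta> 0 * (slope h u 0)\<^sup>2) + k / 2 * ((1 - \<kappa>) * (Z' - J' / 2))
        - (\<alpha> - 1) * h * ((V + Z') / 2)
        + k / 2 * (\<theta> 0 * (slope h u 0)\<^sup>2) + k / 4 * (1 - \<kappa>) * J'"
    by (simp add: algebra_simps add_divide_distrib diff_divide_distrib)
  have combine: "a + b - c + p + q \<le> x + p + q + d - n"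
    if "a \<le> a'" "b \<le> b'" "- c \<le> c'" "- d \<le> d'" "x = a' + d' + n + b' + c'"
    for a a' b b' c c' d d' n p q x :: real
    using that by linarith
  show ?thesis unfolding split by (rule combine[OF A B C D identity])
qed

end

section \<open>Independence of Brownian increments from the past\<close>

context brownian_space
begin

text \<open>
  Events that are determined, up to null sets, by the path at finitely many times up to \<open>s\<close>. They
  contain the generators of the augmented filtration and are stable under intersection.
\<close>

definition path_events :: "real \<Rightarrow> 'a set set" where
  "path_events s = {E \<in> events. \<exists>S D. finite S \<and> S \<subseteq> {0..s} \<and> D \<in> sets (PiM S (\<lambda>_. borel)) \<and>
     (AE \<omega> in P. \<omega> \<in> E \<longleftrightarrow> (\<lambda>u\<in>S. B u \<omega>) \<in> D)}"

lemma path_eventsI: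
  assumes "E \<in> events" "finite S" "S \<subseteq> {0..s}" "D \<in> sets (PiM S (\<lambda>_. borel))"
    "AE \<omega> in P. \<omega> \<in> E \<longleftrightarrow> (\<lambda>u\<in>S. B u \<omega>) \<in> D"
  shows "E \<in> path_events s"
  using assms unfolding path_events_def by blast

lemma path_eventsE:
  assumes "E \<in> path_events s"
  obtains S D where "E \<in> events" "finite S" "S \<subseteq> {0..s}" "D \<in> sets (PiM S (\<lambda>_. borel))"
    "AE \<omega> in P. \<omega> \<in> E \<longleftrightarrow> (\<lambda>u\<in>S. B u \<omega>) \<in> D"
  using assms unfolding path_events_def by blast

lemma path_events_Int_stable: "Int_stable (path_events s)"
proof (rule Int_stableI)
  fix E E' assume E: "E \<in> path_events s" and E': "E' \<in> path_events s"
  from E obtain S D where 1: "E \<in> events" "finite S" "S \<subseteq> {0..s}" "D \<in> sets (PiM S (\<lambda>_. borel))"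
    "AE \<omega> in P. \<omega> \<in> E \<longleftrightarrow> (\<lambda>u\<in>S. B u \<omega>) \<in> D" by (rule path_eventsE)
  from E' obtain S' D' where 2: "E' \<in> events" "finite S'" "S' \<subseteq> {0..s}" "D' \<in> sets (PiM S' (\<lambda>_. borel))"
    "AE \<omega> in P. \<omega> \<in> E' \<longleftrightarrow> (\<lambda>u\<in>S'. B u \<omega>) \<in> D'" by (rule path_eventsE)
  let ?U = "S \<union> S'"
  let ?M = "PiM ?U (\<lambda>_. borel :: real measure)"
  define W where "W = ((\<lambda>f. restrict f S) -` D \<inter> space ?M) \<inter> ((\<lambda>f. restrict f S') -` D' \<inter> space ?M)"
  have W: "W \<in> sets ?M"
    unfolding W_def
    by (intro sets.Int measurable_sets[OF measurable_restrict_subset 1(4)]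
          measurable_sets[OF measurable_restrict_subset 2(4)]) auto
  show "E \<inter> E' \<in> path_events s"
  proof (rule path_eventsI[OF _ _ _ W])
    show "AE \<omega> in P. \<omega> \<in> E \<inter> E' \<longleftrightarrow> (\<lambda>u\<in>?U. B u \<omega>) \<in> W"
      using 1(5) 2(5)
    proof eventually_elim
      case (elim \<omega>)
      have r: "restrict (\<lambda>u\<in>?U. B u \<omega>) S = (\<lambda>u\<in>S. B u \<omega>)"
        "restrict (\<lambda>u\<in>?U. B u \<omega>) S' = (\<lambda>u\<in>S'. B u \<omega>)" by (auto simp: restrict_def)
      have "(\<lambda>u\<in>?U. B u \<omega>) \<in> space ?M" by (auto simp: space_PiM)
      then show ?case using elim by (auto simp: W_def r)
    qed
  qed (use 1 2 in auto)
qed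

lemma augfilt_generators:
  "{B u -` A \<inter> space P | u A. 0 \<le> u \<and> u \<le> s \<and> A \<in> sets borel} \<union> null_sets P \<subseteq> path_events s"
proof
  fix E assume "E \<in> {B u -` A \<inter> space P | u A. 0 \<le> u \<and> u \<le> s \<and> A \<in> sets borel} \<union> null_sets P"
  then consider u A where "0 \<le> u" "u \<le> s" "A \<in> sets borel" "E = B u -` A \<inter> space P"
    | "E \<in> null_sets P" by blast
  then show "E \<in> path_events s"
  proof cases
    case 1
    let ?M = "PiM {u} (\<lambda>_. borel :: real measure)"
    let ?D = "(\<lambda>f. f u) -` A \<inter> space ?M"
    have D: "?D \<in> sets ?M" using 1 by (intro measurable_sets[OF measurable_component_singleton]) auto
    show ?thesis
    proof (rule path_eventsI[OF _ _ _ D])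
      show "E \<in> events" using 1 B_measurable by (auto intro: measurable_sets)
      show "AE \<omega> in P. \<omega> \<in> E \<longleftrightarrow> (\<lambda>u\<in>{u}. B u \<omega>) \<in> ?D"
        by (rule AE_I2) (auto simp: 1 space_PiM)
    qed (use 1 in auto)
  next
    case 2
    show ?thesis
      by (rule path_eventsI[of _ "{}" _ "{}"]) (use 2 AE_not_in[OF 2] in auto)
  qed
qed

lemma augfilt_sets: "sets (augfilt P B s) = sigma_sets (space P)
    ({B u -` A \<inter> space P | u A. 0 \<le> u \<and> u \<le> s \<and> A \<in> sets borel} \<union> null_sets P)"
proof -
  have "({B u -` A \<inter> space P | u A. 0 \<le> u \<and> u \<le> s \<and> A \<in> sets borel} \<union> null_sets P) \<subseteq> Pow (space P)"
    using sets.sets_into_space null_setsD2 by blast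
  then show ?thesis unfolding augfilt_def by (rule sets_measure_of)
qed

lemma augfilt_space: "space (augfilt P B s) = space P"
proof -
  have "({B u -` A \<inter> space P | u A. 0 \<le> u \<and> u \<le> s \<and> A \<in> sets borel} \<union> null_sets P) \<subseteq> Pow (space P)"
    using sets.sets_into_space null_setsD2 by blast
  then show ?thesis unfolding augfilt_def by (rule space_measure_of)
qed

lemma augfilt_sets_path_events: "sets (augfilt P B s) \<subseteq> sigma_sets (space P) (path_events s)"
  unfolding augfilt_sets by (rule sigma_sets_mono'[OF augfilt_generators])

lemma augfilt_subset_events: "sets (augfilt P B s) \<subseteq> events"
proof -
  have "path_events s \<subseteq> events" by (auto simp: path_events_def)
  then have "sigma_sets (space P) (path_events s) \<subseteq> events"
    by (rule sets.sigma_sets_subset)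
  then show ?thesis using augfilt_sets_path_events by blast
qed

lemma augfilt_measurable_events:
  assumes "X \<in> borel_measurable (augfilt P B s)"
  shows "X \<in> borel_measurable P"
proof (rule measurableI)
  fix A :: "'b set" assume "A \<in> sets borel"
  then have "X -` A \<inter> space (augfilt P B s) \<in> sets (augfilt P B s)"
    using assms by (intro measurable_sets)
  then show "X -` A \<inter> space P \<in> events" using augfilt_subset_events by (auto simp: augfilt_space)
qed auto

lemma augfilt_mono:
  assumes "X \<in> borel_measurable (augfilt P B s)" "s \<le> t"
  shows "X \<in> borel_measurable (augfilt P B t)"
proof (rule measurableI)
  fix A :: "'b set" assume "A \<in> sets borel"
  then have "X -` A \<inter> space (augfilt P B s) \<in> sets (augfilt P B s)"
    using assms by (intro measurable_sets)
  moreover have "sets (augfilt P B s) \<subseteq> sets (augfilt P B t)"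
    unfolding augfilt_sets using assms(2) by (intro sigma_sets_mono') (auto intro: order_trans)
  ultimately show "X -` A \<inter> space (augfilt P B t) \<in> sets (augfilt P B t)"
    by (auto simp: augfilt_space)
qed auto

text \<open>
  Sort the finitely many times together with \<open>0\<close> and \<open>s\<close>, and append \<open>t\<close>. As \<open>B 0 = 0\<close> almost
  surely, the values of the path are sums of the increments before the last one, which is the
  increment from \<open>s\<close> to \<open>t\<close>.
\<close>

lemma path_vector_of_increments:
  assumes s: "0 \<le> s" "s < t" and S: "finite S" "S \<subseteq> {0..s}"
  obtains n r \<Phi> where "0 \<le> r 0" "strict_mono_on {..Suc n} r" "r n = s" "r (Suc n) = t"
    "\<Phi> \<in> measurable (PiM {..<n} (\<lambda>_. borel)) (PiM S (\<lambda>_. borel :: real measure))"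
    "AE \<omega> in P. (\<lambda>u\<in>S. B u \<omega>) = \<Phi> (\<lambda>i\<in>{..<n}. B (r (Suc i)) \<omega> - B (r i) \<omega>)"
proof -
  define U where "U = insert 0 (insert s S)"
  define L where "L = sorted_list_of_set U"
  have finU: "finite U" and U: "U \<subseteq> {0..s}" "0 \<in> U" "s \<in> U" using s S by (auto simp: U_def)
  have L: "sorted_wrt (<) L" "set L = U"
    using finU by (auto simp: L_def)
  define n where "n = length L - 1"
  have len: "length L = Suc n" using L(2) U by (cases L) (auto simp: n_def)
  define r where "r = (\<lambda>i. if i \<le> n then L ! i else t)"
  have nth_less: "L ! i < L ! j" if "i < j" "j \<le> n" for i j
    using sorted_wrt_nth_less[OF L(1), of i j] that len by auto
  have in_U: "L ! i \<in> U" if "i \<le> n" for i using that L(2) len nth_mem[of i L] by auto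
  obtain i0 where i0: "i0 \<le> n" "L ! i0 = 0" using U(2) L(2) len by (metis in_set_conv_nth less_Suc_eq_le)
  have r0: "r 0 = 0"
  proof -
    have "L ! 0 = 0"
    proof (cases "i0 = 0")
      case False
      then have "L ! 0 < L ! i0" using nth_less[of 0 i0] i0 by auto
      then show ?thesis using i0 in_U[of 0] U by auto
    qed (use i0 in auto)
    then show ?thesis by (simp add: r_def)
  qed
  have rn: "r n = s"
  proof -
    obtain i1 where i1: "i1 \<le> n" "L ! i1 = s" using U(3) L(2) len by (metis in_set_conv_nth less_Suc_eq_le)
    have "L ! n = s"
    proof (cases "i1 = n")
      case False
      then have "L ! i1 < L ! n" using nth_less[of i1 n] i1 by auto
      then show ?thesis using i1 in_U[of n] U by auto
    qed (use i1 in auto)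
    then show ?thesis by (simp add: r_def)
  qed
  have mono: "strict_mono_on {..Suc n} r"
  proof (rule strict_mono_onI)
    fix i j assume "i \<in> {..Suc n}" "j \<in> {..Suc n}" and ij: "i < j"
    show "r i < r j"
    proof (cases "j \<le> n")
      case True then show ?thesis using ij nth_less by (simp add: r_def)
    next
      case False
      then have "r i \<in> U" using ij \<open>j \<in> _\<close> in_U[of i] by (simp add: r_def)
      then have "r i \<le> s" using U by auto
      moreover have "r j = t" using False by (simp add: r_def)
      ultimately show ?thesis using s by simp
    qed
  qed
  have "\<exists>i\<le>n. r i = u" if "u \<in> S" for u
  proof -
    have "u \<in> set L" using that L(2) by (simp add: U_def)
    then obtain i where "i < length L" "L ! i = u" by (auto simp: in_set_conv_nth)
    then show ?thesis using len by (auto simp: r_def intro!: exI[of _ i])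
  qed
  then obtain idx where idx: "\<And>u. u \<in> S \<Longrightarrow> idx u \<le> n \<and> r (idx u) = u" by metis
  define \<Phi> where "\<Phi> = (\<lambda>x :: nat \<Rightarrow> real. \<lambda>u\<in>S. \<Sum>i<idx u. x i)"
  have meas: "\<Phi> \<in> measurable (PiM {..<n} (\<lambda>_. borel)) (PiM S (\<lambda>_. borel :: real measure))"
    unfolding \<Phi>_def using idx
    by (intro measurable_restrict borel_measurable_sum measurable_component_singleton) fastforce
  have "AE \<omega> in P. (\<lambda>u\<in>S. B u \<omega>) = \<Phi> (\<lambda>i\<in>{..<n}. B (r (Suc i)) \<omega> - B (r i) \<omega>)"
    using B_start
  proof eventually_elim
    case (elim \<omega>)
    have "B u \<omega> = (\<Sum>i<idx u. (\<lambda>i\<in>{..<n}. B (r (Suc i)) \<omega> - B (r i) \<omega>) i)" if "u \<in> S" for u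
    proof -
      have "(\<Sum>i<idx u. (\<lambda>i\<in>{..<n}. B (r (Suc i)) \<omega> - B (r i) \<omega>) i)
          = (\<Sum>i<idx u. B (r (Suc i)) \<omega> - B (r i) \<omega>)"
        using idx[OF that] by (intro sum.cong) auto
      also have "\<dots> = B (r (idx u)) \<omega> - B (r 0) \<omega>"
        by (rule sum_lessThan_telescope)
      finally show ?thesis using idx[OF that] elim r0 by simp
    qed
    then show ?case by (auto simp: \<Phi>_def fun_eq_iff restrict_def)
  qed
  then show thesis
    using that[OF _ mono rn _ meas] r0 by (simp add: r_def)
qed

text \<open>
  Independence of the increments transfers to functions of disjoint groups of them.
\<close>

lemma path_events_indep_increment:
  assumes s: "0 \<le> s" "s < t" and E: "E \<in> path_events s" and C: "C \<in> sets (borel :: real measure)"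
  shows "prob (E \<inter> ((\<lambda>\<omega>. B t \<omega> - B s \<omega>) -` C \<inter> space P))
       = prob E * prob ((\<lambda>\<omega>. B t \<omega> - B s \<omega>) -` C \<inter> space P)"
proof -
  from E obtain S D where 1: "E \<in> events" "finite S" "S \<subseteq> {0..s}" "D \<in> sets (PiM S (\<lambda>_. borel))"
    "AE \<omega> in P. \<omega> \<in> E \<longleftrightarrow> (\<lambda>u\<in>S. B u \<omega>) \<in> D" by (rule path_eventsE)
  obtain n r \<Phi> where r: "0 \<le> r 0" "strict_mono_on {..Suc n} r" "r n = s" "r (Suc n) = t"
    and \<Phi>: "\<Phi> \<in> measurable (PiM {..<n} (\<lambda>_. borel)) (PiM S (\<lambda>_. borel :: real measure))"
    and eq: "AE \<omega> in P. (\<lambda>u\<in>S. B u \<omega>) = \<Phi> (\<lambda>i\<in>{..<n}. B (r (Suc i)) \<omega> - B (r i) \<omega>)"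
    using path_vector_of_increments[OF s 1(2,3)] .
  let ?I = "\<lambda>i \<omega>. B (r (Suc i)) \<omega> - B (r i) \<omega>"
  let ?X = "\<lambda>\<omega>. \<lambda>i\<in>{..<n}. ?I i \<omega>" and ?Y = "\<lambda>\<omega>. \<lambda>i\<in>{n}. ?I i \<omega>"
  have "indep_vars (\<lambda>_. borel) ?I {..<Suc n}" by (rule B_indep_increments[OF r(1,2)])
  then have "indep_var (PiM {..<n} (\<lambda>_. borel)) ?X (PiM {n} (\<lambda>_. borel)) ?Y"
    by (rule indep_var_restrict) auto
  \<comment> \<open>The indicator is used because \<open>indep_var\<close> requires both variables to have the same type.\<close>
  moreover have "(\<lambda>x. indicator D (\<Phi> x) :: real) \<in> borel_measurable (PiM {..<n} (\<lambda>_. borel))"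
    by (rule measurable_compose[OF \<Phi>]) (rule borel_measurable_indicator[OF 1(4)])
  ultimately have ind: "indep_var borel ((\<lambda>x. indicator D (\<Phi> x) :: real) \<circ> ?X) borel ((\<lambda>y. y n) \<circ> ?Y)"
    by (rule indep_var_compose) (auto intro: measurable_component_singleton)
  have Y: "(\<lambda>y. y n) \<circ> ?Y = (\<lambda>\<omega>. B t \<omega> - B s \<omega>)" using r by (simp add: fun_eq_iff)
  let ?Z = "(\<lambda>x. indicator D (\<Phi> x) :: real) \<circ> ?X"
  let ?F = "?Z -` {1} \<inter> space P" and ?G = "(\<lambda>\<omega>. B t \<omega> - B s \<omega>) -` C \<inter> space P"
  have rv: "random_variable borel ?Z" "random_variable borel (\<lambda>\<omega>. B t \<omega> - B s \<omega>)"
    using ind unfolding Y by (auto simp: indep_var_eq)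
  have F: "?F \<in> events" using rv(1) by (rule measurable_sets) simp
  have G: "?G \<in> events" using rv(2) C by (rule measurable_sets)
  have ae: "AE \<omega> in P. \<omega> \<in> E \<longleftrightarrow> \<omega> \<in> ?F"
    using 1(5) eq AE_space by eventually_elim (auto simp: indicator_eq_1_iff)
  have "prob (E \<inter> ?G) = prob (?F \<inter> ?G)"
    using ae 1(1) F G by (intro finite_measure_eq_AE) auto
  also have "?F \<inter> ?G = (\<lambda>\<omega>. (?Z \<omega>, B t \<omega> - B s \<omega>)) -` ({1} \<times> C) \<inter> space P" by auto
  also have "prob \<dots> = prob ?F * prob ?G"
    using indep_varD[OF ind _ C, of "{1}"] unfolding Y by simp
  also have "prob ?F = prob E" using ae 1(1) F by (intro finite_measure_eq_AE) auto
  finally show ?thesis .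
qed

text \<open>
  Independence extends from an intersection-stable generator to the generated \<open>\<sigma>\<close>-algebra.
\<close>

lemma indep_var_increment:
  fixes X :: "'a \<Rightarrow> real"
  assumes s: "0 \<le> s" "s < t" and X: "X \<in> borel_measurable (augfilt P B s)"
  shows "indep_var borel X borel (\<lambda>\<omega>. B t \<omega> - B s \<omega>)"
proof -
  let ?Y = "\<lambda>\<omega>. B t \<omega> - B s \<omega>"
  let ?H = "{?Y -` C \<inter> space P | C. C \<in> sets borel}"
  have Y: "?Y \<in> borel_measurable P" using B_measurable s by auto
  have H: "Int_stable ?H"
  proof (rule Int_stableI)
    fix a b assume "a \<in> ?H" "b \<in> ?H"
    then obtain C C' where "a = ?Y -` C \<inter> space P" "b = ?Y -` C' \<inter> space P" "C \<in> sets borel" "C' \<in> sets borel"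
      by auto
    then show "a \<inter> b \<in> ?H" by (auto intro!: exI[of _ "C \<inter> C'"])
  qed
  have "indep_set (path_events s) ?H"
    unfolding indep_sets2_eq
  proof (intro conjI ballI)
    show "path_events s \<subseteq> events" by (auto simp: path_events_def)
    show "?H \<subseteq> events" using Y by (auto intro: measurable_sets)
    fix a b assume a: "a \<in> path_events s" and "b \<in> ?H"
    then obtain C where "b = ?Y -` C \<inter> space P" "C \<in> sets borel" by auto
    then show "prob (a \<inter> b) = prob a * prob b" using path_events_indep_increment[OF s a] by simp
  qed
  then have ind: "indep_set (sigma_sets (space P) (path_events s)) (sigma_sets (space P) ?H)"
    by (rule indep_set_sigma_sets[OF _ path_events_Int_stable H])
  have sub: "sigma_sets (space P) {X -` A \<inter> space P | A. A \<in> sets borel}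
      \<subseteq> sigma_sets (space P) (path_events s)"
  proof (rule sigma_sets_mono)
    have "X -` A \<inter> space P \<in> sigma_sets (space P) (path_events s)" if "A \<in> sets borel" for A
      using measurable_sets[OF X that] augfilt_sets_path_events by (auto simp: augfilt_space)
    then show "{X -` A \<inter> space P | A. A \<in> sets borel} \<subseteq> sigma_sets (space P) (path_events s)" by auto
  qed
  show ?thesis
    unfolding indep_var_eq
    using augfilt_measurable_events[OF X] Y ind sub unfolding indep_sets2_eq by blast
qed

lemma increment_moments:
  assumes "0 \<le> s" "s < t"
  shows "integrable P (\<lambda>\<omega>. B t \<omega> - B s \<omega>)" "expectation (\<lambda>\<omega>. B t \<omega> - B s \<omega>) = 0"
    "integrable P (\<lambda>\<omega>. (B t \<omega> - B s \<omega>)\<^sup>2)" "expectation (\<lambda>\<omega>. (B t \<omega> - B s \<omega>)\<^sup>2) = t - s"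
proof -
  define \<sigma> where "\<sigma> = sqrt (t - s)"
  have \<sigma>: "0 < \<sigma>" "\<sigma>\<^sup>2 = t - s" using assms by (auto simp: \<sigma>_def)
  have D: "distributed P lborel (\<lambda>\<omega>. B t \<omega> - B s \<omega>) (normal_density 0 \<sigma>)"
    unfolding \<sigma>_def by (rule B_normal_increments[OF assms])
  note * = normal_density_nonneg
  show "integrable P (\<lambda>\<omega>. B t \<omega> - B s \<omega>)"
    using distributed_integrable[OF D, of "\<lambda>x. x"] integrable_normal_moment_nz_1[OF \<sigma>(1), of 0] by simp
  show "expectation (\<lambda>\<omega>. B t \<omega> - B s \<omega>) = 0"
    using distributed_integral[OF D, of "\<lambda>x. x"] integral_normal_moment_nz_1[OF \<sigma>(1), of 0] by simp
  show "integrable P (\<lambda>\<omega>. (B t \<omega> - B s \<omega>)\<^sup>2)"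
    using distributed_integrable[OF D, of "\<lambda>x. x\<^sup>2"] integrable_normal_moment[OF \<sigma>(1), of 0 2] by simp
  show "expectation (\<lambda>\<omega>. (B t \<omega> - B s \<omega>)\<^sup>2) = t - s"
    using distributed_integral[OF D, of "\<lambda>x. x\<^sup>2"] integral_normal_moment_even[OF \<sigma>(1), of 0 1] \<sigma>
    by simp
qed

text \<open>
  The two martingale facts behind all energy estimates: an increment has conditional mean \<open>0\<close> and
  conditional variance \<open>t - s\<close> given the past.
\<close>

lemma increment_orthogonal:
  fixes X :: "'a \<Rightarrow> real"
  assumes s: "0 \<le> s" "s < t" and X: "X \<in> borel_measurable (augfilt P B s)" "integrable P X"
  shows "integrable P (\<lambda>\<omega>. X \<omega> * (B t \<omega> - B s \<omega>))"
    "expectation (\<lambda>\<omega>. X \<omega> * (B t \<omega> - B s \<omega>)) = 0"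
    "integrable P (\<lambda>\<omega>. X \<omega> * (B t \<omega> - B s \<omega>)\<^sup>2)"
    "expectation (\<lambda>\<omega>. X \<omega> * (B t \<omega> - B s \<omega>)\<^sup>2) = (t - s) * expectation X"
proof -
  note ind = indep_var_increment[OF s X(1)]
  have ind2: "indep_var borel X borel (\<lambda>\<omega>. (B t \<omega> - B s \<omega>)\<^sup>2)"
    using indep_var_compose[OF ind, of "\<lambda>x. x" borel "\<lambda>x. x\<^sup>2" borel] by (simp add: comp_def)
  note m = increment_moments[OF s]
  show "integrable P (\<lambda>\<omega>. X \<omega> * (B t \<omega> - B s \<omega>))"
    by (rule indep_var_integrable[OF ind X(2) m(1)])
  show "expectation (\<lambda>\<omega>. X \<omega> * (B t \<omega> - B s \<omega>)) = 0"
    using indep_var_lebesgue_integral[OF ind X(2) m(1)] m(2) by simp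
  show "integrable P (\<lambda>\<omega>. X \<omega> * (B t \<omega> - B s \<omega>)\<^sup>2)"
    by (rule indep_var_integrable[OF ind2 X(2) m(3)])
  show "expectation (\<lambda>\<omega>. X \<omega> * (B t \<omega> - B s \<omega>)\<^sup>2) = (t - s) * expectation X"
    using indep_var_lebesgue_integral[OF ind2 X(2) m(3)] m(4) by simp
qed

end

section \<open>Square-integrable random variables\<close>

definition sqint :: "'a measure \<Rightarrow> ('a \<Rightarrow> real) \<Rightarrow> bool" where
  "sqint P X \<longleftrightarrow> X \<in> borel_measurable P \<and> integrable P (\<lambda>\<omega>. (X \<omega>)\<^sup>2)"

lemma sqint_measurable: "sqint P X \<Longrightarrow> X \<in> borel_measurable P"
  by (simp add: sqint_def)

lemma sqint_square: "sqint P X \<Longrightarrow> integrable P (\<lambda>\<omega>. (X \<omega>)\<^sup>2)"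
  by (simp add: sqint_def)

lemma sqint_times:
  assumes X: "sqint P X" and Y: "sqint P Y"
  shows "integrable P (\<lambda>\<omega>. X \<omega> * Y \<omega>)"
proof (rule Bochner_Integration.integrable_bound)
  show "integrable P (\<lambda>\<omega>. (X \<omega>)\<^sup>2 + (Y \<omega>)\<^sup>2)" using assms by (simp add: sqint_def)
  show "(\<lambda>\<omega>. X \<omega> * Y \<omega>) \<in> borel_measurable P" using assms by (auto simp: sqint_def)
  have "\<bar>x * y\<bar> \<le> \<bar>x\<^sup>2 + y\<^sup>2\<bar>" for x y :: real
  proof -
    have "\<bar>x\<bar> * \<bar>y\<bar> \<le> 2 * (\<bar>x\<bar> * \<bar>y\<bar>)" by simp
    also have "\<dots> \<le> x\<^sup>2 + y\<^sup>2" using sum_squares_bound[of "\<bar>x\<bar>" "\<bar>y\<bar>"] by (simp add: mult.assoc)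
    finally show ?thesis by (simp add: abs_mult)
  qed
  then show "AE \<omega> in P. norm (X \<omega> * Y \<omega>) \<le> norm ((X \<omega>)\<^sup>2 + (Y \<omega>)\<^sup>2)" by simp
qed

lemma sqint_cmult: "sqint P X \<Longrightarrow> sqint P (\<lambda>\<omega>. c * X \<omega>)"
  by (auto simp: sqint_def power_mult_distrib)

lemma sqint_divide: "sqint P X \<Longrightarrow> sqint P (\<lambda>\<omega>. X \<omega> / c)"
  using sqint_cmult[of P X "1 / c"] by simp

lemma sqint_add:
  assumes "sqint P X" "sqint P Y" shows "sqint P (\<lambda>\<omega>. X \<omega> + Y \<omega>)"
proof -
  have "integrable P (\<lambda>\<omega>. (X \<omega>)\<^sup>2 + (Y \<omega>)\<^sup>2 + 2 * (X \<omega> * Y \<omega>))"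
    using assms sqint_times[OF assms] by (simp add: sqint_def)
  moreover have "(X \<omega> + Y \<omega>)\<^sup>2 = (X \<omega>)\<^sup>2 + (Y \<omega>)\<^sup>2 + 2 * (X \<omega> * Y \<omega>)" for \<omega>
    by (simp add: power2_sum)
  ultimately show ?thesis using assms by (auto simp: sqint_def)
qed

lemma sqint_diff: "sqint P X \<Longrightarrow> sqint P Y \<Longrightarrow> sqint P (\<lambda>\<omega>. X \<omega> - Y \<omega>)"
  using sqint_add[of P X "\<lambda>\<omega>. - 1 * Y \<omega>"] sqint_cmult[of P Y "-1"] by simp

lemma sqint_abs: "sqint P X \<Longrightarrow> sqint P (\<lambda>\<omega>. \<bar>X \<omega>\<bar>)"
  by (auto simp: sqint_def)

lemma sqint_cong_AE:
  assumes "sqint P X" "Y \<in> borel_measurable P" "AE \<omega> in P. Y \<omega> = X \<omega>"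
  shows "sqint P Y"
proof -
  have "integrable P (\<lambda>\<omega>. (X \<omega>)\<^sup>2) \<longleftrightarrow> integrable P (\<lambda>\<omega>. (Y \<omega>)\<^sup>2)"
    using assms by (intro integrable_cong_AE) (auto simp: sqint_def)
  then show ?thesis using assms by (simp add: sqint_def)
qed

lemma sqint_bound_AE:
  assumes "sqint P X" "Y \<in> borel_measurable P" "AE \<omega> in P. \<bar>Y \<omega>\<bar> \<le> \<bar>X \<omega>\<bar>"
  shows "sqint P Y"
  unfolding sqint_def
proof
  show "integrable P (\<lambda>\<omega>. (Y \<omega>)\<^sup>2)"
  proof (rule Bochner_Integration.integrable_bound[OF sqint_square[OF assms(1)]])
    show "AE \<omega> in P. norm ((Y \<omega>)\<^sup>2) \<le> norm ((X \<omega>)\<^sup>2)"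
      using assms(3) by eventually_elim (auto simp: abs_le_square_iff)
  qed (use assms in simp)
qed (rule assms)

lemma sqint_slope:
  assumes "sqint P (u (Suc i))" "sqint P (u i)"
  shows "sqint P (\<lambda>\<omega>. slope h (\<lambda>j. u j \<omega>) i)"
  unfolding slope_def by (intro sqint_divide sqint_diff assms)

lemma sqint_mid_slope:
  assumes "sqint P (u (Suc (Suc i)))" "sqint P (u i)"
  shows "sqint P (\<lambda>\<omega>. mid_slope h (\<lambda>j. u j \<omega>) i)"
  unfolding mid_slope_def by (intro sqint_divide sqint_diff assms)

lemma sqint_laplace:
  assumes "sqint P (u (Suc (Suc i)))" "sqint P (u (Suc i))" "sqint P (u i)"
  shows "sqint P (\<lambda>\<omega>. laplace h (\<lambda>j. u j \<omega>) i)"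
  unfolding laplace_def by (intro sqint_divide sqint_diff sqint_add sqint_cmult assms)

section \<open>The scheme in expectation\<close>

text \<open>
  The scheme at \<open>N\<close> time levels. The velocity \<open>z n\<close> is the difference quotient of \<open>y\<close> over the
  interval that ends at the time \<open>n k\<close>, hence it is known at that time. The lower-order terms \<open>f\<close> and
  the noise intensity \<open>G\<close> enter only through their bounds; as for \<open>laplace\<close>, the index \<open>i\<close> of \<open>f\<close>,
  \<open>G\<close> and \<open>g\<close> refers to the node \<open>Suc i\<close>.
\<close>

locale stochastic_scheme = brownian_space P B
  for P :: "'a measure" and B +
  fixes M N :: nat and h k K :: real and y z f G g :: "nat \<Rightarrow> nat \<Rightarrow> 'a \<Rightarrow> real"
  assumes h_pos: "0 < h" and mesh: "real (Suc M) * h = 1"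
    and k_pos: "0 < k" and cfl: "4 * k \<le> h\<^sup>2" and K_nonneg: "0 \<le> K" and N_pos: "0 < N"
    and y_adapted: "\<And>n j. n \<le> N \<Longrightarrow> j \<le> Suc M \<Longrightarrow> y n j \<in> borel_measurable (augfilt P B (real n * k))"
    and z_adapted: "\<And>n j. n \<le> N \<Longrightarrow> 0 < n \<Longrightarrow> j \<le> Suc M \<Longrightarrow> z n j \<in> borel_measurable (augfilt P B (real n * k))"
    and f_adapted: "\<And>n i. n < N \<Longrightarrow> 0 < n \<Longrightarrow> i < M \<Longrightarrow> f n i \<in> borel_measurable (augfilt P B (real n * k))"
    and G_adapted: "\<And>n i. n < N \<Longrightarrow> 0 < n \<Longrightarrow> i < M \<Longrightarrow> G n i \<in> borel_measurable (augfilt P B (real n * k))"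
    and y_initial: "\<And>j. j \<le> Suc M \<Longrightarrow> sqint P (y 0 j)"
    and z_initial: "\<And>j. j \<le> Suc M \<Longrightarrow> sqint P (z 1 j)"
    and g_sqint: "\<And>n i. n < N \<Longrightarrow> 0 < n \<Longrightarrow> i < M \<Longrightarrow> sqint P (g n i)"
    and y_boundary: "\<And>n. n \<le> N \<Longrightarrow> AE \<omega> in P. y n 0 \<omega> = 0 \<and> y n (Suc M) \<omega> = 0"
    and z_boundary: "\<And>n. n \<le> N \<Longrightarrow> 0 < n \<Longrightarrow> AE \<omega> in P. z n 0 \<omega> = 0 \<and> z n (Suc M) \<omega> = 0"
    and y_step: "\<And>n j. n < N \<Longrightarrow> j \<le> Suc M \<Longrightarrow> AE \<omega> in P. y (Suc n) j \<omega> = y n j \<omega> + k * z (Suc n) j \<omega>"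
    and z_step: "\<And>n i. n < N \<Longrightarrow> 0 < n \<Longrightarrow> i < M \<Longrightarrow> AE \<omega> in P. z (Suc n) (Suc i) \<omega> = z n (Suc i) \<omega>
        + k * laplace h (\<lambda>j. y n j \<omega>) i + k * f n i \<omega>
        + G n i \<omega> * (B (real (Suc n) * k) \<omega> - B (real n * k) \<omega>)"
    and f_bound: "\<And>n i. n < N \<Longrightarrow> 0 < n \<Longrightarrow> i < M \<Longrightarrow> AE \<omega> in P. \<bar>f n i \<omega>\<bar>
        \<le> K * (\<bar>y n (Suc i) \<omega>\<bar> + \<bar>mid_slope h (\<lambda>j. y n j \<omega>) i\<bar> + \<bar>z n (Suc i) \<omega>\<bar>)"
    and G_bound: "\<And>n i. n < N \<Longrightarrow> 0 < n \<Longrightarrow> i < M \<Longrightarrow> AE \<omega> in P. \<bar>G n i \<omega> - g n i \<omega>\<bar> \<le> K * \<bar>y n (Suc i) \<omega>\<bar>"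
begin

abbreviation (input) y_at :: "nat \<Rightarrow> 'a \<Rightarrow> nat \<Rightarrow> real" where "y_at n \<omega> \<equiv> \<lambda>j. y n j \<omega>"
abbreviation (input) z_at :: "nat \<Rightarrow> 'a \<Rightarrow> nat \<Rightarrow> real" where "z_at n \<omega> \<equiv> \<lambda>j. z n j \<omega>"

definition noise :: "nat \<Rightarrow> 'a \<Rightarrow> real" where
  "noise n \<omega> = B (real (Suc n) * k) \<omega> - B (real n * k) \<omega>"

lemma noise_orthogonal:
  assumes "X \<in> borel_measurable (augfilt P B (real n * k))" "integrable P X"
  shows "integrable P (\<lambda>\<omega>. X \<omega> * noise n \<omega>)" "expectation (\<lambda>\<omega>. X \<omega> * noise n \<omega>) = 0"
    "integrable P (\<lambda>\<omega>. X \<omega> * (noise n \<omega>)\<^sup>2)" "expectation (\<lambda>\<omega>. X \<omega> * (noise n \<omega>)\<^sup>2) = k * expectation X"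
  using increment_orthogonal[OF _ _ assms, of "real (Suc n) * k"] k_pos
  by (simp_all add: noise_def algebra_simps)

lemma noise_measurable: "noise n \<in> borel_measurable P"
  unfolding noise_def[abs_def] using k_pos B_measurable by auto

lemma sqint_forces:
  assumes n: "n < N" "0 < n" "i < M" and y: "\<And>j. j \<le> Suc M \<Longrightarrow> sqint P (y n j)"
    and z: "\<And>j. j \<le> Suc M \<Longrightarrow> sqint P (z n j)"
  shows "sqint P (f n i)" "sqint P (G n i)" "sqint P (\<lambda>\<omega>. G n i \<omega> * noise n \<omega>)"
proof -
  have "sqint P (\<lambda>\<omega>. K * (\<bar>y n (Suc i) \<omega>\<bar> + \<bar>mid_slope h (\<lambda>j. y n j \<omega>) i\<bar> + \<bar>z n (Suc i) \<omega>\<bar>))"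
    using n by (intro sqint_cmult sqint_add sqint_abs sqint_mid_slope y z) auto
  then show "sqint P (f n i)"
    by (rule sqint_bound_AE) (use f_bound[OF n] augfilt_measurable_events[OF f_adapted[OF n]] in auto)
  have "sqint P (\<lambda>\<omega>. \<bar>g n i \<omega>\<bar> + K * \<bar>y n (Suc i) \<omega>\<bar>)"
    using n by (intro sqint_cmult sqint_add sqint_abs y g_sqint) auto
  then show G: "sqint P (G n i)"
  proof (rule sqint_bound_AE)
    show "AE \<omega> in P. \<bar>G n i \<omega>\<bar> \<le> \<bar>\<bar>g n i \<omega>\<bar> + K * \<bar>y n (Suc i) \<omega>\<bar>\<bar>"
      using G_bound[OF n] by eventually_elim auto
  qed (rule augfilt_measurable_events[OF G_adapted[OF n]])
  have "(\<lambda>\<omega>. (G n i \<omega>)\<^sup>2) \<in> borel_measurable (augfilt P B (real n * k))"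
    using G_adapted[OF n] by simp
  then have "integrable P (\<lambda>\<omega>. (G n i \<omega>)\<^sup>2 * (noise n \<omega>)\<^sup>2)"
    using sqint_square[OF G] by (intro noise_orthogonal)
  then show "sqint P (\<lambda>\<omega>. G n i \<omega> * noise n \<omega>)"
    using sqint_measurable[OF G] noise_measurable[of n] by (simp add: sqint_def power_mult_distrib)
qed

text \<open>
  Square integrability propagates, since the noise increment is independent of its factor \<open>G\<close>.
\<close>

lemma sqint_solution:
  assumes "n < N"
  shows "\<forall>j\<le>Suc M. sqint P (y (Suc n) j) \<and> sqint P (z (Suc n) j)"
  using assms
proof (induction n)
  case 0
  show ?case
  proof (intro allI impI conjI)
    fix j assume j: "j \<le> Suc M"
    show z1: "sqint P (z (Suc 0) j)" using z_initial[OF j] by simp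
    show "sqint P (y (Suc 0) j)"
      by (rule sqint_cong_AE[OF sqint_add[OF y_initial[OF j] sqint_cmult[OF z1, of k]]])
        (use y_step[of 0 j] augfilt_measurable_events[OF y_adapted[of "Suc 0" j]] 0 j in auto)
  qed
next
  case (Suc n)
  then have n: "Suc n < N" "0 < Suc n" "n < N" by auto
  have y: "sqint P (y (Suc n) j)" and z: "sqint P (z (Suc n) j)" if "j \<le> Suc M" for j
    using Suc.IH[OF n(3)] that by auto
  show ?case
  proof (intro allI impI conjI)
    fix j assume j: "j \<le> Suc M"
    have meas: "z (Suc (Suc n)) j \<in> borel_measurable P" "y (Suc (Suc n)) j \<in> borel_measurable P"
      using z_adapted[of "Suc (Suc n)" j] y_adapted[of "Suc (Suc n)" j] n j
      by (auto intro: augfilt_measurable_events)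
    show z': "sqint P (z (Suc (Suc n)) j)"
    proof (cases "j = 0 \<or> j = Suc M")
      case True
      have "sqint P (\<lambda>\<omega>. 0)" by (simp add: sqint_def)
      then show ?thesis
      proof (rule sqint_cong_AE)
        show "AE \<omega> in P. z (Suc (Suc n)) j \<omega> = 0"
          using z_boundary[of "Suc (Suc n)"] n True by auto
      qed (rule meas)
    next
      case False
      then obtain i where i: "j = Suc i" "i < M" using j by (cases j) auto
      have "sqint P (\<lambda>\<omega>. z (Suc n) (Suc i) \<omega> + k * laplace h (\<lambda>j. y (Suc n) j \<omega>) i
          + k * f (Suc n) i \<omega> + G (Suc n) i \<omega> * noise (Suc n) \<omega>)"
        using i by (intro sqint_add sqint_cmult sqint_laplace sqint_forces[OF n(1,2) i(2)] y z) auto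
      then show ?thesis
        by (rule sqint_cong_AE) (use meas z_step[OF n(1,2) i(2)] i in \<open>auto simp: noise_def\<close>)
    qed
    show "sqint P (y (Suc (Suc n)) j)"
      by (rule sqint_cong_AE[OF sqint_add[OF y[OF j] sqint_cmult[OF z', of k]]])
        (use y_step[of "Suc n" j] meas n j in auto)
  qed
qed

lemma sqint_y: "n \<le> N \<Longrightarrow> j \<le> Suc M \<Longrightarrow> sqint P (y n j)"
  using y_initial sqint_solution[of "n - 1"] by (cases n) auto

lemma sqint_z: "n \<le> N \<Longrightarrow> 0 < n \<Longrightarrow> j \<le> Suc M \<Longrightarrow> sqint P (z n j)"
  using sqint_solution[of "n - 1"] by (cases n) auto

lemma sqint_f: "n < N \<Longrightarrow> 0 < n \<Longrightarrow> i < M \<Longrightarrow> sqint P (f n i)"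
  and sqint_G: "n < N \<Longrightarrow> 0 < n \<Longrightarrow> i < M \<Longrightarrow> sqint P (G n i)"
  using sqint_forces[of n i] sqint_y sqint_z by auto

lemma sqint_slope_y: "n \<le> N \<Longrightarrow> i \<le> M \<Longrightarrow> sqint P (\<lambda>\<omega>. slope h (y_at n \<omega>) i)"
  by (intro sqint_slope sqint_y) auto

lemma sqint_mid_slope_y: "n \<le> N \<Longrightarrow> i < M \<Longrightarrow> sqint P (\<lambda>\<omega>. mid_slope h (y_at n \<omega>) i)"
  by (intro sqint_mid_slope sqint_y) auto

lemma integrable_stiffness_y: "n \<le> N \<Longrightarrow> integrable P (\<lambda>\<omega>. stiffness M h (y_at n \<omega>))"
  unfolding stiffness_def by (intro Bochner_Integration.integrable_sum sqint_square sqint_slope_y) auto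

lemma integrable_mass_z: "n \<le> N \<Longrightarrow> 0 < n \<Longrightarrow> integrable P (\<lambda>\<omega>. mass M (z_at n \<omega>))"
  unfolding mass_def by (intro Bochner_Integration.integrable_sum sqint_square sqint_z) auto

lemma pathwise:
  assumes n: "n < N" "0 < n"
  shows "AE \<omega> in P. scheme_step M h k K (y_at n \<omega>) (z_at n \<omega>) (y_at (Suc n) \<omega>) (z_at (Suc n) \<omega>)
     (\<lambda>i. f n i \<omega>) (\<lambda>i. G n i \<omega> * noise n \<omega>)"
proof -
  have 1: "AE \<omega> in P. \<forall>j\<in>{..Suc M}. y (Suc n) j \<omega> = y n j \<omega> + k * z (Suc n) j \<omega>"
    using n y_step by (intro AE_finite_allI) auto
  have 2: "AE \<omega> in P. \<forall>i\<in>{..<M}. z (Suc n) (Suc i) \<omega> = z n (Suc i) \<omega>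
        + k * laplace h (y_at n \<omega>) i + k * f n i \<omega> + G n i \<omega> * noise n \<omega>"
    unfolding noise_def using n z_step by (intro AE_finite_allI) auto
  have 3: "AE \<omega> in P. \<forall>i\<in>{..<M}. \<bar>f n i \<omega>\<bar>
        \<le> K * (\<bar>y n (Suc i) \<omega>\<bar> + \<bar>mid_slope h (y_at n \<omega>) i\<bar> + \<bar>z n (Suc i) \<omega>\<bar>)"
    using n f_bound by (intro AE_finite_allI) auto
  have 4: "AE \<omega> in P. y n 0 \<omega> = 0 \<and> y n (Suc M) \<omega> = 0"
    "AE \<omega> in P. z (Suc n) 0 \<omega> = 0 \<and> z (Suc n) (Suc M) \<omega> = 0"
    using n y_boundary[of n] z_boundary[of "Suc n"] by auto
  show ?thesis
    using 1 2 3 4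
    by eventually_elim (unfold_locales; use h_pos mesh k_pos cfl K_nonneg in auto)
qed

lemma expected_martingale:
  assumes n: "n < N" and X: "\<And>i. i < M \<Longrightarrow> X i \<in> borel_measurable (augfilt P B (real n * k))"
    and "\<And>i. i < M \<Longrightarrow> integrable P (X i)"
  shows "integrable P (\<lambda>\<omega>. \<Sum>i<M. X i \<omega> * noise n \<omega>)"
    "expectation (\<lambda>\<omega>. \<Sum>i<M. X i \<omega> * noise n \<omega>) = 0"
proof -
  have i: "integrable P (\<lambda>\<omega>. X i \<omega> * noise n \<omega>)" "expectation (\<lambda>\<omega>. X i \<omega> * noise n \<omega>) = 0"
    if "i < M" for i using noise_orthogonal[OF X assms(3)] that by auto
  then show "integrable P (\<lambda>\<omega>. \<Sum>i<M. X i \<omega> * noise n \<omega>)" by auto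
  show "expectation (\<lambda>\<omega>. \<Sum>i<M. X i \<omega> * noise n \<omega>) = 0"
    using i by (subst Bochner_Integration.integral_sum) auto
qed

lemma expected_noise_energy:
  assumes n: "n < N" "0 < n"
  shows "integrable P (\<lambda>\<omega>. \<Sum>i<M. (G n i \<omega> * noise n \<omega>)\<^sup>2)"
    "expectation (\<lambda>\<omega>. \<Sum>i<M. (G n i \<omega> * noise n \<omega>)\<^sup>2) = k * expectation (\<lambda>\<omega>. \<Sum>i<M. (G n i \<omega>)\<^sup>2)"
proof -
  have m: "(\<lambda>\<omega>. (G n i \<omega>)\<^sup>2) \<in> borel_measurable (augfilt P B (real n * k))" if "i < M" for i
    using G_adapted[OF n that] by simp
  have i: "integrable P (\<lambda>\<omega>. (G n i \<omega>)\<^sup>2 * (noise n \<omega>)\<^sup>2)"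
    "expectation (\<lambda>\<omega>. (G n i \<omega>)\<^sup>2 * (noise n \<omega>)\<^sup>2) = k * expectation (\<lambda>\<omega>. (G n i \<omega>)\<^sup>2)"
    if "i < M" for i using noise_orthogonal[OF m sqint_square[OF sqint_G]] n that by auto
  show "integrable P (\<lambda>\<omega>. \<Sum>i<M. (G n i \<omega> * noise n \<omega>)\<^sup>2)"
    unfolding power_mult_distrib using i by auto
  have "expectation (\<lambda>\<omega>. \<Sum>i<M. (G n i \<omega> * noise n \<omega>)\<^sup>2)
      = (\<Sum>i<M. expectation (\<lambda>\<omega>. (G n i \<omega>)\<^sup>2 * (noise n \<omega>)\<^sup>2))"
    unfolding power_mult_distrib using i by (intro Bochner_Integration.integral_sum) auto
  also have "\<dots> = (\<Sum>i<M. k * expectation (\<lambda>\<omega>. (G n i \<omega>)\<^sup>2))"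
    using i by (intro sum.cong) auto
  also have "\<dots> = k * expectation (\<lambda>\<omega>. \<Sum>i<M. (G n i \<omega>)\<^sup>2)"
    using sqint_square[OF sqint_G[OF n]]
    by (subst Bochner_Integration.integral_sum) (auto simp: sum_distrib_left)
  finally show "expectation (\<lambda>\<omega>. \<Sum>i<M. (G n i \<omega> * noise n \<omega>)\<^sup>2) = \<dots>" .
qed

definition energy :: "nat \<Rightarrow> real" where
  "energy n = expectation (\<lambda>\<omega>. stiffness M h (y_at n \<omega>)) + expectation (\<lambda>\<omega>. mass M (z_at n \<omega>))"

definition noise_energy :: "nat \<Rightarrow> real" where
  "noise_energy n = expectation (\<lambda>\<omega>. \<Sum>i<M. (G n i \<omega>)\<^sup>2)"

lemma energy_nonneg: "0 \<le> energy n"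
  unfolding energy_def by (intro add_nonneg_nonneg integral_nonneg_AE) (auto simp: stiffness_nonneg mass_nonneg)

lemma noise_energy_nonneg: "0 \<le> noise_energy n"
  unfolding noise_energy_def by (intro integral_nonneg_AE AE_I2 sum_nonneg) auto

lemma energy_martingale:
  assumes n: "n < N" "0 < n"
  shows "integrable P (\<lambda>\<omega>. \<Sum>i<M. 2 * (z n (Suc i) \<omega> + k * f n i \<omega>) * (G n i \<omega> * noise n \<omega>))"
    "expectation (\<lambda>\<omega>. \<Sum>i<M. 2 * (z n (Suc i) \<omega> + k * f n i \<omega>) * (G n i \<omega> * noise n \<omega>)) = 0"
proof -
  have "(\<lambda>\<omega>. 2 * (z n (Suc i) \<omega> + k * f n i \<omega>) * G n i \<omega>) \<in> borel_measurable (augfilt P B (real n * k))"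
    if "i < M" for i
    using z_adapted[of n "Suc i"] f_adapted[OF n that] G_adapted[OF n that] n that by simp
  moreover have "integrable P (\<lambda>\<omega>. 2 * (z n (Suc i) \<omega> + k * f n i \<omega>) * G n i \<omega>)" if "i < M" for i
    using n that by (intro sqint_times sqint_cmult sqint_add sqint_z sqint_f sqint_G) auto
  ultimately have *: "integrable P (\<lambda>\<omega>. \<Sum>i<M. 2 * (z n (Suc i) \<omega> + k * f n i \<omega>) * G n i \<omega> * noise n \<omega>)"
    "expectation (\<lambda>\<omega>. \<Sum>i<M. 2 * (z n (Suc i) \<omega> + k * f n i \<omega>) * G n i \<omega> * noise n \<omega>) = 0"
    using expected_martingale[OF n(1), of "\<lambda>i \<omega>. 2 * (z n (Suc i) \<omega> + k * f n i \<omega>) * G n i \<omega>"] by auto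
  show "integrable P (\<lambda>\<omega>. \<Sum>i<M. 2 * (z n (Suc i) \<omega> + k * f n i \<omega>) * (G n i \<omega> * noise n \<omega>))"
    "expectation (\<lambda>\<omega>. \<Sum>i<M. 2 * (z n (Suc i) \<omega> + k * f n i \<omega>) * (G n i \<omega> * noise n \<omega>)) = 0"
    using * by (simp_all only: mult.assoc)
qed

text \<open>
  Noise can only add energy; the loss per step is at most of order \<open>k\<close>.
\<close>

lemma energy_decay_bound:
  assumes n: "n < N" "0 < n"
  shows "(1 - (4 * K + 1) * k) * energy n + k * noise_energy n \<le> energy (Suc n)"
proof -
  define X where "X = (\<lambda>\<omega>. (\<Sum>i<M. 2 * (z n (Suc i) \<omega> + k * f n i \<omega>) * (G n i \<omega> * noise n \<omega>)))"
  define Q where "Q = (\<lambda>\<omega>. (\<Sum>i<M. (G n i \<omega> * noise n \<omega>)\<^sup>2))"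
  note [simp] = energy_martingale[OF n, folded X_def] expected_noise_energy[OF n, folded Q_def]
    integrable_stiffness_y[of n] integrable_stiffness_y[of "Suc n"]
    integrable_mass_z[of n] integrable_mass_z[of "Suc n"]
  let ?c = "1 - (4 * K + 1) * k"
  let ?L = "\<lambda>\<omega>. ?c * (stiffness M h (y_at n \<omega>) + mass M (z_at n \<omega>)) + X \<omega> + Q \<omega>"
  let ?R = "\<lambda>\<omega>. stiffness M h (y_at (Suc n) \<omega>) + mass M (z_at (Suc n) \<omega>)"
  have "expectation ?L \<le> expectation ?R"
  proof (rule integral_mono_AE)
    show "AE \<omega> in P. ?L \<omega> \<le> ?R \<omega>"
      using pathwise[OF n] by eventually_elim (unfold X_def Q_def, rule scheme_step.energy_lower_bound)
  qed (use n in auto)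
  moreover have "expectation ?R = energy (Suc n)" using n by (simp add: energy_def)
  moreover have "expectation ?L = ?c * energy n + k * noise_energy n"
    using n by (simp add: energy_def noise_energy_def)
  ultimately show ?thesis by simp
qed

lemma energy_growth_bound:
  assumes n: "n < N" "0 < n"
  shows "(1 - k) * energy (Suc n) \<le> (1 + (4 * K + 6 * K\<^sup>2) * k) * energy n + k * noise_energy n"
proof -
  define X where "X = (\<lambda>\<omega>. (\<Sum>i<M. 2 * (z n (Suc i) \<omega> + k * f n i \<omega>) * (G n i \<omega> * noise n \<omega>)))"
  define Q where "Q = (\<lambda>\<omega>. (\<Sum>i<M. (G n i \<omega> * noise n \<omega>)\<^sup>2))"
  note [simp] = energy_martingale[OF n, folded X_def] expected_noise_energy[OF n, folded Q_def]
    integrable_stiffness_y[of n] integrable_stiffness_y[of "Suc n"]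
    integrable_mass_z[of n] integrable_mass_z[of "Suc n"]
  let ?c = "1 + (4 * K + 6 * K\<^sup>2) * k"
  let ?R = "\<lambda>\<omega>. ?c * (stiffness M h (y_at n \<omega>) + mass M (z_at n \<omega>)) + X \<omega> + Q \<omega>"
  let ?L = "\<lambda>\<omega>. (1 - k) * (stiffness M h (y_at (Suc n) \<omega>) + mass M (z_at (Suc n) \<omega>))"
  have "expectation ?L \<le> expectation ?R"
  proof (rule integral_mono_AE)
    show "AE \<omega> in P. ?L \<omega> \<le> ?R \<omega>"
      using pathwise[OF n] by eventually_elim (unfold X_def Q_def, rule scheme_step.energy_upper_bound)
  qed (use n in auto)
  moreover have "expectation ?L = (1 - k) * energy (Suc n)" using n by (simp add: energy_def)
  moreover have "expectation ?R = ?c * energy n + k * noise_energy n"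
    using n by (simp add: energy_def noise_energy_def)
  ultimately show ?thesis by (simp only:)
qed

text \<open>
  The noise intensity and the source differ by \<open>d y\<close>, which the Poincare inequality controls.
\<close>

lemma noise_energy_bound:
  assumes n: "n < N" "0 < n"
  shows "noise_energy n \<le> 2 * expectation (\<lambda>\<omega>. \<Sum>i<M. (g n i \<omega>)\<^sup>2) + 2 * K\<^sup>2 * energy n"
    and "expectation (\<lambda>\<omega>. \<Sum>i<M. (g n i \<omega>)\<^sup>2) \<le> 2 * noise_energy n + 2 * K\<^sup>2 * energy n"
proof -
  have bd: "AE \<omega> in P. \<forall>i\<in>{..<M}. \<bar>G n i \<omega> - g n i \<omega>\<bar> \<le> K * \<bar>y n (Suc i) \<omega>\<bar>"
    using G_bound[OF n] by (intro AE_finite_allI) auto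
  have sq: "X\<^sup>2 \<le> 2 * Y\<^sup>2 + 2 * K\<^sup>2 * u\<^sup>2" if "\<bar>X - Y\<bar> \<le> K * \<bar>u\<bar>" for X Y u :: real
  proof -
    have "(X - Y)\<^sup>2 \<le> (K * u)\<^sup>2"
      using that K_nonneg by (intro abs_le_square_iff[THEN iffD1]) (simp add: abs_mult)
    moreover have "X\<^sup>2 \<le> 2 * Y\<^sup>2 + 2 * (X - Y)\<^sup>2"
      using zero_le_power2[of "X - 2 * Y"] by (simp add: power2_eq_square algebra_simps)
    ultimately show ?thesis by (simp add: power_mult_distrib)
  qed
  have p: "AE \<omega> in P. mass M (y_at n \<omega>) \<le> stiffness M h (y_at n \<omega>)"
    using pathwise[OF n] by eventually_elim (rule scheme_step.poincare)
  have sum: "(\<Sum>i<M. (X i)\<^sup>2) \<le> 2 * (\<Sum>i<M. (Y i)\<^sup>2) + 2 * K\<^sup>2 * (s + m)"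
    if "\<forall>i\<in>{..<M}. \<bar>X i - Y i\<bar> \<le> K * \<bar>u (Suc i)\<bar>" "mass M u \<le> s" "0 \<le> m" for X Y u s m
  proof -
    have "(\<Sum>i<M. (X i)\<^sup>2) \<le> (\<Sum>i<M. 2 * (Y i)\<^sup>2 + 2 * K\<^sup>2 * (u (Suc i))\<^sup>2)"
      using that(1) by (intro sum_mono sq) auto
    also have "\<dots> = 2 * (\<Sum>i<M. (Y i)\<^sup>2) + 2 * K\<^sup>2 * mass M u"
      by (simp add: sum.distrib sum_distrib_left mass_def)
    also have "\<dots> \<le> 2 * (\<Sum>i<M. (Y i)\<^sup>2) + 2 * K\<^sup>2 * (s + m)"
      using that by (intro add_left_mono mult_left_mono) auto
    finally show ?thesis .
  qed
  note [simp] = integrable_stiffness_y[of n] integrable_mass_z[of n]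
  define SG Sg where "SG = (\<lambda>\<omega>. \<Sum>i<M. (G n i \<omega>)\<^sup>2)" and "Sg = (\<lambda>\<omega>. \<Sum>i<M. (g n i \<omega>)\<^sup>2)"
  have [simp]: "integrable P SG" "integrable P Sg"
    unfolding SG_def Sg_def using sqint_square[OF sqint_G[OF n]] sqint_square[OF g_sqint[OF n]] by auto
  let ?E = "\<lambda>\<omega>. stiffness M h (y_at n \<omega>) + mass M (z_at n \<omega>)"
  have "expectation SG \<le> expectation (\<lambda>\<omega>. 2 * Sg \<omega> + 2 * K\<^sup>2 * ?E \<omega>)"
  proof (rule integral_mono_AE)
    show "AE \<omega> in P. SG \<omega> \<le> 2 * Sg \<omega> + 2 * K\<^sup>2 * ?E \<omega>"
      using bd p by eventually_elim (unfold SG_def Sg_def, rule sum, auto simp: mass_nonneg)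
  qed (use n in auto)
  also have "\<dots> = 2 * expectation Sg + 2 * K\<^sup>2 * energy n" using n by (simp add: energy_def)
  finally show "noise_energy n \<le> 2 * expectation (\<lambda>\<omega>. \<Sum>i<M. (g n i \<omega>)\<^sup>2) + 2 * K\<^sup>2 * energy n"
    by (simp add: SG_def Sg_def noise_energy_def)
  have "expectation Sg \<le> expectation (\<lambda>\<omega>. 2 * SG \<omega> + 2 * K\<^sup>2 * ?E \<omega>)"
  proof (rule integral_mono_AE)
    show "AE \<omega> in P. Sg \<omega> \<le> 2 * SG \<omega> + 2 * K\<^sup>2 * ?E \<omega>"
      using bd p
      by eventually_elim (unfold SG_def Sg_def, rule sum, auto simp: mass_nonneg abs_minus_commute)
  qed (use n in auto)
  also have "\<dots> = 2 * expectation SG + 2 * K\<^sup>2 * energy n" using n by (simp add: energy_def)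
  also have "expectation SG = noise_energy n" by (simp add: noise_energy_def SG_def)
  finally show "expectation (\<lambda>\<omega>. \<Sum>i<M. (g n i \<omega>)\<^sup>2) \<le> 2 * noise_energy n + 2 * K\<^sup>2 * energy n"
    by (simp add: Sg_def)
qed

text \<open>
  The energy at the first level uses \<open>y 1\<close> instead of the initial displacement \<open>y 0\<close>. Both have
  comparable slopes because \<open>y 1 - y 0 = k z 1\<close>.
\<close>

lemma initial_energy_bound:
  "energy 1 \<le> 2 * expectation (\<lambda>\<omega>. stiffness M h (y_at 0 \<omega>)) + 3 * expectation (\<lambda>\<omega>. mass M (z_at 1 \<omega>))"
  "expectation (\<lambda>\<omega>. stiffness M h (y_at 0 \<omega>)) \<le> 2 * energy 1"
proof -
  have "AE \<omega> in P. \<forall>j\<in>{..Suc M}. y (Suc 0) j \<omega> = y 0 j \<omega> + k * z (Suc 0) j \<omega>"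
    using y_step N_pos by (intro AE_finite_allI) auto
  moreover have "AE \<omega> in P. z (Suc 0) 0 \<omega> = 0 \<and> z (Suc 0) (Suc M) \<omega> = 0"
    using z_boundary[of "Suc 0"] N_pos by auto
  ultimately have "AE \<omega> in P. stiffness M h (y_at 1 \<omega>) \<le> 2 * stiffness M h (y_at 0 \<omega>) + 2 * mass M (z_at 1 \<omega>) \<and>
      stiffness M h (y_at 0 \<omega>) \<le> 2 * stiffness M h (y_at 1 \<omega>) + 2 * mass M (z_at 1 \<omega>)"
  proof eventually_elim
    case (elim \<omega>)
    have k1: "k \<le> 1"
    proof -
      have "1 * h \<le> real (Suc M) * h" using h_pos by (intro mult_right_mono) auto
      then have "h \<le> 1" unfolding mesh by simp
      then have "h\<^sup>2 \<le> 1" using h_pos by (simp add: power_le_one)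
      then show ?thesis using cfl by simp
    qed
    have S: "k\<^sup>2 * stiffness M h (z_at 1 \<omega>) \<le> mass M (z_at 1 \<omega>)"
    proof -
      have "k\<^sup>2 * stiffness M h (z_at 1 \<omega>) = k * (k * stiffness M h (z_at 1 \<omega>))"
        by (simp add: power2_eq_square)
      also have "\<dots> \<le> 1 * (h\<^sup>2 / 4 * stiffness M h (z_at 1 \<omega>))"
        using k_pos k1 cfl by (intro mult_mono mult_right_mono mult_nonneg_nonneg stiffness_nonneg) auto
      also have "\<dots> \<le> mass M (z_at 1 \<omega>)"
        using inverse_slope[of h "z_at 1 \<omega>" M] h_pos elim
        by (auto simp: stiffness_def mass_def simp del: sum.lessThan_Suc)
      finally show ?thesis .
    qed
    have step: "y 1 j \<omega> = y 0 j \<omega> + k * z 1 j \<omega>" if "j \<le> Suc M" for j using elim that by simp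
    have 1: "stiffness M h (y_at 1 \<omega>) \<le> 2 * stiffness M h (y_at 0 \<omega>) + 2 * (k\<^sup>2 * stiffness M h (z_at 1 \<omega>))"
      by (rule stiffness_add_le) (rule step)
    have "stiffness M h (y_at 0 \<omega>) \<le> 2 * stiffness M h (y_at 1 \<omega>) + 2 * ((- k)\<^sup>2 * stiffness M h (z_at 1 \<omega>))"
      by (rule stiffness_add_le) (simp add: step[unfolded One_nat_def])
    then show ?case using S 1 by simp
  qed
  then have ae: "AE \<omega> in P. stiffness M h (y_at 1 \<omega>) \<le> 2 * stiffness M h (y_at 0 \<omega>) + 2 * mass M (z_at 1 \<omega>)"
    "AE \<omega> in P. stiffness M h (y_at 0 \<omega>) \<le> 2 * stiffness M h (y_at 1 \<omega>) + 2 * mass M (z_at 1 \<omega>)"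
    by auto
  have [simp]: "integrable P (\<lambda>\<omega>. stiffness M h (y_at 0 \<omega>))"
    "integrable P (\<lambda>\<omega>. stiffness M h (y_at (Suc 0) \<omega>))"
    "integrable P (\<lambda>\<omega>. mass M (z_at (Suc 0) \<omega>))"
    using integrable_stiffness_y[of 0] integrable_stiffness_y[of 1] integrable_mass_z[of 1] N_pos by auto
  have "expectation (\<lambda>\<omega>. stiffness M h (y_at 1 \<omega>))
      \<le> expectation (\<lambda>\<omega>. 2 * stiffness M h (y_at 0 \<omega>) + 2 * mass M (z_at 1 \<omega>))"
    by (rule integral_mono_AE[OF _ _ ae(1)]) auto
  then show "energy 1 \<le> 2 * expectation (\<lambda>\<omega>. stiffness M h (y_at 0 \<omega>)) + 3 * expectation (\<lambda>\<omega>. mass M (z_at 1 \<omega>))"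
    unfolding energy_def by simp
  have "expectation (\<lambda>\<omega>. stiffness M h (y_at 0 \<omega>))
      \<le> expectation (\<lambda>\<omega>. 2 * stiffness M h (y_at 1 \<omega>) + 2 * mass M (z_at 1 \<omega>))"
    by (rule integral_mono_AE[OF _ _ ae(2)]) auto
  then show "expectation (\<lambda>\<omega>. stiffness M h (y_at 0 \<omega>)) \<le> 2 * energy 1"
    unfolding energy_def by simp
qed

section \<open>The weighted sideways estimate\<close>

text \<open>
  The weight \<open>exp (\<rho> (t - \<gamma> x))\<close>. It is geometric in both indices, so that its difference quotients
  are exact multiples of it.
\<close>

definition weight :: "real \<Rightarrow> real \<Rightarrow> nat \<Rightarrow> nat \<Rightarrow> real" where
  "weight \<rho> \<gamma> n i = exp (\<rho> * (real n * k - \<gamma> * (real i * h)))"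

definition weighted_stiffness :: "real \<Rightarrow> real \<Rightarrow> nat \<Rightarrow> real" where
  "weighted_stiffness \<rho> \<gamma> n = expectation (\<lambda>\<omega>. \<Sum>i<Suc M. weight \<rho> \<gamma> n i * (slope h (y_at n \<omega>) i)\<^sup>2)"

definition weighted_mass :: "real \<Rightarrow> real \<Rightarrow> nat \<Rightarrow> real" where
  "weighted_mass \<rho> \<gamma> n = expectation (\<lambda>\<omega>. \<Sum>i<M. weight \<rho> \<gamma> n (Suc i) * (z n (Suc i) \<omega>)\<^sup>2)"

definition weighted_jumps :: "real \<Rightarrow> real \<Rightarrow> nat \<Rightarrow> real" where
  "weighted_jumps \<rho> \<gamma> n = expectation (\<lambda>\<omega>. \<Sum>i<Suc M. weight \<rho> \<gamma> n i * (z n (Suc i) \<omega> - z n i \<omega>)\<^sup>2)"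

definition weighted_momentum :: "real \<Rightarrow> real \<Rightarrow> nat \<Rightarrow> real" where
  "weighted_momentum \<rho> \<gamma> n =
     expectation (\<lambda>\<omega>. \<Sum>i<M. weight \<rho> \<gamma> n (Suc i) * (mid_slope h (y_at n \<omega>) i * z n (Suc i) \<omega>))"

definition trace_energy :: "nat \<Rightarrow> real" where
  "trace_energy n = expectation (\<lambda>\<omega>. (slope h (y_at n \<omega>) 0)\<^sup>2)"

lemma sideways_bound:
  assumes n: "n < N" "0 < n" and \<rho>: "0 \<le> \<rho>" "0 \<le> \<gamma>"
  shows "((1 - exp (- \<rho> * \<gamma> * h)) * k - (exp (\<rho> * k) - 1) * h) / 2
       * (weighted_stiffness \<rho> \<gamma> n + weighted_mass \<rho> \<gamma> (Suc n))
    \<le> h * weighted_momentum \<rho> \<gamma> (Suc n) - h * weighted_momentum \<rho> \<gamma> n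
      + k / 2 * (exp (\<rho> * (real n * k)) * trace_energy n)
      + k / 4 * (1 - exp (- \<rho> * \<gamma> * h)) * weighted_jumps \<rho> \<gamma> (Suc n)
      + k * h * K * (5 / 2 * weighted_stiffness \<rho> \<gamma> n + weighted_mass \<rho> \<gamma> n / 2)"
proof -
  let ?\<theta> = "weight \<rho> \<gamma> n" and ?\<theta>' = "weight \<rho> \<gamma> (Suc n)"
  let ?\<kappa> = "exp (- \<rho> * \<gamma> * h)" and ?\<alpha> = "exp (\<rho> * k)"
  have \<theta>: "?\<theta> (Suc i) = ?\<kappa> * ?\<theta> i" "?\<theta>' i = ?\<alpha> * ?\<theta> i" "0 \<le> ?\<theta> i" for i
    by (simp_all add: weight_def exp_add[symmetric] algebra_simps)
  have \<theta>0: "?\<theta> 0 = exp (\<rho> * (real n * k))" by (simp add: weight_def)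
  have \<kappa>: "0 \<le> ?\<kappa>" "?\<kappa> \<le> 1" "1 \<le> ?\<alpha>" using \<rho> h_pos k_pos by auto
  define V where "V = (\<lambda>\<omega>. \<Sum>i<Suc M. ?\<theta> i * (slope h (y_at n \<omega>) i)\<^sup>2)"
  define Z where "Z = (\<lambda>\<omega>. \<Sum>i<M. ?\<theta> (Suc i) * (z n (Suc i) \<omega>)\<^sup>2)"
  define Z' where "Z' = (\<lambda>\<omega>. \<Sum>i<M. ?\<theta>' (Suc i) * (z (Suc n) (Suc i) \<omega>)\<^sup>2)"
  define J where "J = (\<lambda>\<omega>. \<Sum>i<Suc M. ?\<theta>' i * (z (Suc n) (Suc i) \<omega> - z (Suc n) i \<omega>)\<^sup>2)"
  define p where "p = (\<lambda>\<omega>. \<Sum>i<M. ?\<theta> (Suc i) * (mid_slope h (y_at n \<omega>) i * z n (Suc i) \<omega>))"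
  define p' where "p' = (\<lambda>\<omega>. \<Sum>i<M. ?\<theta>' (Suc i) * (mid_slope h (y_at (Suc n) \<omega>) i * z (Suc n) (Suc i) \<omega>))"
  define t where "t = (\<lambda>\<omega>. (slope h (y_at n \<omega>) 0)\<^sup>2)"
  define X where "X = (\<lambda>\<omega>. \<Sum>i<M. h * ?\<theta> (Suc i) * mid_slope h (y_at n \<omega>) i * (G n i \<omega> * noise n \<omega>))"
  note folds = V_def[symmetric] Z_def[symmetric] Z'_def[symmetric] J_def[symmetric]
    p_def[symmetric] p'_def[symmetric] t_def[symmetric]
  have step: "AE \<omega> in P. ((1 - ?\<kappa>) * k - (?\<alpha> - 1) * h) / 2 * (V \<omega> + Z' \<omega>)
      \<le> h * p' \<omega> - h * p \<omega> + k / 2 * (?\<theta> 0 * t \<omega>) + k / 4 * (1 - ?\<kappa>) * J \<omega>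
       + k * h * K * (5 / 2 * V \<omega> + Z \<omega> / 2) - X \<omega>"
    using pathwise[OF n]
  proof eventually_elim
    case (elim \<omega>)
    show ?case
      using scheme_step.sideways_step[OF elim, of ?\<theta> ?\<kappa> ?\<theta>' ?\<alpha>, OF \<theta>(1) \<theta>(3) \<theta>(2) \<kappa>]
      by (simp only: V_def Z_def Z'_def J_def p_def p'_def t_def X_def)
  qed
  have [simp]: "integrable P V" "integrable P Z" "integrable P Z'" "integrable P J"
    "integrable P p" "integrable P p'" "integrable P t"
    unfolding V_def Z_def Z'_def J_def p_def p'_def t_def using n
    by (auto intro!: Bochner_Integration.integrable_sum integrable_mult_right sqint_square sqint_diff sqint_times
         sqint_slope_y sqint_mid_slope_y sqint_z simp del: sum.lessThan_Suc)
  have X: "integrable P X" "expectation X = 0"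
  proof -
    have "(\<lambda>\<omega>. h * ?\<theta> (Suc i) * mid_slope h (y_at n \<omega>) i * G n i \<omega>) \<in> borel_measurable (augfilt P B (real n * k))"
      if "i < M" for i
      using y_adapted[of n "Suc (Suc i)"] y_adapted[of n i] G_adapted[OF n that] n that
      by (simp add: mid_slope_def)
    moreover have "integrable P (\<lambda>\<omega>. h * ?\<theta> (Suc i) * mid_slope h (y_at n \<omega>) i * G n i \<omega>)" if "i < M" for i
      using n that by (intro sqint_times sqint_cmult sqint_mid_slope_y sqint_G) auto
    ultimately have "integrable P (\<lambda>\<omega>. \<Sum>i<M. h * ?\<theta> (Suc i) * mid_slope h (y_at n \<omega>) i * G n i \<omega> * noise n \<omega>)"
      "expectation (\<lambda>\<omega>. \<Sum>i<M. h * ?\<theta> (Suc i) * mid_slope h (y_at n \<omega>) i * G n i \<omega> * noise n \<omega>) = 0"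
      using expected_martingale[OF n(1), of "\<lambda>i \<omega>. h * ?\<theta> (Suc i) * mid_slope h (y_at n \<omega>) i * G n i \<omega>"]
      by auto
    then show "integrable P X" "expectation X = 0" unfolding X_def by (simp_all only: mult.assoc)
  qed
  note [simp] = X
  have "expectation (\<lambda>\<omega>. ((1 - ?\<kappa>) * k - (?\<alpha> - 1) * h) / 2 * (V \<omega> + Z' \<omega>))
      \<le> expectation (\<lambda>\<omega>. h * p' \<omega> - h * p \<omega> + k / 2 * (?\<theta> 0 * t \<omega>) + k / 4 * (1 - ?\<kappa>) * J \<omega>
       + k * h * K * (5 / 2 * V \<omega> + Z \<omega> / 2) - X \<omega>)"
    by (rule integral_mono_AE[OF _ _ step]) auto
  also have "expectation (\<lambda>\<omega>. ((1 - ?\<kappa>) * k - (?\<alpha> - 1) * h) / 2 * (V \<omega> + Z' \<omega>))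
      = ((1 - ?\<kappa>) * k - (?\<alpha> - 1) * h) / 2 * (expectation V + expectation Z')" by simp
  also have "expectation (\<lambda>\<omega>. h * p' \<omega> - h * p \<omega> + k / 2 * (?\<theta> 0 * t \<omega>) + k / 4 * (1 - ?\<kappa>) * J \<omega>
       + k * h * K * (5 / 2 * V \<omega> + Z \<omega> / 2) - X \<omega>)
     = h * expectation p' - h * expectation p + k / 2 * (?\<theta> 0 * expectation t)
       + k / 4 * (1 - ?\<kappa>) * expectation J
       + k * h * K * (5 / 2 * expectation V + expectation Z / 2)" by simp
  finally show ?thesis
    unfolding weighted_stiffness_def weighted_mass_def weighted_jumps_def weighted_momentum_def
      trace_energy_def folds \<theta>0 .
qed

end

section \<open>Observability in expectation\<close>

context stochastic_scheme
begin

definition potential_energy :: "nat \<Rightarrow> real" where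
  "potential_energy n = expectation (\<lambda>\<omega>. stiffness M h (y_at n \<omega>))"

definition kinetic_energy :: "nat \<Rightarrow> real" where
  "kinetic_energy n = expectation (\<lambda>\<omega>. mass M (z_at n \<omega>))"

definition jump_energy :: "nat \<Rightarrow> real" where
  "jump_energy n = expectation (\<lambda>\<omega>. \<Sum>i<Suc M. (z n (Suc i) \<omega> - z n i \<omega>)\<^sup>2)"

definition abs_momentum :: "nat \<Rightarrow> real" where
  "abs_momentum n = expectation (\<lambda>\<omega>. \<Sum>i<M. \<bar>mid_slope h (y_at n \<omega>) i * z n (Suc i) \<omega>\<bar>)"

definition force_energy :: "nat \<Rightarrow> real" where
  "force_energy n = expectation (\<lambda>\<omega>. \<Sum>i<M. (g n i \<omega>)\<^sup>2)"

lemma energy_split: "energy n = potential_energy n + kinetic_energy n"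
  by (simp add: energy_def potential_energy_def kinetic_energy_def)

lemma nonneg:
  "0 \<le> potential_energy n" "0 \<le> kinetic_energy n" "0 \<le> jump_energy n" "0 \<le> abs_momentum n"
  "0 \<le> force_energy n" "0 \<le> trace_energy n"
  unfolding potential_energy_def kinetic_energy_def jump_energy_def abs_momentum_def force_energy_def
    trace_energy_def
  by (intro integral_nonneg_AE AE_I2 sum_nonneg stiffness_nonneg mass_nonneg; simp)+

lemma weighted_nonneg: "0 \<le> weighted_stiffness \<rho> \<gamma> n" "0 \<le> weighted_mass \<rho> \<gamma> n"
  unfolding weighted_stiffness_def weighted_mass_def
  by (intro integral_nonneg_AE AE_I2 sum_nonneg; simp add: weight_def)+

lemma node_le_1: "i \<le> Suc M \<Longrightarrow> real i * h \<le> 1"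
proof -
  assume "i \<le> Suc M"
  then have "real i * h \<le> real (Suc M) * h" using h_pos by (intro mult_right_mono) auto
  then show ?thesis using mesh by simp
qed

lemma h_le_1: "h \<le> 1"
  using node_le_1[of 1] by simp

lemma k_le_quarter: "k \<le> 1 / 4"
proof -
  have "h\<^sup>2 \<le> 1" using h_le_1 h_pos by (simp add: power_le_one)
  then show ?thesis using cfl by simp
qed

text \<open>
  For \<open>n k \<ge> \<gamma>\<close> the lower bound is at least \<open>1\<close> on the whole mesh.
\<close>

lemma weight_lower:
  assumes "0 \<le> \<rho>" "0 \<le> \<gamma>" "i \<le> Suc M"
  shows "exp (\<rho> * (real n * k - \<gamma>)) \<le> weight \<rho> \<gamma> n i"
proof -
  have "\<gamma> * (real i * h) \<le> \<gamma> * 1" using assms node_le_1 by (intro mult_left_mono) auto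
  then show ?thesis unfolding weight_def using assms by (simp add: mult_left_mono)
qed

lemma weight_upper:
  assumes "0 \<le> \<rho>" "0 \<le> \<gamma>"
  shows "weight \<rho> \<gamma> n i \<le> exp (\<rho> * (real n * k))"
  unfolding weight_def using assms h_pos by (simp add: mult_left_mono)

lemma integrable_weighted:
  "n \<le> N \<Longrightarrow> integrable P (\<lambda>\<omega>. \<Sum>i<Suc M. w i * (slope h (y_at n \<omega>) i)\<^sup>2)"
  "n \<le> N \<Longrightarrow> 0 < n \<Longrightarrow> integrable P (\<lambda>\<omega>. \<Sum>i<M. w (Suc i) * (z n (Suc i) \<omega>)\<^sup>2)"
  "n \<le> N \<Longrightarrow> 0 < n \<Longrightarrow> integrable P (\<lambda>\<omega>. \<Sum>i<Suc M. w i * (z n (Suc i) \<omega> - z n i \<omega>)\<^sup>2)"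
  "n \<le> N \<Longrightarrow> 0 < n \<Longrightarrow> integrable P (\<lambda>\<omega>. \<Sum>i<M. w (Suc i) * (mid_slope h (y_at n \<omega>) i * z n (Suc i) \<omega>))"
  "n \<le> N \<Longrightarrow> 0 < n \<Longrightarrow> integrable P (\<lambda>\<omega>. \<Sum>i<M. \<bar>mid_slope h (y_at n \<omega>) i * z n (Suc i) \<omega>\<bar>)"
  by (auto intro!: Bochner_Integration.integrable_sum integrable_mult_right sqint_square sqint_diff sqint_times
       integrable_abs sqint_slope_y sqint_mid_slope_y sqint_z simp del: sum.lessThan_Suc)

lemma weighted_stiffness_lower:
  assumes "0 \<le> \<rho>" "0 \<le> \<gamma>" "n \<le> N"
  shows "exp (\<rho> * (real n * k - \<gamma>)) * potential_energy n \<le> weighted_stiffness \<rho> \<gamma> n"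
proof -
  have "expectation (\<lambda>\<omega>. exp (\<rho> * (real n * k - \<gamma>)) * stiffness M h (y_at n \<omega>))
      \<le> weighted_stiffness \<rho> \<gamma> n"
    unfolding weighted_stiffness_def
  proof (rule integral_mono)
    fix \<omega>
    show "exp (\<rho> * (real n * k - \<gamma>)) * stiffness M h (y_at n \<omega>)
        \<le> (\<Sum>i<Suc M. weight \<rho> \<gamma> n i * (slope h (y_at n \<omega>) i)\<^sup>2)"
      unfolding stiffness_def sum_distrib_left
      using assms by (intro sum_mono mult_right_mono weight_lower) auto
  qed (use assms integrable_stiffness_y integrable_weighted in auto)
  then show ?thesis by (simp add: potential_energy_def)
qed

lemma weighted_mass_lower:
  assumes "0 \<le> \<rho>" "0 \<le> \<gamma>" "n \<le> N" "0 < n"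
  shows "exp (\<rho> * (real n * k - \<gamma>)) * kinetic_energy n \<le> weighted_mass \<rho> \<gamma> n"
proof -
  have "expectation (\<lambda>\<omega>. exp (\<rho> * (real n * k - \<gamma>)) * mass M (z_at n \<omega>))
      \<le> weighted_mass \<rho> \<gamma> n"
    unfolding weighted_mass_def
  proof (rule integral_mono)
    fix \<omega>
    show "exp (\<rho> * (real n * k - \<gamma>)) * mass M (z_at n \<omega>)
        \<le> (\<Sum>i<M. weight \<rho> \<gamma> n (Suc i) * (z n (Suc i) \<omega>)\<^sup>2)"
      unfolding mass_def sum_distrib_left
      using assms by (intro sum_mono mult_right_mono weight_lower) auto
  qed (use assms integrable_mass_z integrable_weighted in auto)
  then show ?thesis by (simp add: kinetic_energy_def)
qed

lemma weighted_mass_upper: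
  assumes "0 \<le> \<rho>" "0 \<le> \<gamma>" "n \<le> N" "0 < n"
  shows "weighted_mass \<rho> \<gamma> n \<le> exp (\<rho> * (real n * k)) * kinetic_energy n"
proof -
  have "weighted_mass \<rho> \<gamma> n \<le> expectation (\<lambda>\<omega>. exp (\<rho> * (real n * k)) * mass M (z_at n \<omega>))"
    unfolding weighted_mass_def
  proof (rule integral_mono)
    fix \<omega>
    show "(\<Sum>i<M. weight \<rho> \<gamma> n (Suc i) * (z n (Suc i) \<omega>)\<^sup>2)
        \<le> exp (\<rho> * (real n * k)) * mass M (z_at n \<omega>)"
      unfolding mass_def sum_distrib_left
      using assms by (intro sum_mono mult_right_mono weight_upper) auto
  qed (use assms integrable_mass_z integrable_weighted in auto)
  then show ?thesis by (simp add: kinetic_energy_def)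
qed

lemma weighted_jumps_upper:
  assumes "0 \<le> \<rho>" "0 \<le> \<gamma>" "n \<le> N" "0 < n"
  shows "weighted_jumps \<rho> \<gamma> n \<le> exp (\<rho> * (real n * k)) * jump_energy n"
proof -
  have "weighted_jumps \<rho> \<gamma> n
      \<le> expectation (\<lambda>\<omega>. exp (\<rho> * (real n * k)) * (\<Sum>i<Suc M. (z n (Suc i) \<omega> - z n i \<omega>)\<^sup>2))"
    unfolding weighted_jumps_def
  proof (rule integral_mono)
    fix \<omega>
    show "(\<Sum>i<Suc M. weight \<rho> \<gamma> n i * (z n (Suc i) \<omega> - z n i \<omega>)\<^sup>2)
        \<le> exp (\<rho> * (real n * k)) * (\<Sum>i<Suc M. (z n (Suc i) \<omega> - z n i \<omega>)\<^sup>2)"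
      unfolding sum_distrib_left
      using assms by (intro sum_mono mult_right_mono weight_upper) auto
  qed (use assms integrable_weighted(3)[of n] integrable_weighted(3)[of n "\<lambda>_. 1"]
       in \<open>auto simp del: sum.lessThan_Suc\<close>)
  then show ?thesis by (simp add: jump_energy_def del: sum.lessThan_Suc)
qed

lemma weighted_momentum_upper:
  assumes "0 \<le> \<rho>" "0 \<le> \<gamma>" "n \<le> N" "0 < n"
  shows "\<bar>weighted_momentum \<rho> \<gamma> n\<bar> \<le> exp (\<rho> * (real n * k)) * abs_momentum n"
proof -
  let ?X = "\<lambda>\<omega>. \<Sum>i<M. weight \<rho> \<gamma> n (Suc i) * (mid_slope h (y_at n \<omega>) i * z n (Suc i) \<omega>)"
  have "\<bar>weighted_momentum \<rho> \<gamma> n\<bar> \<le> expectation (\<lambda>\<omega>. \<bar>?X \<omega>\<bar>)"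
    unfolding weighted_momentum_def by (rule integral_abs_bound)
  also have "\<dots> \<le> expectation (\<lambda>\<omega>. exp (\<rho> * (real n * k))
      * (\<Sum>i<M. \<bar>mid_slope h (y_at n \<omega>) i * z n (Suc i) \<omega>\<bar>))"
  proof (rule integral_mono)
    fix \<omega>
    have "\<bar>?X \<omega>\<bar> \<le> (\<Sum>i<M. \<bar>weight \<rho> \<gamma> n (Suc i) * (mid_slope h (y_at n \<omega>) i * z n (Suc i) \<omega>)\<bar>)"
      by (rule sum_abs)
    also have "\<dots> = (\<Sum>i<M. weight \<rho> \<gamma> n (Suc i) * \<bar>mid_slope h (y_at n \<omega>) i * z n (Suc i) \<omega>\<bar>)"
      by (intro sum.cong) (auto simp: abs_mult weight_def)
    also have "\<dots> \<le> exp (\<rho> * (real n * k)) * (\<Sum>i<M. \<bar>mid_slope h (y_at n \<omega>) i * z n (Suc i) \<omega>\<bar>)"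
      unfolding sum_distrib_left
      using assms by (intro sum_mono mult_right_mono weight_upper) auto
    finally show "\<bar>?X \<omega>\<bar> \<le> \<dots>" .
  qed (use assms integrable_weighted(4,5)[of n] in auto)
  finally show ?thesis by (simp add: abs_momentum_def)
qed

text \<open>
  The free parameter \<open>s\<close> is optimized only when the momentum is evaluated at the final time, where
  the potential energy is small and the kinetic energy merely bounded.
\<close>

lemma abs_momentum_le:
  assumes n: "n \<le> N" "0 < n" and s: "0 < s"
  shows "abs_momentum n \<le> (s * potential_energy n + kinetic_energy n / s) / 2"
proof -
  have [simp]: "integrable P (\<lambda>\<omega>. stiffness M h (y_at n \<omega>))" "integrable P (\<lambda>\<omega>. mass M (z_at n \<omega>))"
    using n integrable_stiffness_y integrable_mass_z by auto
  have "abs_momentum n \<le> expectation (\<lambda>\<omega>. (s * stiffness M h (y_at n \<omega>) + mass M (z_at n \<omega>) / s) / 2)"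
    unfolding abs_momentum_def
  proof (rule integral_mono)
    fix \<omega>
    have am: "\<bar>m * q\<bar> \<le> (s * m\<^sup>2 + q\<^sup>2 / s) / 2" for m q :: real
    proof -
      have "0 \<le> (s * \<bar>m\<bar> - \<bar>q\<bar>)\<^sup>2 / s" using s by simp
      also have "\<dots> = s * m\<^sup>2 + q\<^sup>2 / s - 2 * \<bar>m * q\<bar>"
        using s by (simp add: power2_eq_square abs_mult field_simps)
      finally show ?thesis by simp
    qed
    have "(\<Sum>i<M. \<bar>mid_slope h (y_at n \<omega>) i * z n (Suc i) \<omega>\<bar>)
        \<le> (\<Sum>i<M. (s * (mid_slope h (y_at n \<omega>) i)\<^sup>2 + (z n (Suc i) \<omega>)\<^sup>2 / s) / 2)"
      by (intro sum_mono am)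
    also have "\<dots> = (s * (\<Sum>i<M. (mid_slope h (y_at n \<omega>) i)\<^sup>2) + mass M (z_at n \<omega>) / s) / 2"
      by (simp only: sum_divide_distrib[symmetric] sum.distrib sum_distrib_left mass_def)
    also have "\<dots> \<le> (s * stiffness M h (y_at n \<omega>) + mass M (z_at n \<omega>) / s) / 2"
      using weighted_mid_slope[of "\<lambda>_. 1" h "y_at n \<omega>" M] s
      by (simp add: stiffness_def antimono_def del: sum.lessThan_Suc)
    finally show "(\<Sum>i<M. \<bar>mid_slope h (y_at n \<omega>) i * z n (Suc i) \<omega>\<bar>) \<le> \<dots>" .
  qed (use n integrable_weighted(5)[of n] in auto)
  then show ?thesis by (simp add: potential_energy_def kinetic_energy_def)
qed

text \<open>
  Gronwall backwards in time: the noise energy enters \<open>energy_decay_bound\<close> with a favourable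
  sign and is dropped.
\<close>

lemma energy_backward:
  assumes C: "(4 * K + 1) * k \<le> 1 / 2" and mn: "0 < m" "m \<le> n" "n \<le> N"
  shows "energy m \<le> exp (2 * (4 * K + 1) * (real N * k)) * energy n"
proof -
  let ?c = "(4 * K + 1) * k"
  have c: "0 \<le> ?c" using K_nonneg k_pos by simp
  have inv: "1 \<le> exp (2 * ?c) * (1 - ?c)"
  proof -
    have "1 \<le> (1 + 2 * ?c) * (1 - ?c)"
    proof -
      have "?c * ?c \<le> ?c * (1 / 2)" using C c by (intro mult_left_mono) auto
      then show ?thesis by (simp add: algebra_simps)
    qed
    also have "\<dots> \<le> exp (2 * ?c) * (1 - ?c)"
      using C exp_ge_add_one_self[of "2 * ?c"] by (intro mult_right_mono) auto
    finally show ?thesis .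
  qed
  have "energy m \<le> exp (2 * ?c * real (n - m)) * energy n" using mn(2)
  proof (induction n rule: dec_induct)
    case (step l)
    have "(1 - ?c) * energy l + k * noise_energy l \<le> energy (Suc l)"
      using step mn by (intro energy_decay_bound) auto
    moreover have "0 \<le> k * noise_energy l" using noise_energy_nonneg k_pos by simp
    ultimately have "(1 - ?c) * energy l \<le> energy (Suc l)" by linarith
    then have a: "exp (2 * ?c) * ((1 - ?c) * energy l) \<le> exp (2 * ?c) * energy (Suc l)"
      by (intro mult_left_mono) auto
    have b: "1 * energy l \<le> (exp (2 * ?c) * (1 - ?c)) * energy l"
      using inv energy_nonneg by (intro mult_right_mono) auto
    have "energy l \<le> exp (2 * ?c) * energy (Suc l)"
      using order_trans[OF b[unfolded mult.assoc] a] by simp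
    then have "exp (2 * ?c * real (l - m)) * energy l
        \<le> exp (2 * ?c * real (l - m)) * (exp (2 * ?c) * energy (Suc l))"
      by (intro mult_left_mono) auto
    also have "\<dots> = exp (2 * ?c * real (Suc l - m)) * energy (Suc l)"
    proof -
      have "real (Suc l - m) = 1 + real (l - m)" using step by simp
      then have "2 * ?c * real (l - m) + 2 * ?c = 2 * ?c * real (Suc l - m)" by (simp only: algebra_simps)
      then show ?thesis by (metis exp_add mult.assoc)
    qed
    finally show ?case using step.IH by linarith
  qed simp
  also have "\<dots> \<le> exp (2 * (4 * K + 1) * (real N * k)) * energy n"
  proof (intro mult_right_mono energy_nonneg)
    have "2 * ?c * real (n - m) \<le> 2 * ?c * real N" using c mn by (intro mult_left_mono) auto
    then show "exp (2 * ?c * real (n - m)) \<le> exp (2 * (4 * K + 1) * (real N * k))"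
      by (simp add: mult_ac)
  qed
  finally show ?thesis .
qed

text \<open>
  Gronwall forwards in time. Here the source has to be known; the bound is applied to sources in a
  ball.
\<close>

lemma energy_forward:
  assumes n: "0 < n" "n \<le> N"
  shows "energy n \<le> exp ((2 + 4 * K + 8 * K\<^sup>2) * (real N * k))
           * (energy 1 + 2 * (\<Sum>m\<in>{1..<n}. k * force_energy m))"
proof -
  let ?c = "4 * K + 8 * K\<^sup>2"
  define F where "F n = energy 1 + 2 * (\<Sum>m\<in>{1..<n}. k * force_energy m)" for n
  have c: "0 \<le> ?c" using K_nonneg by simp
  have step: "energy (Suc n) \<le> exp ((2 + ?c) * k) * (energy n + 2 * (k * force_energy n))"
    if n: "n < N" "0 < n" for n
  proof -
    let ?e = "energy n" and ?f = "2 * (k * force_energy n)"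
    have f: "0 \<le> ?f" using nonneg(5) k_pos by simp
    have "k * noise_energy n \<le> k * (2 * force_energy n + 2 * K\<^sup>2 * ?e)"
      using noise_energy_bound(1)[OF n] k_pos by (intro mult_left_mono) (auto simp: force_energy_def)
    then have "(1 - k) * energy (Suc n) \<le> (1 + ?c * k) * ?e + ?f"
      using energy_growth_bound[OF n] by (simp add: algebra_simps)
    also have "\<dots> \<le> exp (?c * k) * ?e + exp (?c * k) * ?f"
    proof (intro add_mono mult_right_mono energy_nonneg)
      show "1 + ?c * k \<le> exp (?c * k)" by (rule exp_ge_add_one_self)
      have "0 \<le> ?c * k" using c k_pos by simp
      then have "1 * ?f \<le> exp (?c * k) * ?f" using f by (intro mult_right_mono) auto
      then show "?f \<le> exp (?c * k) * ?f" by simp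
    qed
    finally have "exp (2 * k) * ((1 - k) * energy (Suc n)) \<le> exp (2 * k) * (exp (?c * k) * (?e + ?f))"
      by (intro mult_left_mono) (auto simp: distrib_left)
    moreover have "1 \<le> exp (2 * k) * (1 - k)"
    proof -
      have "k * k \<le> k * (1 / 4)" using k_le_quarter k_pos by (intro mult_left_mono) auto
      then have "1 \<le> (1 + 2 * k) * (1 - k)" using k_pos by (simp add: algebra_simps)
      also have "\<dots> \<le> exp (2 * k) * (1 - k)"
        using exp_ge_add_one_self[of "2 * k"] k_le_quarter by (intro mult_right_mono) auto
      finally show ?thesis .
    qed
    then have "1 * energy (Suc n) \<le> (exp (2 * k) * (1 - k)) * energy (Suc n)"
      using energy_nonneg by (intro mult_right_mono) auto
    ultimately show ?thesis
      by (simp add: mult.assoc[symmetric] exp_add[symmetric] distrib_right)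
  qed
  have F0: "0 \<le> F n" for n
    unfolding F_def using energy_nonneg nonneg(5) k_pos by (intro add_nonneg_nonneg mult_nonneg_nonneg sum_nonneg) auto
  have "energy n \<le> exp ((2 + ?c) * k * real n) * F n" using n
  proof (induction n)
    case (Suc n)
    show ?case
    proof (cases "n = 0")
      case True
      have "1 * energy 1 \<le> exp ((2 + ?c) * k) * energy 1"
        using energy_nonneg c k_pos by (intro mult_right_mono) auto
      then show ?thesis using True by (simp add: F_def)
    next
      case False
      let ?x = "exp ((2 + ?c) * k * real n)"
      have x: "1 \<le> ?x" using c k_pos by simp
      have f: "0 \<le> 2 * (k * force_energy n)" using nonneg(5) k_pos by simp
      have "energy n + 2 * (k * force_energy n) \<le> ?x * F n + ?x * (2 * (k * force_energy n))"
        using Suc False mult_right_mono[OF x f] by (intro add_mono) auto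
      also have "\<dots> = ?x * F (Suc n)"
        using False by (simp add: F_def algebra_simps)
      finally have "exp ((2 + ?c) * k) * (energy n + 2 * (k * force_energy n)) \<le> exp ((2 + ?c) * k) * (?x * F (Suc n))"
        by (intro mult_left_mono) auto
      also have "\<dots> = exp ((2 + ?c) * k * real (Suc n)) * F (Suc n)"
      proof -
        have "(2 + ?c) * k + (2 + ?c) * k * real n = (2 + ?c) * k * real (Suc n)"
          by (simp add: distrib_left)
        then show ?thesis by (metis exp_add mult.assoc)
      qed
      finally show ?thesis using step[of n] Suc False by simp
    qed
  qed simp
  also have "\<dots> \<le> exp ((2 + ?c) * (real N * k)) * F n"
  proof (intro mult_right_mono F0)
    have "(2 + ?c) * k * real n \<le> (2 + ?c) * k * real N" using c k_pos n by (intro mult_left_mono) auto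
    then show "exp ((2 + ?c) * k * real n) \<le> exp ((2 + ?c) * (real N * k))" by (simp add: mult_ac)
  qed
  finally show ?thesis by (simp add: F_def add.assoc)
qed

text \<open>
  Sum the energy inequality against \<open>T - t\<close>. Abel summation turns the increments of the energy into
  the energy itself, and the weight kills the term at the final time.
\<close>

lemma weighted_noise_energy:
  "(\<Sum>n\<in>{1..<N}. (real N * k - real n * k) * (k * noise_energy n))
     \<le> (1 + (4 * K + 1) * (real N * k)) * (\<Sum>n\<in>{1..N}. k * energy n)"
proof -
  let ?C = "4 * K + 1" and ?T = "real N * k"
  let ?\<tau> = "\<lambda>n. real N * k - real n * k"
  have C: "0 \<le> ?C" using K_nonneg by simp
  have step: "?\<tau> n * (k * noise_energy n)
      \<le> (?\<tau> (Suc n) * energy (Suc n) - ?\<tau> n * energy n) + k * energy (Suc n) + ?C * ?T * (k * energy n)"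
    if "n \<in> {1..<N}" for n
  proof -
    have \<tau>: "0 \<le> ?\<tau> n" "?\<tau> n \<le> ?T" using that k_pos by auto
    have "k * noise_energy n \<le> energy (Suc n) - energy n + ?C * k * energy n"
      using energy_decay_bound[of n] that by (simp add: algebra_simps)
    then have "?\<tau> n * (k * noise_energy n) \<le> ?\<tau> n * (energy (Suc n) - energy n + ?C * k * energy n)"
      using \<tau> by (intro mult_left_mono) auto
    also have "\<dots> = (?\<tau> (Suc n) * energy (Suc n) - ?\<tau> n * energy n) + k * energy (Suc n) + ?\<tau> n * (?C * (k * energy n))"
      by (simp add: algebra_simps)
    also have "?\<tau> n * (?C * (k * energy n)) \<le> ?T * (?C * (k * energy n))"
      using \<tau> C k_pos energy_nonneg by (intro mult_right_mono) auto
    finally show ?thesis by (simp add: mult_ac)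
  qed
  have "(\<Sum>n\<in>{1..<N}. ?\<tau> n * (k * noise_energy n))
      \<le> (\<Sum>n\<in>{1..<N}. (?\<tau> (Suc n) * energy (Suc n) - ?\<tau> n * energy n) + k * energy (Suc n) + ?C * ?T * (k * energy n))"
    by (rule sum_mono[OF step])
  also have "\<dots> = (\<Sum>n\<in>{1..<N}. ?\<tau> (Suc n) * energy (Suc n) - ?\<tau> n * energy n)
      + (\<Sum>n\<in>{1..<N}. k * energy (Suc n)) + ?C * ?T * (\<Sum>n\<in>{1..<N}. k * energy n)"
    by (simp only: sum.distrib sum_distrib_left)
  also have "(\<Sum>n\<in>{1..<N}. ?\<tau> (Suc n) * energy (Suc n) - ?\<tau> n * energy n) = ?\<tau> N * energy N - ?\<tau> 1 * energy 1"
    using N_pos by (intro sum_Suc_diff') auto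
  also have "\<dots> \<le> 0"
  proof -
    have "1 * k \<le> real N * k" using N_pos k_pos by (intro mult_right_mono) auto
    then show ?thesis using energy_nonneg by simp
  qed
  also have "(\<Sum>n\<in>{1..<N}. k * energy (Suc n)) = (\<Sum>n\<in>{Suc 1..<Suc N}. k * energy n)"
    by (rule sum.shift_bounds_Suc_ivl[symmetric])
  also have "\<dots> \<le> (\<Sum>n\<in>{1..N}. k * energy n)"
    using k_pos energy_nonneg by (intro sum_mono2) auto
  also have "?C * ?T * (\<Sum>n\<in>{1..<N}. k * energy n) \<le> ?C * ?T * (\<Sum>n\<in>{1..N}. k * energy n)"
    using k_pos energy_nonneg C by (intro mult_left_mono sum_mono2) auto
  finally show ?thesis by (simp add: algebra_simps)
qed

text \<open>
  With exact exponentials, the decay in space beats the growth in time by \<open>\<rho> (\<gamma> - 1)\<close> to first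
  order. Half of this gain survives the second-order errors on a fine mesh.
\<close>

lemma sideways_coefficient:
  assumes \<rho>: "0 < \<rho>" "\<rho> * k \<le> 1" and \<gamma>: "1 < \<gamma>" and small: "\<rho> * (\<gamma>\<^sup>2 * h + k) \<le> (\<gamma> - 1) / 2"
  shows "k * h * (\<rho> * (\<gamma> - 1) / 4) \<le> ((1 - exp (- \<rho> * \<gamma> * h)) * k - (exp (\<rho> * k) - 1) * h) / 2"
    and "1 - exp (- \<rho> * \<gamma> * h) \<le> \<rho> * \<gamma> * h"
proof -
  let ?u = "\<rho> * \<gamma> * h" and ?v = "\<rho> * k"
  have u: "0 < ?u" using \<rho> \<gamma> h_pos by simp
  have "?u - ?u\<^sup>2 \<le> 1 - exp (- ?u)"
  proof -
    have "exp (- ?u) = 1 / exp ?u" by (simp add: exp_minus inverse_eq_divide)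
    also have "\<dots> \<le> 1 / (1 + ?u)" using u by (intro divide_left_mono) auto
    also have "\<dots> \<le> 1 - ?u + ?u\<^sup>2"
    proof -
      have "(1 - w + w\<^sup>2) * (1 + w) = 1 + w ^ 3" for w :: real
        by (simp add: power2_eq_square power3_eq_cube algebra_simps)
      then have "1 \<le> (1 - ?u + ?u\<^sup>2) * (1 + ?u)" using u by simp
      then show ?thesis using u by (simp add: divide_le_eq)
    qed
    finally show ?thesis by simp
  qed
  then have A: "(?u - ?u\<^sup>2) * k \<le> (1 - exp (- \<rho> * \<gamma> * h)) * k" using k_pos by (intro mult_right_mono) auto
  have "exp ?v - 1 \<le> ?v + ?v\<^sup>2" using exp_bound[of ?v] \<rho> k_pos by simp
  then have B: "(exp ?v - 1) * h \<le> (?v + ?v\<^sup>2) * h" using h_pos by (intro mult_right_mono) auto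
  have "k * h * \<rho> * (\<rho> * (\<gamma>\<^sup>2 * h + k)) \<le> k * h * \<rho> * ((\<gamma> - 1) / 2)"
    using small k_pos h_pos \<rho> by (intro mult_left_mono) auto
  moreover have "(?u - ?u\<^sup>2) * k - (?v + ?v\<^sup>2) * h = k * h * \<rho> * (\<gamma> - 1) - k * h * \<rho> * (\<rho> * (\<gamma>\<^sup>2 * h + k))"
    by (simp add: power2_eq_square algebra_simps)
  moreover have "2 * (k * h * (\<rho> * (\<gamma> - 1) / 4)) = k * h * \<rho> * (\<gamma> - 1) - k * h * \<rho> * ((\<gamma> - 1) / 2)"
    by (simp add: field_simps)
  ultimately have "2 * (k * h * (\<rho> * (\<gamma> - 1) / 4)) \<le> (1 - exp (- \<rho> * \<gamma> * h)) * k - (exp (\<rho> * k) - 1) * h"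
    using A B by linarith
  then show "k * h * (\<rho> * (\<gamma> - 1) / 4) \<le> ((1 - exp (- \<rho> * \<gamma> * h)) * k - (exp (\<rho> * k) - 1) * h) / 2"
    by (simp only: le_divide_eq_numeral1 mult.commute)
  show "1 - exp (- \<rho> * \<gamma> * h) \<le> \<rho> * \<gamma> * h" using exp_ge_add_one_self[of "- ?u"] by simp
qed

text \<open>
  The right-hand side of the linear estimate: the trace at \<open>x = 0\<close>, the jumps of the velocity, and
  the momentum and the slope at the final time. The last two are bounded by the norm of \<open>y (T)\<close> only
  together with the a priori bound.
\<close>

definition data_energy :: real where
  "data_energy = (\<Sum>n\<in>{1..N}. k * trace_energy n) + k * h * (\<Sum>n\<in>{1..N}. jump_energy n)
     + h * abs_momentum N + h * potential_energy N"

definition weighted_energy :: "real \<Rightarrow> real \<Rightarrow> real" where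
  "weighted_energy \<rho> \<gamma> = (\<Sum>n\<in>{1..<N}. weighted_stiffness \<rho> \<gamma> n + weighted_mass \<rho> \<gamma> (Suc n))"

lemma data_energy_nonneg: "0 \<le> data_energy"
  unfolding data_energy_def using k_pos h_pos nonneg
  by (intro add_nonneg_nonneg mult_nonneg_nonneg sum_nonneg) auto

lemma weighted_energy_nonneg: "0 \<le> weighted_energy \<rho> \<gamma>"
  unfolding weighted_energy_def by (intro sum_nonneg add_nonneg_nonneg weighted_nonneg)

text \<open>
  Summation of \<open>sideways_bound\<close> over time. The momentum telescopes; at the bottom level the weight is
  at most \<open>exp (\<rho> k) \<le> 3\<close>, so that the factor of the initial energy does not depend on \<open>\<rho>\<close>.
\<close>

lemma sideways_estimate:
  assumes \<rho>: "0 < \<rho>" "\<rho> * k \<le> 1" and \<gamma>: "1 < \<gamma>" and small: "\<rho> * (\<gamma>\<^sup>2 * h + k) \<le> (\<gamma> - 1) / 2"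
  shows "(\<rho> * (\<gamma> - 1) / 4 - 5 / 2 * K) * (k * h * weighted_energy \<rho> \<gamma>)
      \<le> exp (\<rho> * (real N * k)) * (1 + \<rho> * \<gamma>) * data_energy + 2 * (1 + K) * (h * energy 1)"
proof -
  let ?V = "weighted_stiffness \<rho> \<gamma>" and ?Z = "weighted_mass \<rho> \<gamma>" and ?p = "weighted_momentum \<rho> \<gamma>"
  let ?e = "exp (\<rho> * (real N * k))"
  let ?S = "weighted_energy \<rho> \<gamma>"
  note coeff = sideways_coefficient[OF \<rho> \<gamma> small]
  have \<rho>0: "0 \<le> \<rho>" "0 \<le> \<gamma>" using \<rho> \<gamma> by auto
  have e_mono: "exp (\<rho> * (real n * k)) \<le> ?e" if "n \<le> N" for n
    using that \<rho> k_pos by (simp add: mult_left_mono mult_right_mono)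
  have e1: "exp (\<rho> * (real 1 * k)) \<le> 3"
    using \<rho> exp_le by (simp add: order_trans[OF exp_le_cancel_iff[THEN iffD2]])
  have kh: "0 \<le> k * h" using k_pos h_pos by simp
  have e0: "0 \<le> ?e" by simp
  have step: "k * h * (\<rho> * (\<gamma> - 1) / 4) * (?V n + ?Z (Suc n))
      \<le> (h * ?p (Suc n) - h * ?p n) + ?e * (k * trace_energy n)
        + ?e * (\<rho> * \<gamma>) * (k * h * jump_energy (Suc n))
        + k * h * K * (5 / 2) * ?V n + k * h * K / 2 * ?Z n"
    if "n \<in> {1..<N}" for n
  proof -
    have n: "n < N" "0 < n" using that by auto
    have "k * h * (\<rho> * (\<gamma> - 1) / 4) * (?V n + ?Z (Suc n))
        \<le> ((1 - exp (- \<rho> * \<gamma> * h)) * k - (exp (\<rho> * k) - 1) * h) / 2 * (?V n + ?Z (Suc n))"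
      by (intro mult_right_mono coeff add_nonneg_nonneg weighted_nonneg)
    moreover note sideways_bound[OF n \<rho>0]
    moreover have "k / 2 * (exp (\<rho> * (real n * k)) * trace_energy n) \<le> ?e * (k * trace_energy n)"
    proof -
      have "exp (\<rho> * (real n * k)) * (k * trace_energy n) \<le> ?e * (k * trace_energy n)"
        using e_mono[of n] n nonneg(6) k_pos by (intro mult_right_mono) auto
      moreover have "k / 2 * (exp (\<rho> * (real n * k)) * trace_energy n) \<le> k * (exp (\<rho> * (real n * k)) * trace_energy n)"
        using nonneg(6) k_pos by (intro mult_right_mono) auto
      ultimately show ?thesis by (simp only: mult_ac)
    qed
    moreover have "k / 4 * (1 - exp (- \<rho> * \<gamma> * h)) * weighted_jumps \<rho> \<gamma> (Suc n)
        \<le> ?e * (\<rho> * \<gamma>) * (k * h * jump_energy (Suc n))"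
    proof -
      have J: "weighted_jumps \<rho> \<gamma> (Suc n) \<le> ?e * jump_energy (Suc n)"
        using weighted_jumps_upper[OF \<rho>0, of "Suc n"] n
          mult_right_mono[OF e_mono[of "Suc n"] nonneg(3)[of "Suc n"]] by simp
      have "0 \<le> 1 - exp (- \<rho> * \<gamma> * h)" using \<rho> \<gamma> h_pos by simp
      then have "k / 4 * (1 - exp (- \<rho> * \<gamma> * h)) * weighted_jumps \<rho> \<gamma> (Suc n)
          \<le> k / 4 * (1 - exp (- \<rho> * \<gamma> * h)) * (?e * jump_energy (Suc n))"
        using J k_pos by (intro mult_left_mono) auto
      also have "\<dots> \<le> k * (\<rho> * \<gamma> * h) * (?e * jump_energy (Suc n))"
        using coeff(2) k_pos nonneg(3) \<open>0 \<le> 1 - exp (- \<rho> * \<gamma> * h)\<close>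
        by (intro mult_right_mono mult_mono mult_nonneg_nonneg) auto
      finally show ?thesis by (simp only: mult_ac)
    qed
    moreover have "k * h * K * (5 / 2 * ?V n + ?Z n / 2) = k * h * K * (5 / 2) * ?V n + k * h * K / 2 * ?Z n"
      by (simp add: algebra_simps)
    ultimately show ?thesis by linarith
  qed
  have "k * h * (\<rho> * (\<gamma> - 1) / 4) * ?S
      = (\<Sum>n\<in>{1..<N}. k * h * (\<rho> * (\<gamma> - 1) / 4) * (?V n + ?Z (Suc n)))"
    unfolding weighted_energy_def by (rule sum_distrib_left)
  also have "\<dots> \<le> (\<Sum>n\<in>{1..<N}. (h * ?p (Suc n) - h * ?p n) + ?e * (k * trace_energy n)
        + ?e * (\<rho> * \<gamma>) * (k * h * jump_energy (Suc n))
        + k * h * K * (5 / 2) * ?V n + k * h * K / 2 * ?Z n)"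
    by (rule sum_mono[OF step])
  also have "\<dots> = (\<Sum>n\<in>{1..<N}. h * ?p (Suc n) - h * ?p n) + ?e * (\<Sum>n\<in>{1..<N}. k * trace_energy n)
        + ?e * (\<rho> * \<gamma>) * (k * h * (\<Sum>n\<in>{1..<N}. jump_energy (Suc n)))
        + k * h * K * (5 / 2) * (\<Sum>n\<in>{1..<N}. ?V n) + k * h * K / 2 * (\<Sum>n\<in>{1..<N}. ?Z n)"
    by (simp only: sum.distrib sum_distrib_left)
  finally have main: "k * h * (\<rho> * (\<gamma> - 1) / 4) * ?S \<le> \<dots>" .
  have tele: "(\<Sum>n\<in>{1..<N}. h * ?p (Suc n) - h * ?p n) = h * ?p N - h * ?p 1"
    using N_pos by (intro sum_Suc_diff') auto
  have pN: "h * ?p N \<le> ?e * (h * abs_momentum N)"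
  proof -
    have "?p N \<le> ?e * abs_momentum N"
      using weighted_momentum_upper[OF \<rho>0, of N] N_pos by simp
    then have "h * ?p N \<le> h * (?e * abs_momentum N)" using h_pos by (intro mult_left_mono) auto
    then show ?thesis by (simp only: mult_ac)
  qed
  have p1: "- (h * ?p 1) \<le> 3 / 2 * (h * energy 1)"
  proof -
    have "- ?p 1 \<le> \<bar>?p 1\<bar>" by simp
    also have "\<dots> \<le> exp (\<rho> * (real 1 * k)) * abs_momentum 1"
      using weighted_momentum_upper[OF \<rho>0, of 1] N_pos by simp
    also have "\<dots> \<le> 3 * (energy 1 / 2)"
      using e1 abs_momentum_le[of 1 1] N_pos nonneg(4)[of 1] by (intro mult_mono) (auto simp: energy_split)
    finally have "h * - ?p 1 \<le> h * (3 * (energy 1 / 2))" using h_pos by (intro mult_left_mono) auto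
    then show ?thesis by simp
  qed
  have tr: "?e * (\<Sum>n\<in>{1..<N}. k * trace_energy n) \<le> ?e * (\<Sum>n\<in>{1..N}. k * trace_energy n)"
    using k_pos nonneg(6) by (intro mult_left_mono sum_mono2) auto
  have ju: "?e * (\<rho> * \<gamma>) * (k * h * (\<Sum>n\<in>{1..<N}. jump_energy (Suc n)))
      \<le> ?e * (\<rho> * \<gamma>) * (k * h * (\<Sum>n\<in>{1..N}. jump_energy n))"
  proof -
    have "(\<Sum>n\<in>{1..<N}. jump_energy (Suc n)) = (\<Sum>n\<in>{Suc 1..<Suc N}. jump_energy n)"
      by (rule sum.shift_bounds_Suc_ivl[symmetric])
    also have "\<dots> \<le> (\<Sum>n\<in>{1..N}. jump_energy n)" using nonneg(3) by (intro sum_mono2) auto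
    finally show ?thesis using kh \<rho>0 by (intro mult_left_mono) auto
  qed
  have Vsum: "k * h * K * (5 / 2) * (\<Sum>n\<in>{1..<N}. ?V n) + k * h * K / 2 * (\<Sum>n\<in>{1..<N}. ?Z n)
      \<le> 5 / 2 * K * (k * h * ?S) + 3 / 2 * K * (h * energy 1)"
  proof -
    have "?Z n \<le> 3 * energy 1" if "n = 1" for n
    proof -
      have "?Z 1 \<le> exp (\<rho> * (real 1 * k)) * kinetic_energy 1"
        using weighted_mass_upper[OF \<rho>0, of 1] N_pos by simp
      also have "\<dots> \<le> 3 * energy 1"
        using e1 nonneg(1,2)[of 1] by (intro mult_mono) (auto simp: energy_split)
      finally show ?thesis using that by simp
    qed
    then have Z1: "?Z 1 \<le> 3 * energy 1" by simp
    have "(\<Sum>n\<in>{1..<N}. ?Z n) \<le> (\<Sum>n\<in>{1..<Suc N}. ?Z n)"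
      using weighted_nonneg by (intro sum_mono2) auto
    also have "\<dots> = ?Z 1 + (\<Sum>n\<in>{Suc 1..<Suc N}. ?Z n)"
      using N_pos by (intro sum.atLeast_Suc_lessThan) auto
    also have "(\<Sum>n\<in>{Suc 1..<Suc N}. ?Z n) = (\<Sum>n\<in>{1..<N}. ?Z (Suc n))"
      by (rule sum.shift_bounds_Suc_ivl)
    finally have "(\<Sum>n\<in>{1..<N}. ?Z n) \<le> 3 * energy 1 + (\<Sum>n\<in>{1..<N}. ?Z (Suc n))" using Z1 by simp
    then have "k * h * K / 2 * (\<Sum>n\<in>{1..<N}. ?Z n) \<le> k * h * K / 2 * (3 * energy 1 + (\<Sum>n\<in>{1..<N}. ?Z (Suc n)))"
      using kh K_nonneg by (intro mult_left_mono) auto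
    also have "\<dots> = k * (3 / 2 * K * (h * energy 1)) + k * h * K / 2 * (\<Sum>n\<in>{1..<N}. ?Z (Suc n))"
      by (simp add: algebra_simps)
    also have "\<dots> \<le> 1 * (3 / 2 * K * (h * energy 1)) + k * h * K * (5 / 2) * (\<Sum>n\<in>{1..<N}. ?Z (Suc n))"
    proof (intro add_mono mult_right_mono)
      have "0 \<le> k * h * K" using kh K_nonneg by simp
      then show "k * h * K / 2 \<le> k * h * K * (5 / 2)" by linarith
    qed (use K_nonneg h_pos energy_nonneg k_le_quarter weighted_nonneg in \<open>auto intro: sum_nonneg\<close>)
    moreover have "5 / 2 * K * (k * h * ?S) = k * h * K * (5 / 2) * (\<Sum>n\<in>{1..<N}. ?V n) + k * h * K * (5 / 2) * (\<Sum>n\<in>{1..<N}. ?Z (Suc n))"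
      unfolding weighted_energy_def sum.distrib by (simp add: algebra_simps)
    ultimately show ?thesis by linarith
  qed
  have D: "?e * (\<Sum>n\<in>{1..N}. k * trace_energy n) + ?e * (\<rho> * \<gamma>) * (k * h * (\<Sum>n\<in>{1..N}. jump_energy n))
      + ?e * (h * abs_momentum N) \<le> ?e * (1 + \<rho> * \<gamma>) * data_energy"
  proof -
    let ?a = "\<Sum>n\<in>{1..N}. k * trace_energy n" and ?b = "k * h * (\<Sum>n\<in>{1..N}. jump_energy n)"
      and ?c = "h * abs_momentum N" and ?d = "h * potential_energy N"
    have pos: "0 \<le> ?a" "0 \<le> ?b" "0 \<le> ?c" "0 \<le> ?d"
      using k_pos h_pos nonneg by (auto intro!: sum_nonneg mult_nonneg_nonneg)
    have "0 \<le> \<rho> * \<gamma>" using \<rho>0 by simp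
    then have "0 \<le> \<rho> * \<gamma> * (?a + ?c + ?d)" using pos by simp
    then have "?a + \<rho> * \<gamma> * ?b + ?c \<le> (1 + \<rho> * \<gamma>) * (?a + ?b + ?c + ?d)"
      using pos by (simp add: distrib_left distrib_right)
    then have "?e * (?a + \<rho> * \<gamma> * ?b + ?c) \<le> ?e * ((1 + \<rho> * \<gamma>) * (?a + ?b + ?c + ?d))"
      by (intro mult_left_mono) auto
    moreover have "e * x + e * r * y + e * w = e * (x + r * y + w)" for e r x y w :: real
      by (simp add: algebra_simps)
    ultimately show ?thesis unfolding data_energy_def by (simp only: mult.assoc)
  qed
  have "h * energy 1 * (3 / 2) + K * (h * energy 1) * (3 / 2) \<le> 2 * (1 + K) * (h * energy 1)"
  proof -
    have "0 \<le> h * energy 1" "0 \<le> K * (h * energy 1)" using h_pos energy_nonneg K_nonneg by auto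
    then show ?thesis by (simp add: algebra_simps)
  qed
  moreover have "(\<rho> * (\<gamma> - 1) / 4 - 5 / 2 * K) * (k * h * ?S)
      = k * h * (\<rho> * (\<gamma> - 1) / 4) * ?S - 5 / 2 * K * (k * h * ?S)"
    by (simp add: algebra_simps)
  ultimately show ?thesis using main tele pN p1 tr ju Vsum D by linarith
qed

text \<open>
  Average \<open>energy_backward\<close> over the times in \<open>[\<gamma>, T)\<close>, where the weight is at least \<open>1\<close>.
\<close>

lemma initial_energy_from_weighted_energy:
  assumes C: "(4 * K + 1) * k \<le> 1 / 2" and \<rho>: "0 \<le> \<rho>" and \<gamma>: "1 < \<gamma>" "\<gamma> < real N * k"
    and k: "k \<le> (real N * k - \<gamma>) / 2"
  shows "(real N * k - \<gamma>) / 2 * energy 1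
      \<le> exp (2 * (4 * K + 1) * (real N * k)) * (k * weighted_energy \<rho> \<gamma>)"
proof -
  let ?V = "weighted_stiffness \<rho> \<gamma>" and ?Z = "weighted_mass \<rho> \<gamma>"
  let ?X = "exp (2 * (4 * K + 1) * (real N * k))"
  \<comment> \<open>The first level at which the weight is at least \<open>1\<close> at every node.\<close>
  define n0 where "n0 = nat \<lceil>\<gamma> / k\<rceil>"
  have n0: "\<gamma> / k \<le> real n0" "real n0 < \<gamma> / k + 1"
    using \<gamma> k_pos unfolding n0_def by (auto simp: less_eq_real_def intro: le_of_int_ceiling) linarith+
  have "2 \<le> \<gamma> / k" using k_le_quarter \<gamma> k_pos by (simp add: le_divide_eq)
  then have n0_2: "2 \<le> n0" using n0 by linarith
  have n0k: "\<gamma> \<le> real n0 * k" "real n0 * k < \<gamma> + k"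
    using n0 k_pos by (auto simp: field_simps)
  have "2 * k \<le> real N * k - \<gamma>" using k by simp
  then have "real n0 * k < real N * k" using n0k \<gamma> k_pos by linarith
  then have n0N: "n0 < N" using k_pos by simp
  have lower: "energy n \<le> ?V n + ?Z n" if "n \<in> {n0..<N}" for n
  proof -
    have "real n0 * k \<le> real n * k" using that k_pos by (intro mult_right_mono) auto
    then have "\<gamma> \<le> real n * k" using n0k by linarith
    then have "0 \<le> \<rho> * (real n * k - \<gamma>)" using \<rho> by simp
    then have e: "1 \<le> exp (\<rho> * (real n * k - \<gamma>))" by simp
    have "1 * potential_energy n \<le> ?V n"
      using \<rho> \<gamma> that
      by (intro order_trans[OF mult_right_mono[OF e nonneg(1)[of n]] weighted_stiffness_lower]) auto
    moreover have "1 * kinetic_energy n \<le> ?Z n"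
      using \<rho> \<gamma> that n0_2
      by (intro order_trans[OF mult_right_mono[OF e nonneg(2)[of n]] weighted_mass_lower]) auto
    ultimately show ?thesis by (simp add: energy_split)
  qed
  have "(\<Sum>n\<in>{n0..<N}. energy n) \<le> (\<Sum>n\<in>{n0..<N}. ?V n) + (\<Sum>n\<in>{n0..<N}. ?Z n)"
    unfolding sum.distrib[symmetric] by (rule sum_mono[OF lower])
  also have "(\<Sum>n\<in>{n0..<N}. ?V n) \<le> (\<Sum>n\<in>{1..<N}. ?V n)"
    using n0_2 weighted_nonneg by (intro sum_mono2) auto
  also have "(\<Sum>n\<in>{n0..<N}. ?Z n) \<le> (\<Sum>n\<in>{Suc 1..<Suc N}. ?Z n)"
    using n0_2 weighted_nonneg by (intro sum_mono2) auto
  also have "\<dots> = (\<Sum>n\<in>{1..<N}. ?Z (Suc n))" by (rule sum.shift_bounds_Suc_ivl)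
  finally have slab: "(\<Sum>n\<in>{n0..<N}. energy n) \<le> weighted_energy \<rho> \<gamma>"
    by (simp add: weighted_energy_def sum.distrib)
  have "(\<Sum>n\<in>{n0..<N}. energy 1) \<le> (\<Sum>n\<in>{n0..<N}. ?X * energy n)"
    using n0_2 by (intro sum_mono energy_backward[OF C]) auto
  then have "real (N - n0) * energy 1 \<le> ?X * (\<Sum>n\<in>{n0..<N}. energy n)"
    by (simp add: sum_distrib_left)
  also have "\<dots> \<le> ?X * weighted_energy \<rho> \<gamma>" using slab by (intro mult_left_mono) auto
  finally have "k * (real (N - n0) * energy 1) \<le> k * (?X * weighted_energy \<rho> \<gamma>)"
    using k_pos by (intro mult_left_mono) auto
  moreover have "(real N * k - \<gamma>) / 2 * energy 1 \<le> k * (real (N - n0) * energy 1)"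
  proof -
    have "k * real (N - n0) = real N * k - real n0 * k"
      using n0N by (simp add: of_nat_diff algebra_simps)
    then have "real N * k - \<gamma> \<le> 2 * (k * real (N - n0))"
      using n0k \<open>2 * k \<le> real N * k - \<gamma>\<close> by linarith
    then have "(real N * k - \<gamma>) / 2 \<le> k * real (N - n0)" by simp
    then have "(real N * k - \<gamma>) / 2 * energy 1 \<le> k * real (N - n0) * energy 1"
      using energy_nonneg by (rule mult_right_mono)
    then show ?thesis by (simp only: mult.assoc)
  qed
  ultimately show ?thesis by (simp add: mult_ac)
qed

text \<open>
  The two end terms are present because the weighted energy omits the displacement at the final
  level and the velocity at the first one.
\<close>

lemma total_energy_from_weighted_energy:
  assumes \<rho>: "0 \<le> \<rho>" and \<gamma>: "0 \<le> \<gamma>"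
  shows "(\<Sum>n\<in>{1..N}. k * energy n) \<le> exp (\<rho> * \<gamma>) * (k * weighted_energy \<rho> \<gamma>) + potential_energy N + energy 1"
proof -
  let ?V = "weighted_stiffness \<rho> \<gamma>" and ?Z = "weighted_mass \<rho> \<gamma>"
  have e: "1 \<le> exp (\<rho> * \<gamma>) * exp (\<rho> * (real n * k - \<gamma>))" for n
    unfolding exp_add[symmetric] using \<rho> k_pos by (simp add: algebra_simps)
  have V: "potential_energy n \<le> exp (\<rho> * \<gamma>) * ?V n" if "n \<le> N" for n
  proof -
    have "1 * potential_energy n \<le> (exp (\<rho> * \<gamma>) * exp (\<rho> * (real n * k - \<gamma>))) * potential_energy n"
      by (intro mult_right_mono e nonneg)
    also have "\<dots> \<le> exp (\<rho> * \<gamma>) * ?V n"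
      unfolding mult.assoc using weighted_stiffness_lower[OF \<rho> \<gamma> that] by (intro mult_left_mono) auto
    finally show ?thesis by simp
  qed
  have Z: "kinetic_energy n \<le> exp (\<rho> * \<gamma>) * ?Z n" if "n \<le> N" "0 < n" for n
  proof -
    have "1 * kinetic_energy n \<le> (exp (\<rho> * \<gamma>) * exp (\<rho> * (real n * k - \<gamma>))) * kinetic_energy n"
      by (intro mult_right_mono e nonneg)
    also have "\<dots> \<le> exp (\<rho> * \<gamma>) * ?Z n"
      unfolding mult.assoc using weighted_mass_lower[OF \<rho> \<gamma> that] by (intro mult_left_mono) auto
    finally show ?thesis by simp
  qed
  have "(\<Sum>n\<in>{1..N}. energy n) = (\<Sum>n\<in>{1..<Suc N}. potential_energy n) + (\<Sum>n\<in>{1..<Suc N}. kinetic_energy n)"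
    by (simp add: energy_split sum.distrib atLeastLessThanSuc_atLeastAtMost)
  also have "(\<Sum>n\<in>{1..<Suc N}. potential_energy n) = (\<Sum>n\<in>{1..<N}. potential_energy n) + potential_energy N"
    using N_pos by (simp add: sum.atLeastLessThan_Suc)
  also have "(\<Sum>n\<in>{1..<Suc N}. kinetic_energy n) = kinetic_energy 1 + (\<Sum>n\<in>{Suc 1..<Suc N}. kinetic_energy n)"
    using N_pos by (intro sum.atLeast_Suc_lessThan) auto
  also have "(\<Sum>n\<in>{Suc 1..<Suc N}. kinetic_energy n) = (\<Sum>n\<in>{1..<N}. kinetic_energy (Suc n))"
    by (rule sum.shift_bounds_Suc_ivl)
  finally have "(\<Sum>n\<in>{1..N}. energy n)
      = (\<Sum>n\<in>{1..<N}. potential_energy n + kinetic_energy (Suc n)) + potential_energy N + kinetic_energy 1"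
    by (simp add: sum.distrib)
  also have "(\<Sum>n\<in>{1..<N}. potential_energy n + kinetic_energy (Suc n))
      \<le> (\<Sum>n\<in>{1..<N}. exp (\<rho> * \<gamma>) * ?V n + exp (\<rho> * \<gamma>) * ?Z (Suc n))"
    by (intro sum_mono add_mono V Z) auto
  also have "\<dots> = exp (\<rho> * \<gamma>) * weighted_energy \<rho> \<gamma>"
    by (simp add: weighted_energy_def sum_distrib_left distrib_left)
  also have "kinetic_energy 1 \<le> energy 1" using nonneg by (simp add: energy_split)
  finally have "k * (\<Sum>n\<in>{1..N}. energy n)
      \<le> k * (exp (\<rho> * \<gamma>) * weighted_energy \<rho> \<gamma> + potential_energy N + energy 1)"
    using k_pos by (intro mult_left_mono) auto
  also have "\<dots> = exp (\<rho> * \<gamma>) * (k * weighted_energy \<rho> \<gamma>) + k * (potential_energy N + energy 1)"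
    by (simp add: algebra_simps)
  also have "k * (potential_energy N + energy 1) \<le> 1 * (potential_energy N + energy 1)"
    using k_le_quarter nonneg energy_nonneg by (intro mult_right_mono add_nonneg_nonneg) auto
  finally show ?thesis by (simp add: sum_distrib_left)
qed

text \<open>
  The initial energy is bounded by the weighted energy with a constant that depends only on \<open>K\<close>, \<open>\<gamma>\<close>
  and the final time, so that a large \<open>\<rho>\<close> absorbs the bottom term of \<open>sideways_estimate\<close>.
\<close>

lemma observability:
  assumes C: "(4 * K + 1) * k \<le> 1 / 2"
    and \<rho>: "0 < \<rho>" "\<rho> * k \<le> 1" and small: "\<rho> * (\<gamma>\<^sup>2 * h + k) \<le> (\<gamma> - 1) / 2"
    and \<gamma>: "1 < \<gamma>" "\<gamma> < real N * k" and k: "k \<le> (real N * k - \<gamma>) / 2"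
    and large: "5 / 2 * K + 1 + 4 * (1 + K) * exp (2 * (4 * K + 1) * (real N * k)) / (real N * k - \<gamma>)
        \<le> \<rho> * (\<gamma> - 1) / 4"
  shows "k * h * weighted_energy \<rho> \<gamma> \<le> exp (\<rho> * (real N * k)) * (1 + \<rho> * \<gamma>) * data_energy"
proof -
  let ?S = "k * h * weighted_energy \<rho> \<gamma>" and ?X = "exp (2 * (4 * K + 1) * (real N * k))"
  let ?d = "real N * k - \<gamma>"
  have d: "0 < ?d" using \<gamma> by simp
  have S: "0 \<le> ?S" using k_pos h_pos weighted_energy_nonneg by simp
  have "h * (?d / 2 * energy 1) \<le> h * (?X * (k * weighted_energy \<rho> \<gamma>))"
    using initial_energy_from_weighted_energy[OF C _ \<gamma> k, of \<rho>] \<rho> h_pos by (intro mult_left_mono) auto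
  then have "h * energy 1 \<le> 2 * ?X / ?d * ?S" using d by (simp add: field_simps)
  then have "2 * (1 + K) * (h * energy 1) \<le> 2 * (1 + K) * (2 * ?X / ?d * ?S)"
    using K_nonneg by (intro mult_left_mono) auto
  also have "\<dots> = 4 * (1 + K) * ?X / ?d * ?S" by (simp add: field_simps)
  finally have "(\<rho> * (\<gamma> - 1) / 4 - 5 / 2 * K) * ?S
      \<le> exp (\<rho> * (real N * k)) * (1 + \<rho> * \<gamma>) * data_energy + 4 * (1 + K) * ?X / ?d * ?S"
    using sideways_estimate[OF \<rho> \<gamma>(1) small] by linarith
  moreover have "(5 / 2 * K + 1 + 4 * (1 + K) * ?X / ?d) * ?S \<le> (\<rho> * (\<gamma> - 1) / 4) * ?S"
    by (intro mult_right_mono large S)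
  moreover have "s \<le> D" if "(a - b) * s \<le> D + c * s" "(b + 1 + c) * s \<le> a * s" for a b c s D :: real
    using that by (simp add: algebra_simps)
  ultimately show ?thesis by blast
qed

text \<open>
  Both unknowns are recovered from the weighted energy: the initial data by \<open>energy_backward\<close>, the
  source by \<open>weighted_noise_energy\<close> up to \<open>d y\<close>.
\<close>

lemma stability:
  fixes \<rho> \<gamma> :: real
  assumes C: "(4 * K + 1) * k \<le> 1 / 2"
    and \<rho>: "0 < \<rho>" "\<rho> * k \<le> 1" and small: "\<rho> * (\<gamma>\<^sup>2 * h + k) \<le> (\<gamma> - 1) / 2"
    and \<gamma>: "1 < \<gamma>" "\<gamma> < real N * k" and k: "k \<le> (real N * k - \<gamma>) / 2"
    and large: "5 / 2 * K + 1 + 4 * (1 + K) * exp (2 * (4 * K + 1) * (real N * k)) / (real N * k - \<gamma>)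
        \<le> \<rho> * (\<gamma> - 1) / 4"
  defines "c \<equiv> (exp (\<rho> * \<gamma>) + 2 * exp (2 * (4 * K + 1) * (real N * k)) / (real N * k - \<gamma>))
      * (exp (\<rho> * (real N * k)) * (1 + \<rho> * \<gamma>)) + 1"
  shows "h * energy 1 \<le> c * data_energy"
    and "(\<Sum>n\<in>{1..<N}. (real N * k - real n * k) * (k * (h * force_energy n)))
       \<le> 2 * (1 + (4 * K + 1) * (real N * k) + K\<^sup>2 * (real N * k)) * c * data_energy"
proof -
  let ?T = "real N * k" and ?S = "k * h * weighted_energy \<rho> \<gamma>"
  let ?Y = "2 * exp (2 * (4 * K + 1) * ?T) / (?T - \<gamma>)" and ?E = "exp (\<rho> * ?T) * (1 + \<rho> * \<gamma>)"
  have S0: "0 \<le> ?S" using k_pos h_pos weighted_energy_nonneg by simp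
  have S: "?S \<le> ?E * data_energy"
    by (rule observability[OF C \<rho> small \<gamma> k large])
  have Y0: "0 \<le> ?Y" using \<gamma> by simp
  have "h * ((?T - \<gamma>) / 2 * energy 1)
      \<le> h * (exp (2 * (4 * K + 1) * ?T) * (k * weighted_energy \<rho> \<gamma>))"
    using initial_energy_from_weighted_energy[OF C _ \<gamma> k, of \<rho>] \<rho> h_pos by (intro mult_left_mono) auto
  then have e1: "h * energy 1 \<le> ?Y * ?S" using \<gamma> by (simp add: field_simps)
  also have "\<dots> \<le> ?Y * (?E * data_energy)" using S Y0 by (intro mult_left_mono)
  finally have e1': "h * energy 1 \<le> ?Y * (?E * data_energy)" .
  have c: "c * data_energy = exp (\<rho> * \<gamma>) * (?E * data_energy) + ?Y * (?E * data_energy) + data_energy"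
    unfolding c_def by (simp only: distrib_right mult.assoc mult_1_left)
  have pos: "0 \<le> exp (\<rho> * \<gamma>) * (?E * data_energy)" "0 \<le> data_energy"
    using \<rho> \<gamma> data_energy_nonneg by auto
  show "h * energy 1 \<le> c * data_energy" using e1' c pos by linarith
  have total: "h * (\<Sum>n\<in>{1..N}. k * energy n) \<le> c * data_energy"
  proof -
    have "h * (\<Sum>n\<in>{1..N}. k * energy n)
        \<le> h * (exp (\<rho> * \<gamma>) * (k * weighted_energy \<rho> \<gamma>) + potential_energy N + energy 1)"
      using total_energy_from_weighted_energy[of \<rho> \<gamma>] \<rho> \<gamma> h_pos by (intro mult_left_mono) auto
    also have "\<dots> = exp (\<rho> * \<gamma>) * ?S + h * potential_energy N + h * energy 1" by (simp add: algebra_simps)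
    also have "exp (\<rho> * \<gamma>) * ?S \<le> exp (\<rho> * \<gamma>) * (?E * data_energy)" using S by (intro mult_left_mono) auto
    also have "h * potential_energy N \<le> data_energy"
      unfolding data_energy_def using k_pos h_pos nonneg
      by (auto intro!: add_nonneg_nonneg mult_nonneg_nonneg sum_nonneg)
    finally show ?thesis using e1' c by linarith
  qed
  let ?\<tau> = "\<lambda>n. ?T - real n * k"
  have "?\<tau> n * (k * (h * force_energy n)) \<le> 2 * h * (?\<tau> n * (k * noise_energy n)) + 2 * K\<^sup>2 * ?T * h * (k * energy n)"
    if "n \<in> {1..<N}" for n
  proof -
    have \<tau>: "0 \<le> ?\<tau> n" "?\<tau> n \<le> ?T" using that k_pos by auto
    have kh: "0 \<le> k * h" using k_pos h_pos by simp
    have "force_energy n \<le> 2 * noise_energy n + 2 * K\<^sup>2 * energy n"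
      using noise_energy_bound(2)[of n] that by (simp add: force_energy_def)
    then have "?\<tau> n * (k * h * force_energy n) \<le> ?\<tau> n * (k * h * (2 * noise_energy n + 2 * K\<^sup>2 * energy n))"
      using \<tau> kh by (intro mult_left_mono) auto
    also have "\<dots> = 2 * h * (?\<tau> n * (k * noise_energy n)) + ?\<tau> n * (2 * K\<^sup>2 * (k * h * energy n))"
      by (simp add: algebra_simps)
    also have "?\<tau> n * (2 * K\<^sup>2 * (k * h * energy n)) \<le> ?T * (2 * K\<^sup>2 * (k * h * energy n))"
      using \<tau> kh energy_nonneg by (intro mult_right_mono) auto
    finally show ?thesis by (simp add: mult_ac)
  qed
  then have "(\<Sum>n\<in>{1..<N}. ?\<tau> n * (k * (h * force_energy n)))
      \<le> (\<Sum>n\<in>{1..<N}. 2 * h * (?\<tau> n * (k * noise_energy n)) + 2 * K\<^sup>2 * ?T * h * (k * energy n))"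
    by (rule sum_mono)
  also have "\<dots> = 2 * h * (\<Sum>n\<in>{1..<N}. ?\<tau> n * (k * noise_energy n))
      + 2 * K\<^sup>2 * ?T * h * (\<Sum>n\<in>{1..<N}. k * energy n)"
    by (simp only: sum.distrib sum_distrib_left)
  also have "\<dots> \<le> 2 * h * ((1 + (4 * K + 1) * ?T) * (\<Sum>n\<in>{1..N}. k * energy n))
      + 2 * K\<^sup>2 * ?T * h * (\<Sum>n\<in>{1..N}. k * energy n)"
    using weighted_noise_energy h_pos k_pos energy_nonneg
    by (intro add_mono mult_left_mono sum_mono2) auto
  also have "\<dots> = 2 * (1 + (4 * K + 1) * ?T + K\<^sup>2 * ?T) * (h * (\<Sum>n\<in>{1..N}. k * energy n))"
    by (simp add: algebra_simps)
  also have "\<dots> \<le> 2 * (1 + (4 * K + 1) * ?T + K\<^sup>2 * ?T) * (c * data_energy)"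
    using K_nonneg k_pos by (intro mult_left_mono total) auto
  finally show "(\<Sum>n\<in>{1..<N}. ?\<tau> n * (k * (h * force_energy n)))
      \<le> 2 * (1 + (4 * K + 1) * ?T + K\<^sup>2 * ?T) * c * data_energy"
    by (simp only: mult.assoc)
qed

end

section \<open>Mesh functions as indexed arrays\<close>

lemma dx_pos: "0 < dx M"
  by (simp add: dx_def)

lemma dx_mesh: "real (Suc M) * dx M = 1"
  by (simp add: dx_def add.commute)

lemma dx_neq_0: "dx M \<noteq> 0"
  using dx_pos[of M] by simp

lemma sum_xmesh: "(\<Sum>x\<in>xmesh M. F x) = (\<Sum>i<M. F (real (Suc i) * dx M))"
proof -
  have "inj_on (\<lambda>j. real j * dx M) {1..M}" by (auto simp: inj_on_def dx_neq_0)
  then have "(\<Sum>x\<in>xmesh M. F x) = (\<Sum>j\<in>{Suc 0..M}. F (real j * dx M))"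
    unfolding xmesh_def by (simp add: sum.reindex)
  also have "\<dots> = (\<Sum>i<M. F (real (Suc i) * dx M))" by (rule sum.atLeast1_atMost_eq)
  finally show ?thesis .
qed

lemma sum_xmesh_star: "(\<Sum>x\<in>xmesh_star M. F x) = (\<Sum>i<Suc M. F ((real i + 1 / 2) * dx M))"
proof -
  have "inj_on (\<lambda>j. (real j + 1 / 2) * dx M) {0..M}" by (auto simp: inj_on_def dx_neq_0)
  then show ?thesis unfolding xmesh_star_def
    by (simp add: sum.reindex atMost_atLeast0[symmetric] lessThan_Suc_atMost del: sum.lessThan_Suc)
qed

lemma sum_tmesh:
  assumes "dt T N \<noteq> 0"
  shows "(\<Sum>t\<in>tmesh T N. F t) = (\<Sum>n\<in>{1..N}. F (real n * dt T N))"
proof -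
  have "inj_on (\<lambda>n. real n * dt T N) {1..N}" using assms by (auto simp: inj_on_def)
  then show ?thesis unfolding tmesh_def by (simp add: sum.reindex)
qed

lemma sum_tmesh_star:
  assumes "dt T N \<noteq> 0"
  shows "(\<Sum>t\<in>tmesh_star T N. F t) = (\<Sum>n<N. F ((real n + 1 / 2) * dt T N))"
proof -
  have "inj_on (\<lambda>n. (real n + 1 / 2) * dt T N) {..<N}" using assms by (auto simp: inj_on_def)
  then show ?thesis unfolding tmesh_star_def by (simp add: sum.reindex)
qed

lemma diffquot_slope:
  "diffquot h v ((real i + 1 / 2) * h) = slope h (\<lambda>j. v (real j * h)) i"
proof -
  have "(real i + 1 / 2) * h + h / 2 = real (Suc i) * h" "(real i + 1 / 2) * h - h / 2 = real i * h"
    by (simp_all add: field_simps)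
  then show ?thesis by (simp only: diffquot_def shift_pos_def shift_neg_def slope_def)
qed

lemma Dx_slope: "Dx h u ((real i + 1 / 2) * h) t = slope h (\<lambda>j. u (real j * h) t) i"
  unfolding Dx_def by (rule diffquot_slope)

lemma trace0_slope: "trace0 h (Dx h u) t = slope h (\<lambda>j. u (real j * h) t) 0"
  using Dx_slope[of h u 0 t] by (simp add: trace0_def)

lemma Dx_Dx_laplace:
  assumes "h \<noteq> 0"
  shows "Dx h (Dx h u) (real (Suc i) * h) t = laplace h (\<lambda>j. u (real j * h) t) i"
proof -
  have "Dx h (Dx h u) (real (Suc i) * h) t = (Dx h u ((real (Suc i) + 1 / 2) * h) t - Dx h u ((real i + 1 / 2) * h) t) / h"
  proof -
    have "real (Suc i) * h + h / 2 = (real (Suc i) + 1 / 2) * h" "real (Suc i) * h - h / 2 = (real i + 1 / 2) * h"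
      by (simp_all add: field_simps)
    then show ?thesis by (simp only: Dx_def[of h "Dx h u"] diffquot_def shift_pos_def shift_neg_def)
  qed
  then show ?thesis unfolding Dx_slope laplace_slope[OF assms] .
qed

lemma Ax_Dx_mid_slope:
  "Ax h (Dx h u) (real (Suc i) * h) t = mid_slope h (\<lambda>j. u (real j * h) t) i"
proof -
  have "Ax h (Dx h u) (real (Suc i) * h) t = (Dx h u ((real (Suc i) + 1 / 2) * h) t + Dx h u ((real i + 1 / 2) * h) t) / 2"
  proof -
    have "real (Suc i) * h + h / 2 = (real (Suc i) + 1 / 2) * h" "real (Suc i) * h - h / 2 = (real i + 1 / 2) * h"
      by (simp_all add: field_simps)
    then show ?thesis by (simp only: Ax_def average_def shift_pos_def shift_neg_def)
  qed
  then show ?thesis unfolding Dx_slope mid_slope_slope by simp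
qed

lemma Dt_half: "Dt k u x ((real n + 1 / 2) * k) = (u x (real (Suc n) * k) - u x (real n * k)) / k"
proof -
  have "(real n + 1 / 2) * k + k / 2 = real (Suc n) * k" "(real n + 1 / 2) * k - k / 2 = real n * k"
    by (simp_all add: field_simps)
  then show ?thesis by (simp only: Dt_def diffquot_def shift_pos_def shift_neg_def)
qed

lemma t_neg_Dt: "t_neg k (Dt k u) x (real (Suc n) * k) = (u x (real (Suc n) * k) - u x (real n * k)) / k"
proof -
  have "real (Suc n) * k - k / 2 = (real n + 1 / 2) * k" by (simp add: field_simps)
  then show ?thesis by (simp only: t_neg_def shift_neg_def Dt_half)
qed

lemma t_pos_Dt: "t_pos k (Dt k u) x (real n * k) = (u x (real (Suc n) * k) - u x (real n * k)) / k"
proof -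
  have "real n * k + k / 2 = (real n + 1 / 2) * k" by (simp add: field_simps)
  then show ?thesis by (simp only: t_pos_def shift_pos_def Dt_half)
qed

lemma incr_t_Dt: "incr_t k (Dt k u) x (real (Suc n) * k)
    = (u x (real (Suc (Suc n)) * k) - u x (real (Suc n) * k)) / k
      - (u x (real (Suc n) * k) - u x (real n * k)) / k"
  unfolding incr_t_def increment_def
  using t_pos_Dt[of k u x "Suc n"] t_neg_Dt[of k u x n] by (simp only: t_pos_def t_neg_def)

lemma shift_pos_increment: "shift_pos k (increment k F) (real n * k) = F (real (Suc n) * k) - F (real n * k)"
proof -
  have "real n * k + k / 2 + k / 2 = real (Suc n) * k" "real n * k + k / 2 - k / 2 = real n * k"
    by (simp_all add: field_simps)
  then show ?thesis by (simp only: shift_pos_def increment_def shift_neg_def)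
qed

lemma L2_xnorm_square: "(L2_xnorm M v)\<^sup>2 = dx M * mass M (\<lambda>j. v (real j * dx M))"
proof -
  have "0 \<le> (\<Sum>x\<in>xmesh M. \<bar>v x\<bar>\<^sup>2 * dx M)"
    using dx_pos[of M] by (intro sum_nonneg mult_nonneg_nonneg) auto
  then show ?thesis unfolding L2_xnorm_def
    by (simp add: sum_xmesh mass_def sum_distrib_left mult.commute)
qed

lemma H1_xnorm_square:
  "(H1_xnorm M v)\<^sup>2 = dx M * stiffness M (dx M) (\<lambda>j. v (real j * dx M)) + dx M * mass M (\<lambda>j. v (real j * dx M))"
proof -
  have "0 \<le> (\<Sum>x\<in>xmesh_star M. \<bar>diffquot (dx M) v x\<bar>\<^sup>2 * dx M) + (\<Sum>x\<in>xmesh M. \<bar>v x\<bar>\<^sup>2 * dx M)"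
    using dx_pos[of M] by (intro add_nonneg_nonneg sum_nonneg mult_nonneg_nonneg) auto
  then have "(H1_xnorm M v)\<^sup>2 = (\<Sum>x\<in>xmesh_star M. \<bar>diffquot (dx M) v x\<bar>\<^sup>2 * dx M) + (\<Sum>x\<in>xmesh M. \<bar>v x\<bar>\<^sup>2 * dx M)"
    unfolding H1_xnorm_def by simp
  then show ?thesis
    unfolding sum_xmesh sum_xmesh_star diffquot_slope
    by (simp only: stiffness_def mass_def sum_distrib_left mult.commute power2_abs)
qed

lemma L2_tnorm_square:
  assumes "0 < dt T N"
  shows "(L2_tnorm T N v)\<^sup>2 = (\<Sum>n\<in>{1..N}. dt T N * (v (real n * dt T N))\<^sup>2)"
proof -
  have "0 \<le> (\<Sum>t\<in>tmesh T N. \<bar>v t\<bar>\<^sup>2 * dt T N)" using assms by (intro sum_nonneg) auto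
  then show ?thesis unfolding L2_tnorm_def using assms by (simp add: sum_tmesh mult.commute)
qed

lemma L2_norm_square:
  assumes "0 < dt T N"
  shows "(L2_norm M T N u)\<^sup>2
     = (\<Sum>n\<in>{1..N}. dt T N * (dx M * (\<Sum>i<M. (u (real (Suc i) * dx M) (real n * dt T N))\<^sup>2)))"
proof -
  have "0 \<le> (\<Sum>x\<in>xmesh M. \<Sum>t\<in>tmesh T N. \<bar>u x t\<bar>\<^sup>2 * dx M * dt T N)"
    using assms dx_pos[of M] by (intro sum_nonneg mult_nonneg_nonneg) auto
  then have "(L2_norm M T N u)\<^sup>2 = (\<Sum>x\<in>xmesh M. \<Sum>t\<in>tmesh T N. \<bar>u x t\<bar>\<^sup>2 * dx M * dt T N)"
    unfolding L2_norm_def by simp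
  also have "\<dots> = (\<Sum>t\<in>tmesh T N. \<Sum>x\<in>xmesh M. \<bar>u x t\<bar>\<^sup>2 * dx M * dt T N)" by (rule sum.swap)
  finally show ?thesis using assms
    by (simp add: sum_tmesh sum_xmesh sum_distrib_left mult_ac)
qed

lemma L2_norm_star_square:
  assumes "0 < dt T N"
  shows "(L2_norm_star M T N u)\<^sup>2
     = (\<Sum>n<N. dt T N * (dx M * (\<Sum>i<Suc M. (u ((real i + 1 / 2) * dx M) ((real n + 1 / 2) * dt T N))\<^sup>2)))"
proof -
  have "0 \<le> (\<Sum>x\<in>xmesh_star M. \<Sum>t\<in>tmesh_star T N. \<bar>u x t\<bar>\<^sup>2 * dx M * dt T N)"
    using assms dx_pos[of M] by (intro sum_nonneg mult_nonneg_nonneg) auto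
  then have "(L2_norm_star M T N u)\<^sup>2 = (\<Sum>x\<in>xmesh_star M. \<Sum>t\<in>tmesh_star T N. \<bar>u x t\<bar>\<^sup>2 * dx M * dt T N)"
    unfolding L2_norm_star_def by simp
  also have "\<dots> = (\<Sum>t\<in>tmesh_star T N. \<Sum>x\<in>xmesh_star M. \<bar>u x t\<bar>\<^sup>2 * dx M * dt T N)" by (rule sum.swap)
  finally show ?thesis using assms
    unfolding sum_xmesh_star by (simp add: sum_tmesh_star sum_distrib_left mult_ac del: sum.lessThan_Suc)
qed

lemma L2\<Omega>_norm_square: "(L2\<Omega>_norm P nrm \<zeta>)\<^sup>2 = (\<integral>\<omega>. (nrm (\<zeta> \<omega>))\<^sup>2 \<partial>P)"
  unfolding L2\<Omega>_norm_def by simp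

lemma L2\<Omega>_norm_nonneg: "0 \<le> L2\<Omega>_norm P nrm \<zeta>"
  unfolding L2\<Omega>_norm_def by simp

lemma LinfF_bound_AE:
  assumes "u \<in> LinfF P B M T N" "LinfF_norm P M T N u \<le> ereal K"
  shows "AE \<omega> in P. \<forall>x\<in>xmesh_bar M. \<forall>t\<in>tmesh_bar T N. \<bar>u \<omega> x t\<bar> \<le> K"
proof -
  let ?s = "\<lambda>\<omega>. SUP x\<in>xmesh_bar M. SUP t\<in>tmesh_bar T N. ereal \<bar>u \<omega> x t\<bar>"
  have "AE \<omega> in P. ?s \<omega> \<le> esssup P ?s" by (rule esssup_AE)
  then show ?thesis
  proof eventually_elim
    case (elim \<omega>)
    show ?case
    proof (intro ballI)
      fix x t assume "x \<in> xmesh_bar M" "t \<in> tmesh_bar T N"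
      then have "ereal \<bar>u \<omega> x t\<bar> \<le> ?s \<omega>" by (intro SUP_upper2[of x] SUP_upper2[of t]) auto
      also have "\<dots> \<le> ereal K" using elim assms(2) by (auto simp: LinfF_norm_def)
      finally show "\<bar>u \<omega> x t\<bar> \<le> K" by simp
    qed
  qed
qed

lemma xmesh_node: "i < M \<Longrightarrow> real (Suc i) * dx M \<in> xmesh M"
  unfolding xmesh_def by (rule imageI) auto

lemma xmesh_bar_node: "j \<le> Suc M \<Longrightarrow> real j * dx M \<in> xmesh_bar M"
  unfolding xmesh_bar_def by (rule imageI) auto

lemma tmesh_node: "0 < n \<Longrightarrow> n \<le> N \<Longrightarrow> real n * dt T N \<in> tmesh T N"
  unfolding tmesh_def by (rule imageI) auto

lemma tmesh_bar_node: "n \<le> N \<Longrightarrow> real n * dt T N \<in> tmesh_bar T N"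
  unfolding tmesh_bar_def by (rule imageI) auto

lemma tmesh_ext_node: "n \<le> Suc N \<Longrightarrow> real n * dt T N \<in> tmesh_ext T N"
  unfolding tmesh_ext_def by (rule imageI) auto

lemma Dx_minus: "Dx h (\<lambda>x t. u x t - v x t) = (\<lambda>x t. Dx h u x t - Dx h v x t)"
  by (simp add: Dx_def diffquot_def shift_pos_def shift_neg_def fun_eq_iff diff_divide_distrib)

lemma Dt_minus: "Dt k (\<lambda>x t. u x t - v x t) = (\<lambda>x t. Dt k u x t - Dt k v x t)"
  by (simp add: Dt_def diffquot_def shift_pos_def shift_neg_def fun_eq_iff diff_divide_distrib)

lemma Ax_minus: "Ax h (\<lambda>x t. u x t - v x t) = (\<lambda>x t. Ax h u x t - Ax h v x t)"
  by (simp add: Ax_def average_def shift_pos_def shift_neg_def fun_eq_iff diff_divide_distrib add_divide_distrib)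

lemma incr_t_minus: "incr_t k (\<lambda>x t. u x t - v x t) = (\<lambda>x t. incr_t k u x t - incr_t k v x t)"
  by (simp add: incr_t_def increment_def shift_pos_def shift_neg_def fun_eq_iff)

lemma t_shift_minus:
  "t_neg k (\<lambda>x t. u x t - v x t) = (\<lambda>x t. t_neg k u x t - t_neg k v x t)"
  "t_pos k (\<lambda>x t. u x t - v x t) = (\<lambda>x t. t_pos k u x t - t_pos k v x t)"
  by (simp_all add: t_neg_def t_pos_def shift_pos_def shift_neg_def fun_eq_iff)

lemma scheme_solution_minus:
  assumes u: "scheme_solution P B M T N a b c d g u0 u1 u"
    and v: "scheme_solution P B M T N a b c d f v0 v1 v"
  shows "scheme_solution P B M T N a b c d (\<lambda>\<omega> x t. g \<omega> x t - f \<omega> x t)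
     (\<lambda>\<omega> x. u0 \<omega> x - v0 \<omega> x) (\<lambda>\<omega> x. u1 \<omega> x - v1 \<omega> x) (\<lambda>\<omega> x t. u \<omega> x t - v \<omega> x t)"
  unfolding scheme_solution_def
proof (intro conjI)
  have "adapted P B (xmesh_bar M) (tmesh_ext T N) u" "adapted P B (xmesh_bar M) (tmesh_ext T N) v"
    using u v unfolding scheme_solution_def by auto
  then show "adapted P B (xmesh_bar M) (tmesh_ext T N) (\<lambda>\<omega> x t. u \<omega> x t - v \<omega> x t)"
    unfolding adapted_def by (intro ballI borel_measurable_diff) auto
  have "AE \<omega> in P. \<forall>t\<in>tmesh_ext T N. u \<omega> 0 t = 0 \<and> u \<omega> 1 t = 0"
    "AE \<omega> in P. \<forall>t\<in>tmesh_ext T N. v \<omega> 0 t = 0 \<and> v \<omega> 1 t = 0"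
    using u v unfolding scheme_solution_def by auto
  then show "AE \<omega> in P. \<forall>t\<in>tmesh_ext T N. u \<omega> 0 t - v \<omega> 0 t = 0 \<and> u \<omega> 1 t - v \<omega> 1 t = 0"
    by eventually_elim auto
  have "AE \<omega> in P. \<forall>x\<in>xmesh_bar M. u \<omega> x 0 = u0 \<omega> x \<and> t_pos (dt T N) (Dt (dt T N) (u \<omega>)) x 0 = u1 \<omega> x"
    "AE \<omega> in P. \<forall>x\<in>xmesh_bar M. v \<omega> x 0 = v0 \<omega> x \<and> t_pos (dt T N) (Dt (dt T N) (v \<omega>)) x 0 = v1 \<omega> x"
    using u v unfolding scheme_solution_def by auto
  then show "AE \<omega> in P. \<forall>x\<in>xmesh_bar M. u \<omega> x 0 - v \<omega> x 0 = u0 \<omega> x - v0 \<omega> x \<and>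
      t_pos (dt T N) (Dt (dt T N) (\<lambda>x t. u \<omega> x t - v \<omega> x t)) x 0 = u1 \<omega> x - v1 \<omega> x"
    by eventually_elim (auto simp: Dt_minus t_shift_minus)
  let ?h = "dx M" and ?k = "dt T N"
  let ?E = "\<lambda>g w \<omega> x t. incr_t ?k (Dt ?k w) x t - Dx ?h (Dx ?h w) x t * ?k
        = (a \<omega> x t * w x t + b \<omega> x t * Ax ?h (Dx ?h w) x t + c \<omega> x t * t_neg ?k (Dt ?k w) x t) * ?k
          + (d \<omega> x t * w x t + g) * shift_pos ?k (increment ?k (\<lambda>s. B s \<omega>)) t"
  have "AE \<omega> in P. \<forall>x\<in>xmesh M. \<forall>t\<in>tmesh T N. ?E (g \<omega> x t) (u \<omega>) \<omega> x t"
    "AE \<omega> in P. \<forall>x\<in>xmesh M. \<forall>t\<in>tmesh T N. ?E (f \<omega> x t) (v \<omega>) \<omega> x t"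
    using u v unfolding scheme_solution_def Let_def by auto
  then have "AE \<omega> in P. \<forall>x\<in>xmesh M. \<forall>t\<in>tmesh T N. ?E (g \<omega> x t - f \<omega> x t) (\<lambda>x t. u \<omega> x t - v \<omega> x t) \<omega> x t"
  proof eventually_elim
    case (elim \<omega>)
    show ?case
    proof (intro ballI)
      fix x t assume "x \<in> xmesh M" "t \<in> tmesh T N"
      with elim have 1: "?E (g \<omega> x t) (u \<omega>) \<omega> x t" and 2: "?E (f \<omega> x t) (v \<omega>) \<omega> x t" by auto
      have lin: "p - p' - (q - q') * k = (A * (y - y') + B * (m - m') + C * (z - z')) * k + (D * (y - y') + (r - r')) * W"
        if "p - q * k = (A * y + B * m + C * z) * k + (D * y + r) * W"
          "p' - q' * k = (A * y' + B * m' + C * z') * k + (D * y' + r') * W"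
        for p p' q q' k A B C D y y' m m' z z' r r' W :: real
      proof -
        have "p - p' - (q - q') * k = (p - q * k) - (p' - q' * k)" by (simp add: algebra_simps)
        then show ?thesis unfolding that by (simp add: algebra_simps)
      qed
      show "?E (g \<omega> x t - f \<omega> x t) (\<lambda>x t. u \<omega> x t - v \<omega> x t) \<omega> x t"
        unfolding Dx_minus Dt_minus Ax_minus incr_t_minus t_shift_minus by (rule lin[OF 1 2])
    qed
  qed
  then show "AE \<omega> in P. \<forall>x\<in>xmesh M. \<forall>t\<in>tmesh T N.
        let z = Dt ?k (\<lambda>x t. u \<omega> x t - v \<omega> x t) in
        incr_t ?k z x t - Dx ?h (Dx ?h (\<lambda>x t. u \<omega> x t - v \<omega> x t)) x t * ?k
        = (a \<omega> x t * (u \<omega> x t - v \<omega> x t) + b \<omega> x t * Ax ?h (Dx ?h (\<lambda>x t. u \<omega> x t - v \<omega> x t)) x t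
             + c \<omega> x t * t_neg ?k z x t) * ?k
          + (d \<omega> x t * (u \<omega> x t - v \<omega> x t) + (g \<omega> x t - f \<omega> x t))
             * shift_pos ?k (increment ?k (\<lambda>s. B s \<omega>)) t"
    unfolding Let_def .
qed

text \<open>
  Velocities start at \<open>n = 1\<close> with the prescribed initial velocity; at \<open>n = 0\<close> truncated subtraction
  gives the value zero. At interior nodes square integrability of the initial level is that of the
  data, at \<open>x = 0, 1\<close> it follows from the boundary condition.
\<close>

lemma (in brownian_space) stochastic_scheme_of_solution:
  fixes M N :: nat and T K :: real and a b c d g u :: "'a \<Rightarrow> real \<Rightarrow> real \<Rightarrow> real"
    and u0 u1 :: "'a \<Rightarrow> real \<Rightarrow> real"
  defines "h \<equiv> dx M" and "k \<equiv> dt T N"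
  defines "y \<equiv> \<lambda>n j \<omega>. u \<omega> (real j * h) (real n * k)"
  defines "z \<equiv> \<lambda>n j \<omega>. (u \<omega> (real j * h) (real n * k) - u \<omega> (real j * h) (real (n - 1) * k)) / k"
  defines "f \<equiv> \<lambda>n i \<omega>. a \<omega> (real (Suc i) * h) (real n * k) * y n (Suc i) \<omega>
      + b \<omega> (real (Suc i) * h) (real n * k) * mid_slope h (\<lambda>j. y n j \<omega>) i
      + c \<omega> (real (Suc i) * h) (real n * k) * z n (Suc i) \<omega>"
  defines "G \<equiv> \<lambda>n i \<omega>. d \<omega> (real (Suc i) * h) (real n * k) * y n (Suc i) \<omega> + g \<omega> (real (Suc i) * h) (real n * k)"
  assumes T: "0 < T" and N: "0 < N" and cfl: "4 * k \<le> h\<^sup>2" and K: "0 \<le> K"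
    and a: "a \<in> LinfF P B M T N" "LinfF_norm P M T N a \<le> ereal K"
    and b: "b \<in> LinfF P B M T N" "LinfF_norm P M T N b \<le> ereal K"
    and c: "c \<in> LinfF P B M T N" "LinfF_norm P M T N c \<le> ereal K"
    and d: "d \<in> LinfF P B M T N" "LinfF_norm P M T N d \<le> ereal K"
    and sol: "scheme_solution P B M T N a b c d g u0 u1 u"
    and g_meas: "\<And>x t. x \<in> xmesh M \<Longrightarrow> t \<in> tmesh T N \<Longrightarrow> (\<lambda>\<omega>. g \<omega> x t) \<in> borel_measurable (augfilt P B t)"
    and g_sq: "\<And>x t. x \<in> xmesh M \<Longrightarrow> t \<in> tmesh T N \<Longrightarrow> sqint P (\<lambda>\<omega>. g \<omega> x t)"
    and u0_sq: "\<And>x. x \<in> xmesh M \<Longrightarrow> sqint P (\<lambda>\<omega>. u0 \<omega> x)"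
    and u1_sq: "\<And>x. x \<in> xmesh M \<Longrightarrow> sqint P (\<lambda>\<omega>. u1 \<omega> x)"
  shows "stochastic_scheme P B M N h k K y z f G (\<lambda>n i \<omega>. g \<omega> (real (Suc i) * h) (real n * k))"
proof -
  have hp: "0 < h" "h \<noteq> 0" and mesh: "real (Suc M) * h = 1" unfolding h_def by (fact dx_pos dx_neq_0 dx_mesh)+
  have kp: "0 < k" "k \<noteq> 0" using T N by (auto simp: k_def dt_def)
  have y_ad: "y n j \<in> borel_measurable (augfilt P B (real n * k))" if "n \<le> Suc N" "j \<le> Suc M" for n j
    using sol xmesh_bar_node[of j M] tmesh_ext_node[of n N T] that
    unfolding scheme_solution_def adapted_def y_def h_def k_def by auto
  have coef: "(\<lambda>\<omega>. w \<omega> (real (Suc i) * h) (real n * k)) \<in> borel_measurable (augfilt P B (real n * k))"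
    if "w \<in> LinfF P B M T N" "i < M" "n \<le> N" for w n i
    using that xmesh_bar_node[of "Suc i" M] tmesh_bar_node[of n N T]
    unfolding LinfF_def adapted_def h_def k_def by auto
  have y_ad': "y m j \<in> borel_measurable (augfilt P B (real n * k))" if "m \<le> n" "n \<le> Suc N" "j \<le> Suc M" for m n j
    using that kp by (intro augfilt_mono[OF y_ad]) (auto intro: mult_right_mono)
  have z_y: "z n j = (\<lambda>\<omega>. (y n j \<omega> - y (n - 1) j \<omega>) / k)" for n j by (simp add: z_def y_def)
  have z_ad: "z n j \<in> borel_measurable (augfilt P B (real n * k))" if "n \<le> Suc N" "j \<le> Suc M" for n j
    unfolding z_y using y_ad'[of n n j] y_ad'[of "n - 1" n j] that by (intro borel_measurable_divide borel_measurable_diff) auto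
  have bd: "AE \<omega> in P. y n 0 \<omega> = 0 \<and> y n (Suc M) \<omega> = 0" if "n \<le> Suc N" for n
  proof -
    have "AE \<omega> in P. \<forall>t\<in>tmesh_ext T N. u \<omega> 0 t = 0 \<and> u \<omega> 1 t = 0"
      using sol by (simp add: scheme_solution_def)
    then show ?thesis
      using tmesh_ext_node[OF that, of T] unfolding y_def k_def[symmetric] mesh
      by (auto elim!: eventually_mono)
  qed
  have z_bd: "AE \<omega> in P. z n 0 \<omega> = 0 \<and> z n (Suc M) \<omega> = 0" if "n \<le> Suc N" for n
  proof -
    have "AE \<omega> in P. y (n - 1) 0 \<omega> = 0 \<and> y (n - 1) (Suc M) \<omega> = 0" using that by (intro bd) auto
    then show ?thesis using bd[OF that] by eventually_elim (auto simp: z_y)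
  qed
  have init: "AE \<omega> in P. \<forall>x\<in>xmesh_bar M. u \<omega> x 0 = u0 \<omega> x \<and> t_pos k (Dt k (u \<omega>)) x 0 = u1 \<omega> x"
    using sol by (simp add: scheme_solution_def k_def)
  have zero: "sqint P (\<lambda>\<omega>. 0)" by (simp add: sqint_def)
  have interior: "\<exists>i<M. j = Suc i" if "j \<le> Suc M" "j \<noteq> 0" "j \<noteq> Suc M" for j
    using that by (cases j) auto
  have P_meas: "X \<in> borel_measurable P" if "X \<in> borel_measurable (augfilt P B s)" for X :: "'a \<Rightarrow> real" and s
    using that by (rule augfilt_measurable_events)
  have y0: "sqint P (y 0 j)" if j: "j \<le> Suc M" for j
  proof (cases "j = 0 \<or> j = Suc M")
    case True
    then show ?thesis using bd[of 0] P_meas[OF y_ad[of 0 j]] j by (intro sqint_cong_AE[OF zero]) auto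
  next
    case False
    then obtain i where i: "i < M" "j = Suc i" using interior j by auto
    show ?thesis
    proof (rule sqint_cong_AE[OF u0_sq[OF xmesh_node[OF i(1)]]])
      show "AE \<omega> in P. y 0 j \<omega> = u0 \<omega> (real (Suc i) * dx M)"
        using init xmesh_bar_node[of "Suc i" M] i by (auto simp: y_def h_def elim!: eventually_mono)
    qed (use P_meas[OF y_ad[of 0 j]] j in auto)
  qed
  have z1: "sqint P (z 1 j)" if j: "j \<le> Suc M" for j
  proof (cases "j = 0 \<or> j = Suc M")
    case True
    then show ?thesis using z_bd[of 1] P_meas[OF z_ad[of 1 j]] j by (intro sqint_cong_AE[OF zero]) auto
  next
    case False
    then obtain i where i: "i < M" "j = Suc i" using interior j by auto
    show ?thesis
    proof (rule sqint_cong_AE[OF u1_sq[OF xmesh_node[OF i(1)]]])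
      show "AE \<omega> in P. z 1 j \<omega> = u1 \<omega> (real (Suc i) * dx M)"
        using init
      proof eventually_elim
        case (elim \<omega>)
        have "t_pos k (Dt k (u \<omega>)) (real (Suc i) * h) 0 = u1 \<omega> (real (Suc i) * h)"
          using elim xmesh_bar_node[of "Suc i" M] i by (simp add: h_def)
        then show ?case using t_pos_Dt[of k "u \<omega>" "real (Suc i) * h" 0] i by (simp add: z_def h_def)
      qed
    qed (use P_meas[OF z_ad[of 1 j]] j in auto)
  qed
  have eq: "AE \<omega> in P. \<forall>x\<in>xmesh M. \<forall>t\<in>tmesh T N.
        incr_t k (Dt k (u \<omega>)) x t - Dx h (Dx h (u \<omega>)) x t * k
        = (a \<omega> x t * u \<omega> x t + b \<omega> x t * Ax h (Dx h (u \<omega>)) x t + c \<omega> x t * t_neg k (Dt k (u \<omega>)) x t) * k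
          + (d \<omega> x t * u \<omega> x t + g \<omega> x t) * shift_pos k (increment k (\<lambda>s. B s \<omega>)) t"
    using sol by (simp add: scheme_solution_def Let_def h_def k_def)
  show ?thesis
  proof unfold_locales
    show "0 < h" "real (Suc M) * h = 1" "0 < k" "4 * k \<le> h\<^sup>2" "0 \<le> K" "0 < N"
      using hp mesh kp cfl K N by auto
  next
    fix n j assume "n \<le> N" "j \<le> Suc M"
    then show "y n j \<in> borel_measurable (augfilt P B (real n * k))" by (intro y_ad) auto
  next
    fix n j assume "n \<le> N" "0 < n" "j \<le> Suc M"
    then show "z n j \<in> borel_measurable (augfilt P B (real n * k))" by (intro z_ad) auto
  next
    fix n i assume n: "n < N" "0 < n" "i < M"
    have "(\<lambda>\<omega>. mid_slope h (\<lambda>j. y n j \<omega>) i) \<in> borel_measurable (augfilt P B (real n * k))"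
      unfolding mid_slope_def using n y_ad[of n "Suc (Suc i)"] y_ad[of n i]
      by (intro borel_measurable_divide borel_measurable_diff) auto
    then show "f n i \<in> borel_measurable (augfilt P B (real n * k))"
      unfolding f_def using n coef[OF a(1)] coef[OF b(1)] coef[OF c(1)] y_ad[of n "Suc i"] z_ad[of n "Suc i"]
      by (intro borel_measurable_add borel_measurable_times) auto
  next
    fix n i assume n: "n < N" "0 < n" "i < M"
    have "(\<lambda>\<omega>. g \<omega> (real (Suc i) * h) (real n * k)) \<in> borel_measurable (augfilt P B (real n * k))"
      unfolding h_def k_def by (rule g_meas[OF xmesh_node[OF n(3)] tmesh_node]) (use n in auto)
    then show "G n i \<in> borel_measurable (augfilt P B (real n * k))"
      unfolding G_def using n coef[OF d(1)] y_ad[of n "Suc i"]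
      by (intro borel_measurable_add borel_measurable_times) auto
  next
    fix n i assume n: "n < N" "0 < n" "i < M"
    show "sqint P (\<lambda>\<omega>. g \<omega> (real (Suc i) * h) (real n * k))"
      unfolding h_def k_def by (rule g_sq[OF xmesh_node[OF n(3)] tmesh_node]) (use n in auto)
  next
    fix n j assume "n < N" "j \<le> Suc M"
    show "AE \<omega> in P. y (Suc n) j \<omega> = y n j \<omega> + k * z (Suc n) j \<omega>"
      using kp by (simp add: z_def y_def)
  next
    fix n i assume n: "n < N" "0 < n" "i < M"
    then obtain m where m: "n = Suc m" by (cases n) auto
    show "AE \<omega> in P. z (Suc n) (Suc i) \<omega> = z n (Suc i) \<omega> + k * laplace h (\<lambda>j. y n j \<omega>) i + k * f n i \<omega>
        + G n i \<omega> * (B (real (Suc n) * k) \<omega> - B (real n * k) \<omega>)"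
      using eq
    proof eventually_elim
      case (elim \<omega>)
      let ?x = "real (Suc i) * h" and ?t = "real n * k"
      have "?x \<in> xmesh M" "?t \<in> tmesh T N"
        unfolding h_def k_def using xmesh_node[OF n(3)] tmesh_node[of n N T] n by simp_all
      then have "incr_t k (Dt k (u \<omega>)) ?x ?t - Dx h (Dx h (u \<omega>)) ?x ?t * k
        = (a \<omega> ?x ?t * u \<omega> ?x ?t + b \<omega> ?x ?t * Ax h (Dx h (u \<omega>)) ?x ?t + c \<omega> ?x ?t * t_neg k (Dt k (u \<omega>)) ?x ?t) * k
          + (d \<omega> ?x ?t * u \<omega> ?x ?t + g \<omega> ?x ?t) * shift_pos k (increment k (\<lambda>s. B s \<omega>)) ?t"
        using elim by blast
      moreover have "incr_t k (Dt k (u \<omega>)) ?x ?t = z (Suc n) (Suc i) \<omega> - z n (Suc i) \<omega>"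
        unfolding m incr_t_Dt z_def by simp
      moreover have "Dx h (Dx h (u \<omega>)) ?x ?t = laplace h (\<lambda>j. y n j \<omega>) i"
        unfolding Dx_Dx_laplace[OF hp(2)] y_def ..
      moreover have "Ax h (Dx h (u \<omega>)) ?x ?t = mid_slope h (\<lambda>j. y n j \<omega>) i"
        unfolding Ax_Dx_mid_slope y_def ..
      moreover have "t_neg k (Dt k (u \<omega>)) ?x ?t = z n (Suc i) \<omega>"
        unfolding m t_neg_Dt z_def by simp
      moreover have "u \<omega> ?x ?t = y n (Suc i) \<omega>" by (simp only: y_def)
      ultimately have "z (Suc n) (Suc i) \<omega> - z n (Suc i) \<omega> - laplace h (\<lambda>j. y n j \<omega>) i * k
          = f n i \<omega> * k + G n i \<omega> * (B (real (Suc n) * k) \<omega> - B (real n * k) \<omega>)"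
        unfolding shift_pos_increment f_def G_def by (simp only:)
      then show ?case by (simp add: algebra_simps)
    qed
  next
    fix n i assume n: "n < N" "0 < n" "i < M"
    have x: "real (Suc i) * h \<in> xmesh_bar M" "real n * k \<in> tmesh_bar T N"
      unfolding h_def k_def using n xmesh_bar_node[of "Suc i" M] tmesh_bar_node[of n N T] by simp_all
    show "AE \<omega> in P. \<bar>f n i \<omega>\<bar> \<le> K * (\<bar>y n (Suc i) \<omega>\<bar> + \<bar>mid_slope h (\<lambda>j. y n j \<omega>) i\<bar> + \<bar>z n (Suc i) \<omega>\<bar>)"
      using LinfF_bound_AE[OF a] LinfF_bound_AE[OF b] LinfF_bound_AE[OF c]
    proof eventually_elim
      case (elim \<omega>)
      have tri: "\<bar>A * p + B * q + C * r\<bar> \<le> K * (\<bar>p\<bar> + \<bar>q\<bar> + \<bar>r\<bar>)"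
        if "\<bar>A\<bar> \<le> K" "\<bar>B\<bar> \<le> K" "\<bar>C\<bar> \<le> K" for A B C p q r :: real
      proof -
        have "\<bar>A * p + B * q + C * r\<bar> \<le> \<bar>A * p + B * q\<bar> + \<bar>C * r\<bar>" by (rule abs_triangle_ineq)
        also have "\<dots> \<le> \<bar>A * p\<bar> + \<bar>B * q\<bar> + \<bar>C * r\<bar>" by (intro add_right_mono abs_triangle_ineq)
        also have "\<dots> \<le> K * \<bar>p\<bar> + K * \<bar>q\<bar> + K * \<bar>r\<bar>"
          unfolding abs_mult using that by (intro add_mono mult_right_mono) auto
        finally show ?thesis by (simp add: distrib_left)
      qed
      show ?case unfolding f_def by (rule tri) (use elim x in auto)
    qed
  next
    fix n i assume n: "n < N" "0 < n" "i < M"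
    have x: "real (Suc i) * h \<in> xmesh_bar M" "real n * k \<in> tmesh_bar T N"
      unfolding h_def k_def using n xmesh_bar_node[of "Suc i" M] tmesh_bar_node[of n N T] by simp_all
    show "AE \<omega> in P. \<bar>G n i \<omega> - g \<omega> (real (Suc i) * h) (real n * k)\<bar> \<le> K * \<bar>y n (Suc i) \<omega>\<bar>"
      using LinfF_bound_AE[OF d]
    proof eventually_elim
      case (elim \<omega>)
      then have "\<bar>d \<omega> (real (Suc i) * h) (real n * k)\<bar> \<le> K" using x by auto
      then show ?case by (simp add: G_def abs_mult mult_right_mono)
    qed
  qed (use y0 z1 bd z_bd in auto)
qed

lemma L2F_sqint:
  assumes "brownian_space P B" and k: "0 < dt T N" and g: "g \<in> L2F P B M T N"
    and x: "x \<in> xmesh M" and t: "t \<in> tmesh T N"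
  shows "(\<lambda>\<omega>. g \<omega> x t) \<in> borel_measurable (augfilt P B t)" "sqint P (\<lambda>\<omega>. g \<omega> x t)"
proof -
  interpret brownian_space P B by fact
  show m: "(\<lambda>\<omega>. g \<omega> x t) \<in> borel_measurable (augfilt P B t)"
    using g x t by (simp add: L2F_def adapted_def)
  have meas: "(\<lambda>\<omega>. g \<omega> x t) \<in> borel_measurable P" by (rule augfilt_measurable_events[OF m])
  obtain i where i: "i < M" "x = real (Suc i) * dx M"
  proof -
    obtain j where "j \<in> {1..M}" "x = real j * dx M" using x by (auto simp: xmesh_def)
    then show thesis using that[of "j - 1"] by auto
  qed
  obtain n where n: "n \<in> {1..N}" "t = real n * dt T N" using t by (auto simp: tmesh_def)
  have hk: "0 < dt T N * dx M" using k dx_pos by simp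
  have "integrable P (\<lambda>\<omega>. (L2_norm M T N (g \<omega>))\<^sup>2 / (dt T N * dx M))" using g by (simp add: L2F_def)
  then have "integrable P (\<lambda>\<omega>. (g \<omega> x t)\<^sup>2)"
  proof (rule Bochner_Integration.integrable_bound)
    have "(g \<omega> x t)\<^sup>2 \<le> (L2_norm M T N (g \<omega>))\<^sup>2 / (dt T N * dx M)" for \<omega>
    proof -
      let ?s = "\<lambda>n. \<Sum>i<M. (g \<omega> (real (Suc i) * dx M) (real n * dt T N))\<^sup>2"
      have "(g \<omega> x t)\<^sup>2 \<le> ?s n"
        unfolding i n by (rule member_le_sum) (use i in auto)
      then have "dt T N * (dx M * (g \<omega> x t)\<^sup>2) \<le> dt T N * (dx M * ?s n)"
        using k dx_pos[of M] by (intro mult_left_mono) auto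
      also have "\<dots> \<le> (\<Sum>n\<in>{1..N}. dt T N * (dx M * ?s n))"
        using k dx_pos[of M] by (intro member_le_sum[OF n(1)]) (auto intro!: mult_nonneg_nonneg sum_nonneg)
      finally show ?thesis using hk unfolding L2_norm_square[OF k] by (simp add: le_divide_eq mult_ac)
    qed
    then show "AE \<omega> in P. norm ((g \<omega> x t)\<^sup>2) \<le> norm ((L2_norm M T N (g \<omega>))\<^sup>2 / (dt T N * dx M))"
      using hk by (intro AE_I2) (auto intro: order_trans)
  qed (use meas in auto)
  then show "sqint P (\<lambda>\<omega>. g \<omega> x t)" using meas by (simp add: sqint_def)
qed

lemma L2_xnorm_sqint:
  assumes "integrable P (\<lambda>\<omega>. (L2_xnorm M (v \<omega>))\<^sup>2)" "x \<in> xmesh M" "(\<lambda>\<omega>. v \<omega> x) \<in> borel_measurable P"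
  shows "sqint P (\<lambda>\<omega>. v \<omega> x)"
proof -
  obtain i where i: "i < M" "x = real (Suc i) * dx M"
  proof -
    obtain j where "j \<in> {1..M}" "x = real j * dx M" using assms(2) by (auto simp: xmesh_def)
    then show thesis using that[of "j - 1"] by auto
  qed
  have "integrable P (\<lambda>\<omega>. (L2_xnorm M (v \<omega>))\<^sup>2 / dx M)" using assms(1) by simp
  then have "integrable P (\<lambda>\<omega>. (v \<omega> x)\<^sup>2)"
  proof (rule Bochner_Integration.integrable_bound)
    have "(v \<omega> x)\<^sup>2 \<le> (L2_xnorm M (v \<omega>))\<^sup>2 / dx M" for \<omega>
    proof -
      have "(v \<omega> x)\<^sup>2 \<le> mass M (\<lambda>j. v \<omega> (real j * dx M))"
        unfolding i mass_def by (rule member_le_sum) (use i in auto)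
      then show ?thesis using dx_pos[of M] by (simp add: L2_xnorm_square)
    qed
    then show "AE \<omega> in P. norm ((v \<omega> x)\<^sup>2) \<le> norm ((L2_xnorm M (v \<omega>))\<^sup>2 / dx M)"
      using dx_pos[of M] by (intro AE_I2) (auto intro: order_trans)
  qed (use assms in auto)
  then show ?thesis using assms by (simp add: sqint_def)
qed

section \<open>From expectations to norms\<close>

text \<open>
  The cross term between the velocity and the slope at the final time: one factor is small, the
  other one only bounded. This is where the square root of the final norm comes from.
\<close>

lemma (in stochastic_scheme) final_momentum_bound:
  assumes Q: "0 < Q" "h * energy N \<le> Q\<^sup>2" and \<eta>: "0 \<le> \<eta>" "h * potential_energy N \<le> \<eta>\<^sup>2"
  shows "h * abs_momentum N + h * potential_energy N \<le> 2 * Q * \<eta>"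
proof -
  have V: "0 \<le> h * potential_energy N" and Z: "h * kinetic_energy N \<le> Q\<^sup>2" "h * potential_energy N \<le> Q\<^sup>2"
  proof -
    have "h * energy N = h * potential_energy N + h * kinetic_energy N"
      by (simp add: energy_split distrib_left)
    moreover have "0 \<le> h * kinetic_energy N" "0 \<le> h * potential_energy N" using h_pos nonneg(1,2)[of N] by simp_all
    ultimately show "0 \<le> h * potential_energy N" "h * kinetic_energy N \<le> Q\<^sup>2" "h * potential_energy N \<le> Q\<^sup>2"
      using Q(2) by linarith+
  qed
  have "h * potential_energy N = sqrt (h * potential_energy N) * sqrt (h * potential_energy N)" using V by simp
  also have "\<dots> \<le> Q * \<eta>"
    using Z(2) \<eta> Q V by (intro mult_mono real_le_lsqrt) (auto intro: real_le_lsqrt)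
  finally have 1: "h * potential_energy N \<le> Q * \<eta>" .
  have bound: "h * abs_momentum N \<le> (s * \<eta>\<^sup>2 + Q\<^sup>2 / s) / 2" if s: "0 < s" for s
  proof -
    have "h * abs_momentum N \<le> h * ((s * potential_energy N + kinetic_energy N / s) / 2)"
      using abs_momentum_le[of N s] s N_pos h_pos by (intro mult_left_mono) auto
    also have "\<dots> = (s * (h * potential_energy N) + (h * kinetic_energy N) / s) / 2" by (simp add: field_simps)
    also have "\<dots> \<le> (s * \<eta>\<^sup>2 + Q\<^sup>2 / s) / 2"
      using s \<eta> Z by (intro divide_right_mono add_mono mult_left_mono) auto
    finally show ?thesis .
  qed
  have "h * abs_momentum N \<le> Q * \<eta>"
  proof (cases "\<eta> = 0")
    case True
    show ?thesis
    proof (rule ccontr)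
      assume "\<not> ?thesis"
      then have x: "0 < h * abs_momentum N" using True by simp
      have "h * abs_momentum N \<le> (Q\<^sup>2 / (Q\<^sup>2 / (h * abs_momentum N))) / 2"
        using bound[of "Q\<^sup>2 / (h * abs_momentum N)"] x Q True by simp
      then show False using x Q by simp
    qed
  next
    case False
    then have "h * abs_momentum N \<le> (Q / \<eta> * \<eta>\<^sup>2 + Q\<^sup>2 / (Q / \<eta>)) / 2" using Q \<eta> by (intro bound) simp
    then show ?thesis using False Q by (simp add: power2_eq_square)
  qed
  then show ?thesis using 1 by simp
qed

lemma (in stochastic_scheme) expectation_sum_slices:
  fixes c :: "'n \<Rightarrow> real" and X :: "'n \<Rightarrow> 'a \<Rightarrow> real"
  assumes "\<And>n. n \<in> A \<Longrightarrow> integrable P (X n)"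
  shows "expectation (\<lambda>\<omega>. \<Sum>n\<in>A. c n * X n \<omega>) = (\<Sum>n\<in>A. c n * expectation (X n))"
  using assms by (subst Bochner_Integration.integral_sum) auto

lemma combine_square_bounds:
  fixes A B E c D t s Q \<eta> :: real
  assumes sq: "A\<^sup>2 \<le> c * D" "B\<^sup>2 \<le> c * D" "E\<^sup>2 \<le> c * D" and D: "D \<le> t\<^sup>2 + s\<^sup>2 + 2 * Q * \<eta>"
    and pos: "0 \<le> c" "0 \<le> t" "0 \<le> s" "0 \<le> Q" "0 \<le> \<eta>"
  defines "C \<equiv> 3 * sqrt c * (1 + sqrt (2 * Q)) + 1"
  shows "A + B + E \<le> C * t + C * sqrt \<eta> + C * s"
proof -
  let ?r = "sqrt c * (t + s + sqrt (2 * Q) * sqrt \<eta>)"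
  have "X \<le> ?r" if "X\<^sup>2 \<le> c * D" for X
  proof -
    have "X\<^sup>2 \<le> c * (t\<^sup>2 + s\<^sup>2 + 2 * Q * \<eta>)" using that mult_left_mono[OF D pos(1)] by linarith
    then have "X \<le> sqrt (c * (t\<^sup>2 + s\<^sup>2 + 2 * Q * \<eta>))" by (rule real_le_rsqrt)
    also have "\<dots> = sqrt c * sqrt (t\<^sup>2 + s\<^sup>2 + 2 * Q * \<eta>)" by (rule real_sqrt_mult)
    also have "\<dots> \<le> ?r"
    proof (intro mult_left_mono)
      have "sqrt (t\<^sup>2 + s\<^sup>2 + 2 * Q * \<eta>) \<le> sqrt (t\<^sup>2 + s\<^sup>2) + sqrt (2 * Q * \<eta>)"
        using pos by (intro sqrt_add_le_add_sqrt) auto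
      also have "sqrt (t\<^sup>2 + s\<^sup>2) \<le> sqrt (t\<^sup>2) + sqrt (s\<^sup>2)" by (intro sqrt_add_le_add_sqrt) auto
      finally show "sqrt (t\<^sup>2 + s\<^sup>2 + 2 * Q * \<eta>) \<le> t + s + sqrt (2 * Q) * sqrt \<eta>"
        using pos by (simp add: real_sqrt_mult)
    qed (use pos in auto)
    finally show ?thesis .
  qed
  from this[OF sq(1)] this[OF sq(2)] this[OF sq(3)] have "A + B + E \<le> ?r + ?r + ?r" by (intro add_mono)
  also have "\<dots> = 3 * ?r" by simp
  also have "3 * ?r = 3 * sqrt c * t + 3 * sqrt c * s + 3 * sqrt c * sqrt (2 * Q) * sqrt \<eta>"
    by (simp add: algebra_simps)
  also have "\<dots> \<le> C * t + C * s + C * sqrt \<eta>"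
  proof -
    have "0 \<le> 3 * sqrt c * sqrt (2 * Q)" "0 \<le> 3 * sqrt c" using pos by auto
    then have "3 * sqrt c \<le> C" "3 * sqrt c * sqrt (2 * Q) \<le> C" by (simp_all add: C_def distrib_left)
    then show ?thesis using pos by (intro add_mono mult_right_mono) auto
  qed
  finally show ?thesis by simp
qed

lemma square_diff_le: "(p - q)\<^sup>2 \<le> 2 * p\<^sup>2 + 2 * q\<^sup>2" for p q :: real
  using zero_le_power2[of "p + q"] by (simp add: power2_eq_square algebra_simps)

lemma mass_minus_le: "mass M (\<lambda>j. v j - w j) \<le> 2 * mass M v + 2 * mass M w"
  unfolding mass_def sum_distrib_left sum.distrib[symmetric] by (intro sum_mono square_diff_le)

lemma stiffness_minus_le: "stiffness M h (\<lambda>j. v j - w j) \<le> 2 * stiffness M h v + 2 * stiffness M h w"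
  using stiffness_add_le[of M "\<lambda>j. v j - w j" v "- 1" w h] by simp

lemma L2_xnorm_minus_le: "(L2_xnorm M (\<lambda>x. v x - w x))\<^sup>2 \<le> 2 * (L2_xnorm M v)\<^sup>2 + 2 * (L2_xnorm M w)\<^sup>2"
proof -
  have "dx M * mass M (\<lambda>j. v (real j * dx M) - w (real j * dx M))
      \<le> dx M * (2 * mass M (\<lambda>j. v (real j * dx M)) + 2 * mass M (\<lambda>j. w (real j * dx M)))"
    using dx_pos[of M] by (intro mult_left_mono mass_minus_le) auto
  then show ?thesis by (simp add: L2_xnorm_square algebra_simps)
qed

lemma H1_xnorm_minus_le: "(H1_xnorm M (\<lambda>x. v x - w x))\<^sup>2 \<le> 2 * (H1_xnorm M v)\<^sup>2 + 2 * (H1_xnorm M w)\<^sup>2"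
proof -
  have "dx M * mass M (\<lambda>j. v (real j * dx M) - w (real j * dx M))
      \<le> dx M * (2 * mass M (\<lambda>j. v (real j * dx M)) + 2 * mass M (\<lambda>j. w (real j * dx M)))"
    using dx_pos[of M] by (intro mult_left_mono mass_minus_le) auto
  moreover have "dx M * stiffness M (dx M) (\<lambda>j. v (real j * dx M) - w (real j * dx M))
      \<le> dx M * (2 * stiffness M (dx M) (\<lambda>j. v (real j * dx M)) + 2 * stiffness M (dx M) (\<lambda>j. w (real j * dx M)))"
    using dx_pos[of M] by (intro mult_left_mono stiffness_minus_le) auto
  ultimately show ?thesis by (simp add: H1_xnorm_square algebra_simps)
qed

lemma L2_norm_minus_le:
  assumes k: "0 < dt T N"
  shows "(L2_norm M T N (\<lambda>x t. v x t - w x t))\<^sup>2 \<le> 2 * (L2_norm M T N v)\<^sup>2 + 2 * (L2_norm M T N w)\<^sup>2"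
proof -
  let ?s = "\<lambda>v n. \<Sum>i<M. (v (real (Suc i) * dx M) (real n * dt T N))\<^sup>2"
  have "?s (\<lambda>x t. v x t - w x t) n \<le> 2 * ?s v n + 2 * ?s w n" for n
    unfolding sum_distrib_left sum.distrib[symmetric] by (intro sum_mono square_diff_le)
  then have "(\<Sum>n\<in>{1..N}. dt T N * (dx M * ?s (\<lambda>x t. v x t - w x t) n))
      \<le> (\<Sum>n\<in>{1..N}. dt T N * (dx M * (2 * ?s v n + 2 * ?s w n)))"
    using k dx_pos[of M] by (intro sum_mono mult_left_mono) auto
  also have "\<dots> = 2 * (\<Sum>n\<in>{1..N}. dt T N * (dx M * ?s v n)) + 2 * (\<Sum>n\<in>{1..N}. dt T N * (dx M * ?s w n))"
    unfolding sum_distrib_left sum.distrib[symmetric] by (intro sum.cong refl) (simp only: sum_distrib_left[symmetric] distrib_left mult.left_commute)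
  finally show ?thesis unfolding L2_norm_square[OF k] .
qed

lemma L2\<Omega>_norm_minus_le:
  assumes sq: "\<And>\<omega>. (nrm (\<xi> \<omega>))\<^sup>2 \<le> 2 * (nrm (\<zeta> \<omega>))\<^sup>2 + 2 * (nrm (\<zeta>' \<omega>))\<^sup>2"
    and int: "integrable P (\<lambda>\<omega>. (nrm (\<zeta> \<omega>))\<^sup>2)" "integrable P (\<lambda>\<omega>. (nrm (\<zeta>' \<omega>))\<^sup>2)"
    and R: "L2\<Omega>_norm P nrm \<zeta> \<le> R" "L2\<Omega>_norm P nrm \<zeta>' \<le> R"
  shows "(\<integral>\<omega>. (nrm (\<xi> \<omega>))\<^sup>2 \<partial>P) \<le> 4 * R\<^sup>2"
proof -
  have "(\<integral>\<omega>. (nrm (\<xi> \<omega>))\<^sup>2 \<partial>P) \<le> (\<integral>\<omega>. 2 * (nrm (\<zeta> \<omega>))\<^sup>2 + 2 * (nrm (\<zeta>' \<omega>))\<^sup>2 \<partial>P)"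
    using int by (intro integral_mono' sq) auto
  also have "\<dots> = 2 * (L2\<Omega>_norm P nrm \<zeta>)\<^sup>2 + 2 * (L2\<Omega>_norm P nrm \<zeta>')\<^sup>2"
    using int by (simp add: L2\<Omega>_norm_square)
  also have "\<dots> \<le> 2 * R\<^sup>2 + 2 * R\<^sup>2"
    using R by (intro add_mono mult_left_mono power_mono L2\<Omega>_norm_nonneg) auto
  finally show ?thesis by simp
qed

text \<open>
  The theorem on one mesh, with its constants. The squares of the norms on both sides are identified
  with the expected energies of the difference, to which \<open>stability\<close> applies.
\<close>

lemma difference_estimate:
  fixes P :: "'a measure" and B and M N :: nat and T K R \<gamma> \<rho> :: real
  assumes P: "brownian_space P B"
    and T: "1 < \<gamma>" "\<gamma> < T" and K: "0 \<le> K" and R: "0 < R" and \<rho>: "0 < \<rho>"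
    and large: "5 / 2 * K + 1 + 4 * (1 + K) * exp (2 * (4 * K + 1) * T) / (T - \<gamma>) \<le> \<rho> * (\<gamma> - 1) / 4"
    and MN: "1 \<le> M" "1 \<le> N" and cfl: "4 * dt T N \<le> (dx M)\<^sup>2"
    and small: "(4 * K + 1) * dx M \<le> 1 / 2" "\<rho> * dx M \<le> 1" "\<rho> * (\<gamma>\<^sup>2 + 1) * dx M \<le> (\<gamma> - 1) / 2"
      "dx M \<le> (T - \<gamma>) / 2"
    and a: "a \<in> LinfF P B M T N" "LinfF_norm P M T N a \<le> ereal K"
    and b: "b \<in> LinfF P B M T N" "LinfF_norm P M T N b \<le> ereal K"
    and c: "c \<in> LinfF P B M T N" "LinfF_norm P M T N c \<le> ereal K"
    and d: "d \<in> LinfF P B M T N" "LinfF_norm P M T N d \<le> ereal K"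
    and adm1: "(g1, y01, y11) \<in> admissible P B M T N R gbar"
    and adm2: "(g2, y02, y12) \<in> admissible P B M T N R gbar"
    and sol1: "scheme_solution P B M T N a b c d g1 y01 y11 y1"
    and sol2: "scheme_solution P B M T N a b c d g2 y02 y12 y2"
  defines "c0 \<equiv> (exp (\<rho> * \<gamma>) + 2 * exp (2 * (4 * K + 1) * T) / (T - \<gamma>)) * (exp (\<rho> * T) * (1 + \<rho> * \<gamma>)) + 1"
  defines "c1 \<equiv> 4 * (1 + (4 * K + 1) * T + K\<^sup>2 * T) * c0"
  defines "Q \<equiv> sqrt (28 * exp ((2 + 4 * K + 8 * K\<^sup>2) * T)) * R"
  defines "C \<equiv> 3 * sqrt c1 * (1 + sqrt (2 * Q)) + 1"
  shows "L2\<Omega>_norm P (L2_norm M T N) (\<lambda>\<omega> x t. sqrt (T - t) * (g1 \<omega> x t - g2 \<omega> x t))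
         + L2\<Omega>_norm P (H1_xnorm M) (\<lambda>\<omega> x. y01 \<omega> x - y02 \<omega> x)
         + L2\<Omega>_norm P (L2_xnorm M) (\<lambda>\<omega> x. y11 \<omega> x - y12 \<omega> x)
         \<le> C * L2\<Omega>_norm P (L2_tnorm T N)
                 (\<lambda>\<omega> t. trace0 (dx M) (Dx (dx M) (y1 \<omega>)) t - trace0 (dx M) (Dx (dx M) (y2 \<omega>)) t)
           + C * sqrt (L2\<Omega>_norm P (H1_xnorm M) (\<lambda>\<omega> x. y1 \<omega> x T - y2 \<omega> x T))
           + C * L2\<Omega>_norm P (L2_norm_star M T N)
                 (\<lambda>\<omega> x t. dx M * (Dt (dt T N) (Dx (dx M) (y1 \<omega>)) x t
                                 - Dt (dt T N) (Dx (dx M) (y2 \<omega>)) x t))"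
    (is "?LG + ?L0 + ?L1 \<le> C * ?RT + C * sqrt ?RH + C * ?RS")
proof -
  define h where "h = dx M"
  define k where "k = dt T N"
  define u where "u = (\<lambda>\<omega> x t. y1 \<omega> x t - y2 \<omega> x t)"
  define gg where "gg = (\<lambda>\<omega> x t. g1 \<omega> x t - g2 \<omega> x t)"
  define u0 where "u0 = (\<lambda>\<omega> x. y01 \<omega> x - y02 \<omega> x)"
  define u1 where "u1 = (\<lambda>\<omega> x. y11 \<omega> x - y12 \<omega> x)"
  define y where "y = (\<lambda>n j \<omega>. u \<omega> (real j * h) (real n * k))"
  define z where "z = (\<lambda>n j \<omega>. (u \<omega> (real j * h) (real n * k) - u \<omega> (real j * h) (real (n - 1) * k)) / k)"
  define f where "f = (\<lambda>n i \<omega>. a \<omega> (real (Suc i) * h) (real n * k) * y n (Suc i) \<omega>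
      + b \<omega> (real (Suc i) * h) (real n * k) * mid_slope h (\<lambda>j. y n j \<omega>) i
      + c \<omega> (real (Suc i) * h) (real n * k) * z n (Suc i) \<omega>)"
  define G where "G = (\<lambda>n i \<omega>. d \<omega> (real (Suc i) * h) (real n * k) * y n (Suc i) \<omega> + gg \<omega> (real (Suc i) * h) (real n * k))"
  define g where "g = (\<lambda>n i \<omega>. gg \<omega> (real (Suc i) * h) (real n * k))"
  interpret brownian_space P B by fact
  have T0: "0 < T" and N0: "0 < N" using T MN by auto
  have kp: "0 < k" "0 < dt T N" using T0 N0 by (auto simp: k_def dt_def)
  have hp: "0 < h" using dx_pos by (simp add: h_def)
  have Nk: "real N * k = T" using N0 by (simp add: k_def dt_def)
  have g12: "g1 \<in> L2F P B M T N" "g2 \<in> L2F P B M T N"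
    and y012: "y01 \<in> H1F_x P B M 0" "y02 \<in> H1F_x P B M 0"
    and y112: "y11 \<in> L2F_x P B M 0" "y12 \<in> L2F_x P B M 0"
    and norms1: "L2\<Omega>_norm P (L2_norm M T N) g1 + L2\<Omega>_norm P (H1_xnorm M) y01 + L2\<Omega>_norm P (L2_xnorm M) y11 \<le> R"
    and norms2: "L2\<Omega>_norm P (L2_norm M T N) g2 + L2\<Omega>_norm P (H1_xnorm M) y02 + L2\<Omega>_norm P (L2_xnorm M) y12 \<le> R"
    using adm1 adm2 by (auto simp: admissible_def)
  have R1: "L2\<Omega>_norm P (L2_norm M T N) g1 \<le> R" "L2\<Omega>_norm P (H1_xnorm M) y01 \<le> R" "L2\<Omega>_norm P (L2_xnorm M) y11 \<le> R"
    and R2: "L2\<Omega>_norm P (L2_norm M T N) g2 \<le> R" "L2\<Omega>_norm P (H1_xnorm M) y02 \<le> R" "L2\<Omega>_norm P (L2_xnorm M) y12 \<le> R"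
    using norms1 norms2 L2\<Omega>_norm_nonneg[of P "L2_norm M T N" g1] L2\<Omega>_norm_nonneg[of P "H1_xnorm M" y01]
      L2\<Omega>_norm_nonneg[of P "L2_xnorm M" y11] L2\<Omega>_norm_nonneg[of P "L2_norm M T N" g2]
      L2\<Omega>_norm_nonneg[of P "H1_xnorm M" y02] L2\<Omega>_norm_nonneg[of P "L2_xnorm M" y12] by linarith+
  have node_bar: "x \<in> xmesh_bar M" if "x \<in> xmesh M" for x
    using that by (auto simp: xmesh_def xmesh_bar_def)
  have H1_L2: "integrable P (\<lambda>\<omega>. (L2_xnorm M (v \<omega>))\<^sup>2)" if "v \<in> H1F_x P B M 0" for v
  proof (rule Bochner_Integration.integrable_bound)
    show "integrable P (\<lambda>\<omega>. (H1_xnorm M (v \<omega>))\<^sup>2)" using that by (simp add: H1F_x_def)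
    have "(\<lambda>\<omega>. v \<omega> (real (Suc i) * dx M)) \<in> borel_measurable P" if "i < M" for i
      using that \<open>v \<in> _\<close> node_bar[OF xmesh_node[of i M]]
      by (intro augfilt_measurable_events[of _ 0]) (auto simp: H1F_x_def)
    then show "(\<lambda>\<omega>. (L2_xnorm M (v \<omega>))\<^sup>2) \<in> borel_measurable P"
      unfolding L2_xnorm_square mass_def
      by (intro borel_measurable_times borel_measurable_const borel_measurable_sum borel_measurable_power) auto
    have "(L2_xnorm M (v \<omega>))\<^sup>2 \<le> (H1_xnorm M (v \<omega>))\<^sup>2" for \<omega>
      using dx_pos[of M] stiffness_nonneg[of M "dx M"] by (simp add: L2_xnorm_square H1_xnorm_square)
    then show "AE \<omega> in P. norm ((L2_xnorm M (v \<omega>))\<^sup>2) \<le> norm ((H1_xnorm M (v \<omega>))\<^sup>2)" by simp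
  qed
  have g_meas: "(\<lambda>\<omega>. gg \<omega> x t) \<in> borel_measurable (augfilt P B t)" and g_sq: "sqint P (\<lambda>\<omega>. gg \<omega> x t)"
    if "x \<in> xmesh M" "t \<in> tmesh T N" for x t
    unfolding gg_def using L2F_sqint[OF P kp(2) g12(1) that] L2F_sqint[OF P kp(2) g12(2) that]
    by (auto intro: sqint_diff)
  have u0_sq: "sqint P (\<lambda>\<omega>. u0 \<omega> x)" if x: "x \<in> xmesh M" for x
    unfolding u0_def
  proof (intro sqint_diff L2_xnorm_sqint[where M = M] H1_L2 y012 x)
    show "(\<lambda>\<omega>. y01 \<omega> x) \<in> borel_measurable P" "(\<lambda>\<omega>. y02 \<omega> x) \<in> borel_measurable P"
      using y012 node_bar[OF x] by (auto simp: H1F_x_def intro: augfilt_measurable_events)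
  qed
  have u1_sq: "sqint P (\<lambda>\<omega>. u1 \<omega> x)" if x: "x \<in> xmesh M" for x
    unfolding u1_def
    by (intro sqint_diff L2_xnorm_sqint[where M = M] x)
      (use y112 x in \<open>auto simp: L2F_x_def intro: augfilt_measurable_events\<close>)
  have sol: "scheme_solution P B M T N a b c d gg u0 u1 u"
    unfolding gg_def u0_def u1_def u_def by (rule scheme_solution_minus[OF sol1 sol2])
  have cfl': "4 * k \<le> h\<^sup>2" using cfl by (simp add: h_def k_def)
  interpret S: stochastic_scheme P B M N h k K y z f G g
    unfolding h_def k_def y_def z_def f_def G_def g_def
    by (rule stochastic_scheme_of_solution[OF T0 N0 cfl K a b c d sol g_meas g_sq u0_sq u1_sq])
  have kh: "k \<le> h"
  proof -
    have "h * h \<le> h * 1" using S.h_le_1 hp by (intro mult_left_mono) auto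
    then show ?thesis using cfl' kp(1) by (simp add: power2_eq_square)
  qed

  \<comment> \<open>The norms of the theorem in terms of the expected energies.\<close>
  have trace: "?RT\<^sup>2 = (\<Sum>n\<in>{1..N}. k * S.trace_energy n)"
  proof -
    have "trace0 h (Dx h (y1 \<omega>)) (real n * k) - trace0 h (Dx h (y2 \<omega>)) (real n * k) = slope h (\<lambda>j. y n j \<omega>) 0" for \<omega> n
      by (simp add: trace0_slope slope_def y_def u_def diff_divide_distrib)
    then have "?RT\<^sup>2 = expectation (\<lambda>\<omega>. \<Sum>n\<in>{1..N}. k * (slope h (\<lambda>j. y n j \<omega>) 0)\<^sup>2)"
      unfolding L2\<Omega>_norm_square L2_tnorm_square[OF kp(2)] h_def[symmetric] k_def[symmetric] by simp
    also have "\<dots> = (\<Sum>n\<in>{1..N}. k * S.trace_energy n)"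
      unfolding S.trace_energy_def by (rule S.expectation_sum_slices) (intro sqint_square S.sqint_slope_y, auto)
    finally show ?thesis .
  qed
  have star: "?RS\<^sup>2 = k * h * (\<Sum>n\<in>{1..N}. S.jump_energy n)"
  proof -
    have "h * (Dt k (Dx h (y1 \<omega>)) ((real i + 1 / 2) * h) ((real n + 1 / 2) * k)
          - Dt k (Dx h (y2 \<omega>)) ((real i + 1 / 2) * h) ((real n + 1 / 2) * k)) = z (Suc n) (Suc i) \<omega> - z (Suc n) i \<omega>" for \<omega> i n
      unfolding Dt_half Dx_slope slope_def z_def u_def using hp kp(1) by (simp add: field_simps)
    then have "?RS\<^sup>2 = expectation (\<lambda>\<omega>. \<Sum>n<N. k * (h * (\<Sum>i<Suc M. (z (Suc n) (Suc i) \<omega> - z (Suc n) i \<omega>)\<^sup>2)))"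
      unfolding L2\<Omega>_norm_square L2_norm_star_square[OF kp(2)] h_def[symmetric] k_def[symmetric] by (simp only:)
    also have "\<dots> = expectation (\<lambda>\<omega>. \<Sum>n<N. (k * h) * (\<Sum>i<Suc M. (z (Suc n) (Suc i) \<omega> - z (Suc n) i \<omega>)\<^sup>2))"
      by (simp only: mult.assoc)
    also have "\<dots> = (\<Sum>n<N. (k * h) * S.jump_energy (Suc n))"
      unfolding S.jump_energy_def
      by (rule S.expectation_sum_slices) (use S.integrable_weighted(3)[of _ "\<lambda>_. 1"] in \<open>simp del: sum.lessThan_Suc\<close>)
    also have "\<dots> = k * h * (\<Sum>n<N. S.jump_energy (Suc n))" by (rule sum_distrib_left[symmetric])
    also have "(\<Sum>n<N. S.jump_energy (Suc n)) = (\<Sum>n\<in>{1..N}. S.jump_energy n)"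
      using sum.atLeast1_atMost_eq[of S.jump_energy N] by simp
    finally show ?thesis .
  qed
  have final: "h * S.potential_energy N \<le> ?RH\<^sup>2"
  proof -
    have eq: "(H1_xnorm M (\<lambda>x. y1 \<omega> x T - y2 \<omega> x T))\<^sup>2 = h * stiffness M h (\<lambda>j. y N j \<omega>) + h * mass M (\<lambda>j. y N j \<omega>)" for \<omega>
      unfolding H1_xnorm_square h_def[symmetric] y_def u_def Nk ..
    have [simp]: "integrable P (\<lambda>\<omega>. stiffness M h (\<lambda>j. y N j \<omega>))" "integrable P (\<lambda>\<omega>. mass M (\<lambda>j. y N j \<omega>))"
      using S.integrable_stiffness_y[of N] unfolding mass_def
      by (auto intro!: Bochner_Integration.integrable_sum sqint_square S.sqint_y)
    have "0 \<le> h * expectation (\<lambda>\<omega>. mass M (\<lambda>j. y N j \<omega>))"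
      using hp by (intro mult_nonneg_nonneg integral_nonneg_AE AE_I2 mass_nonneg) auto
    then show ?thesis unfolding L2\<Omega>_norm_square eq S.potential_energy_def by simp
  qed
  have force: "expectation (\<lambda>\<omega>. \<Sum>n\<in>{1..N}. w n * (\<Sum>i<M. (g n i \<omega>)\<^sup>2)) = (\<Sum>n\<in>{1..N}. w n * S.force_energy n)"
    for w :: "nat \<Rightarrow> real"
    unfolding S.force_energy_def
  proof (rule S.expectation_sum_slices)
    fix n assume "n \<in> {1..N}"
    then have "sqint P (g n i)" if "i < M" for i
      unfolding g_def h_def k_def using g_sq[OF xmesh_node[OF that] tmesh_node[of n N T]] by auto
    then show "integrable P (\<lambda>\<omega>. \<Sum>i<M. (g n i \<omega>)\<^sup>2)"
      by (intro Bochner_Integration.integrable_sum sqint_square) auto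
  qed
  have source: "?LG\<^sup>2 = (\<Sum>n\<in>{1..<N}. (real N * k - real n * k) * (k * (h * S.force_energy n)))"
  proof -
    have "?LG\<^sup>2 = expectation (\<lambda>\<omega>. \<Sum>n\<in>{1..N}. (k * (h * (T - real n * k))) * (\<Sum>i<M. (g n i \<omega>)\<^sup>2))"
      unfolding L2\<Omega>_norm_square L2_norm_square[OF kp(2)] h_def[symmetric] k_def[symmetric]
    proof (intro Bochner_Integration.integral_cong refl sum.cong)
      fix \<omega> n assume "n \<in> {1..N}"
      then have "real n * k \<le> T" using kp(1) unfolding Nk[symmetric] by auto
      then have "(sqrt (T - real n * k) * w)\<^sup>2 = (T - real n * k) * w\<^sup>2" for w by (simp add: power_mult_distrib)
      then show "k * (h * (\<Sum>i<M. (sqrt (T - real n * k) * (g1 \<omega> (real (Suc i) * h) (real n * k) - g2 \<omega> (real (Suc i) * h) (real n * k)))\<^sup>2))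
          = k * (h * (T - real n * k)) * (\<Sum>i<M. (g n i \<omega>)\<^sup>2)"
        by (simp only: g_def gg_def sum_distrib_left mult.assoc)
    qed
    also have "\<dots> = (\<Sum>n\<in>{1..N}. k * (h * (T - real n * k)) * S.force_energy n)" by (rule force)
    also have "\<dots> = (\<Sum>n\<in>{1..<N}. k * (h * (T - real n * k)) * S.force_energy n)"
      using N0 by (simp add: atLeastLessThanSuc_atLeastAtMost[symmetric] sum.atLeastLessThan_Suc Nk)
    finally show ?thesis unfolding Nk by (simp only: mult_ac)
  qed
  have init: "AE \<omega> in P. \<forall>x\<in>xmesh_bar M. u \<omega> x 0 = u0 \<omega> x \<and> t_pos k (Dt k (u \<omega>)) x 0 = u1 \<omega> x"
    using sol by (simp add: scheme_solution_def k_def)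
  have int0: "integrable P (\<lambda>\<omega>. stiffness M h (\<lambda>j. y 0 j \<omega>))" "integrable P (\<lambda>\<omega>. mass M (\<lambda>j. y 0 j \<omega>))"
    using S.integrable_stiffness_y[of 0] unfolding mass_def
    by (auto intro!: Bochner_Integration.integrable_sum sqint_square S.sqint_y)
  have H0: "?L0\<^sup>2 = expectation (\<lambda>\<omega>. h * stiffness M h (\<lambda>j. y 0 j \<omega>) + h * mass M (\<lambda>j. y 0 j \<omega>))"
  proof -
    have ae: "AE \<omega> in P. \<forall>j\<le>Suc M. u0 \<omega> (real j * h) = y 0 j \<omega>"
      using init by eventually_elim (auto simp: y_def h_def xmesh_bar_node)
    have "?L0\<^sup>2 = expectation (\<lambda>\<omega>. h * stiffness M h (\<lambda>j. u0 \<omega> (real j * h)) + h * mass M (\<lambda>j. u0 \<omega> (real j * h)))"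
      unfolding L2\<Omega>_norm_square H1_xnorm_square h_def[symmetric] u0_def ..
    also have "\<dots> = expectation (\<lambda>\<omega>. h * stiffness M h (\<lambda>j. y 0 j \<omega>) + h * mass M (\<lambda>j. y 0 j \<omega>))"
    proof (rule integral_cong_AE)
      have "(\<lambda>\<omega>. u0 \<omega> (real j * h)) \<in> borel_measurable P" if "j \<le> Suc M" for j
        unfolding u0_def h_def using y012 xmesh_bar_node[OF that]
        by (intro borel_measurable_diff; intro augfilt_measurable_events[of _ 0]) (auto simp: H1F_x_def)
      then show "(\<lambda>\<omega>. h * stiffness M h (\<lambda>j. u0 \<omega> (real j * h)) + h * mass M (\<lambda>j. u0 \<omega> (real j * h))) \<in> borel_measurable P"
        unfolding stiffness_def mass_def slope_def
        by (intro borel_measurable_add borel_measurable_times borel_measurable_const borel_measurable_sum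
            borel_measurable_power borel_measurable_divide borel_measurable_diff) (auto simp del: of_nat_Suc)
      show "AE \<omega> in P. h * stiffness M h (\<lambda>j. u0 \<omega> (real j * h)) + h * mass M (\<lambda>j. u0 \<omega> (real j * h))
          = h * stiffness M h (\<lambda>j. y 0 j \<omega>) + h * mass M (\<lambda>j. y 0 j \<omega>)"
        using ae
      proof eventually_elim
        case (elim \<omega>)
        have "stiffness M h (\<lambda>j. u0 \<omega> (real j * h)) = stiffness M h (\<lambda>j. y 0 j \<omega>)"
          unfolding stiffness_def slope_def using elim by (intro sum.cong refl) (auto simp del: of_nat_Suc)
        moreover have "mass M (\<lambda>j. u0 \<omega> (real j * h)) = mass M (\<lambda>j. y 0 j \<omega>)"
          unfolding mass_def using elim by (intro sum.cong refl) (auto simp del: of_nat_Suc)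
        ultimately show ?case by simp
      qed
    qed (use int0 in auto)
    finally show ?thesis .
  qed
  have L0_upper: "?L0\<^sup>2 \<le> 4 * (h * S.energy 1)"
  proof -
    have "AE \<omega> in P. y 0 0 \<omega> = 0 \<and> y 0 (Suc M) \<omega> = 0" by (rule S.y_boundary) simp
    then have p: "AE \<omega> in P. mass M (\<lambda>j. y 0 j \<omega>) \<le> stiffness M h (\<lambda>j. y 0 j \<omega>)"
    proof eventually_elim
      case (elim \<omega>)
      then show ?case
        using weighted_poincare[of h M "\<lambda>j. y 0 j \<omega>" "\<lambda>_. 1"] S.mesh hp
        by (simp add: mass_def stiffness_def antimono_def del: sum.lessThan_Suc)
    qed
    have "expectation (\<lambda>\<omega>. mass M (\<lambda>j. y 0 j \<omega>)) \<le> expectation (\<lambda>\<omega>. stiffness M h (\<lambda>j. y 0 j \<omega>))"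
      using int0 by (intro integral_mono_AE p) auto
    also have "\<dots> \<le> 2 * S.energy 1" by (rule S.initial_energy_bound(2))
    finally have "h * expectation (\<lambda>\<omega>. mass M (\<lambda>j. y 0 j \<omega>)) \<le> h * (2 * S.energy 1)"
      using hp by (intro mult_left_mono) auto
    moreover have "h * expectation (\<lambda>\<omega>. stiffness M h (\<lambda>j. y 0 j \<omega>)) \<le> h * (2 * S.energy 1)"
      using hp by (intro mult_left_mono S.initial_energy_bound(2)) auto
    ultimately show ?thesis unfolding H0 using int0 by simp
  qed
  have L0_lower: "h * S.potential_energy 0 \<le> ?L0\<^sup>2"
  proof -
    have "0 \<le> h * expectation (\<lambda>\<omega>. mass M (\<lambda>j. y 0 j \<omega>))"
      using hp by (intro mult_nonneg_nonneg integral_nonneg_AE AE_I2 mass_nonneg) auto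
    then show ?thesis unfolding H0 S.potential_energy_def using int0 by simp
  qed
  have L1: "?L1\<^sup>2 = h * S.kinetic_energy 1"
  proof -
    have "AE \<omega> in P. mass M (\<lambda>j. u1 \<omega> (real j * h)) = mass M (\<lambda>j. z 1 j \<omega>)"
      using init
    proof eventually_elim
      case (elim \<omega>)
      have "u1 \<omega> (real (Suc i) * h) = z 1 (Suc i) \<omega>" if "i < M" for i
      proof -
        have "t_pos k (Dt k (u \<omega>)) (real (Suc i) * h) 0 = u1 \<omega> (real (Suc i) * h)"
          using elim xmesh_bar_node[of "Suc i" M] that by (simp add: h_def)
        then show ?thesis using t_pos_Dt[of k "u \<omega>" "real (Suc i) * h" 0] by (simp add: z_def)
      qed
      then show ?case unfolding mass_def by (intro sum.cong refl) (auto simp del: of_nat_Suc)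
    qed
    moreover have "(\<lambda>\<omega>. mass M (\<lambda>j. u1 \<omega> (real j * h))) \<in> borel_measurable P"
      unfolding mass_def h_def
      by (intro borel_measurable_sum borel_measurable_power sqint_measurable u1_sq xmesh_node) auto
    moreover have "integrable P (\<lambda>\<omega>. mass M (\<lambda>j. z 1 j \<omega>))" using N0 by (intro S.integrable_mass_z) auto
    ultimately have "expectation (\<lambda>\<omega>. mass M (\<lambda>j. u1 \<omega> (real j * h))) = S.kinetic_energy 1"
      unfolding S.kinetic_energy_def by (intro integral_cong_AE) auto
    moreover have "?L1\<^sup>2 = h * expectation (\<lambda>\<omega>. mass M (\<lambda>j. u1 \<omega> (real j * h)))"
      unfolding L2\<Omega>_norm_square L2_xnorm_square h_def[symmetric] u1_def by simp
    ultimately show ?thesis by simp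
  qed

  \<comment> \<open>A priori bound of the energy at the final time; the data of the difference have norm at most \<open>2 R\<close>.\<close>
  have force_R: "(\<Sum>n\<in>{1..<N}. k * (h * S.force_energy n)) \<le> 4 * R\<^sup>2"
  proof -
    have "(\<Sum>n\<in>{1..<N}. k * (h * S.force_energy n)) \<le> (\<Sum>n\<in>{1..N}. k * (h * S.force_energy n))"
      using kp hp S.nonneg(5) by (intro sum_mono2) auto
    also have "\<dots> = expectation (\<lambda>\<omega>. \<Sum>n\<in>{1..N}. (k * h) * (\<Sum>i<M. (g n i \<omega>)\<^sup>2))"
      using force[of "\<lambda>_. k * h"] by (simp only: mult.assoc)
    also have "\<dots> = expectation (\<lambda>\<omega>. (L2_norm M T N (gg \<omega>))\<^sup>2)"
      unfolding L2_norm_square[OF kp(2)] h_def[symmetric] k_def[symmetric] g_def by (simp only: mult.assoc)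
    also have "\<dots> \<le> 4 * R\<^sup>2"
      using g12 R1(1) R2(1) unfolding gg_def
      by (intro L2\<Omega>_norm_minus_le[where \<zeta> = g1 and \<zeta>' = g2] L2_norm_minus_le kp(2)) (auto simp: L2F_def)
    finally show ?thesis .
  qed
  have L0_R: "?L0\<^sup>2 \<le> 4 * R\<^sup>2"
    unfolding L2\<Omega>_norm_square using y012 R1(2) R2(2)
    by (intro L2\<Omega>_norm_minus_le[where \<zeta> = y01 and \<zeta>' = y02] H1_xnorm_minus_le) (auto simp: H1F_x_def)
  have L1_R: "?L1\<^sup>2 \<le> 4 * R\<^sup>2"
    unfolding L2\<Omega>_norm_square using y112 R1(3) R2(3)
    by (intro L2\<Omega>_norm_minus_le[where \<zeta> = y11 and \<zeta>' = y12] L2_xnorm_minus_le) (auto simp: L2F_x_def)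
  have Q0: "0 < Q" using R by (simp add: Q_def)
  have energy_N: "h * S.energy N \<le> Q\<^sup>2"
  proof -
    let ?e = "exp ((2 + 4 * K + 8 * K\<^sup>2) * T)"
    have "h * S.energy N \<le> h * (?e * (S.energy 1 + 2 * (\<Sum>m\<in>{1..<N}. k * S.force_energy m)))"
      using S.energy_forward[of N] N0 hp unfolding Nk by (intro mult_left_mono) auto
    also have "\<dots> = ?e * (h * S.energy 1 + 2 * (\<Sum>m\<in>{1..<N}. k * (h * S.force_energy m)))"
      by (simp add: algebra_simps sum_distrib_left)
    also have "\<dots> \<le> ?e * (28 * R\<^sup>2)"
    proof (intro mult_left_mono)
      have "h * S.energy 1 \<le> h * (2 * S.potential_energy 0 + 3 * S.kinetic_energy 1)"
        using S.initial_energy_bound(1) hp unfolding S.potential_energy_def S.kinetic_energy_def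
        by (intro mult_left_mono) auto
      also have "\<dots> = 2 * (h * S.potential_energy 0) + 3 * (h * S.kinetic_energy 1)" by (simp add: algebra_simps)
      finally show "h * S.energy 1 + 2 * (\<Sum>m\<in>{1..<N}. k * (h * S.force_energy m)) \<le> 28 * R\<^sup>2"
        using L0_lower L0_R L1 L1_R force_R by linarith
    qed simp
    also have "\<dots> = Q\<^sup>2" by (simp add: Q_def power_mult_distrib)
    finally show ?thesis .
  qed
  have RH0: "0 \<le> ?RH" by (rule L2\<Omega>_norm_nonneg)

  \<comment> \<open>The smallness conditions on the mesh hold for \<open>k\<close> because \<open>k \<le> h\<close>.\<close>
  have D: "S.data_energy \<le> ?RT\<^sup>2 + ?RS\<^sup>2 + 2 * Q * ?RH"
    unfolding S.data_energy_def trace star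
    using S.final_momentum_bound[OF Q0 energy_N RH0 final] by simp
  have C1: "(4 * K + 1) * k \<le> 1 / 2"
  proof -
    have "(4 * K + 1) * k \<le> (4 * K + 1) * h" using kh K by (intro mult_left_mono) auto
    then show ?thesis using small(1) unfolding h_def[symmetric] by (rule order_trans)
  qed
  have \<rho>k: "\<rho> * k \<le> 1"
  proof -
    have "\<rho> * k \<le> \<rho> * h" using kh \<rho> by (intro mult_left_mono) auto
    then show ?thesis using small(2) unfolding h_def[symmetric] by (rule order_trans)
  qed
  have sm: "\<rho> * (\<gamma>\<^sup>2 * h + k) \<le> (\<gamma> - 1) / 2"
  proof -
    have "\<rho> * (\<gamma>\<^sup>2 * h + k) \<le> \<rho> * (\<gamma>\<^sup>2 * h + h)" using kh \<rho> by (intro mult_left_mono) auto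
    also have "\<dots> = \<rho> * (\<gamma>\<^sup>2 + 1) * h" by (simp add: algebra_simps)
    finally show ?thesis using small(3) unfolding h_def[symmetric] by simp
  qed
  have kd: "k \<le> (real N * k - \<gamma>) / 2" using kh small(4) unfolding Nk h_def[symmetric] by simp
  note st = S.stability[OF C1 \<rho> \<rho>k sm T(1) _ kd, unfolded Nk, OF T(2) large, folded c0_def]
  have D0: "0 \<le> S.data_energy" by (rule S.data_energy_nonneg)
  have c0: "0 \<le> c0" unfolding c0_def using T \<rho> by (intro add_nonneg_nonneg mult_nonneg_nonneg divide_nonneg_nonneg) auto
  define \<Gamma> where "\<Gamma> = (4 * K + 1) * T + K\<^sup>2 * T"
  have \<Gamma>: "0 \<le> \<Gamma>" "c1 = 4 * (1 + \<Gamma>) * c0" using K T0 by (simp_all add: \<Gamma>_def c1_def add.assoc)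
  have cD: "0 \<le> c0 * S.data_energy" using c0 D0 by simp
  have le: "4 * (c0 * S.data_energy) \<le> c1 * S.data_energy"
    using mult_nonneg_nonneg[OF \<Gamma>(1) cD] unfolding \<Gamma>(2) by (simp add: algebra_simps)
  have A: "?LG\<^sup>2 \<le> c1 * S.data_energy"
  proof -
    have "?LG\<^sup>2 \<le> 2 * (1 + \<Gamma>) * c0 * S.data_energy"
      using st(2) unfolding source Nk \<Gamma>_def by (simp only: add.assoc)
    moreover have "0 \<le> 2 * (1 + \<Gamma>) * c0 * S.data_energy" using \<Gamma>(1) c0 D0 by simp
    ultimately show ?thesis unfolding \<Gamma>(2) by linarith
  qed
  have B0: "?L0\<^sup>2 \<le> c1 * S.data_energy" using L0_upper st(1) le by linarith
  have E: "?L1\<^sup>2 \<le> c1 * S.data_energy"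
  proof -
    have "h * S.kinetic_energy 1 \<le> h * S.energy 1"
      using hp S.nonneg(1)[of 1] by (intro mult_left_mono) (auto simp: S.energy_split)
    then show ?thesis unfolding L1 using st(1) le cD by linarith
  qed
  show ?thesis
    unfolding C_def
    by (rule combine_square_bounds[OF A B0 E D])
      (use c0 \<Gamma> Q0 in \<open>auto simp: L2\<Omega>_norm_nonneg\<close>)
qed

theorem theorem4p1:
  fixes \<beta> xs T M0 R K C0 :: real
  assumes "0 < \<beta>" and "\<beta> < 1"
    and "1 < xs"
    and "0 < T" and "T > (SUP x\<in>{0<..<1}. \<bar>x - xs\<bar>) / \<beta>"
    and "0 < M0" and "\<And>x t. x \<in> {0<..<1} \<Longrightarrow> t \<in> {0<..<T} \<Longrightarrow> 0 < weight_phi xs \<beta> T M0 x t"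
    and "0 < R"
    and "0 \<le> K"
    and "0 < C0"
  shows
    "\<exists>C>0. \<exists>dxhat>0. \<exists>\<epsilon>>0.
       \<forall>(P :: 'a measure) B (M :: nat) (N :: nat) a b c d gbar g1 g2 y01 y02 y11 y12 y1 y2.
         brownian_space P B \<and>
         1 \<le> M \<and> 1 \<le> N \<and> dx M \<le> dxhat \<and> dt T N \<le> C0 * \<epsilon> * (dx M)\<^sup>2 \<and>
         a \<in> LinfF P B M T N \<and> LinfF_norm P M T N a \<le> ereal K \<and>
         b \<in> LinfF P B M T N \<and> LinfF_norm P M T N b \<le> ereal K \<and>
         c \<in> LinfF P B M T N \<and> LinfF_norm P M T N c \<le> ereal K \<and>
         d \<in> LinfF P B M T N \<and> LinfF_norm P M T N d \<le> ereal K \<and>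
         gbar \<in> L2F_x P B M T \<and>
         (g1, y01, y11) \<in> admissible P B M T N R gbar \<and>
         (g2, y02, y12) \<in> admissible P B M T N R gbar \<and>
         scheme_solution P B M T N a b c d g1 y01 y11 y1 \<and>
         scheme_solution P B M T N a b c d g2 y02 y12 y2
         \<longrightarrow>
         L2\<Omega>_norm P (L2_norm M T N) (\<lambda>\<omega> x t. sqrt (T - t) * (g1 \<omega> x t - g2 \<omega> x t))
         + L2\<Omega>_norm P (H1_xnorm M) (\<lambda>\<omega> x. y01 \<omega> x - y02 \<omega> x)
         + L2\<Omega>_norm P (L2_xnorm M) (\<lambda>\<omega> x. y11 \<omega> x - y12 \<omega> x)
         \<le> C * L2\<Omega>_norm P (L2_tnorm T N)
                 (\<lambda>\<omega> t. trace0 (dx M) (Dx (dx M) (y1 \<omega>)) t - trace0 (dx M) (Dx (dx M) (y2 \<omega>)) t)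
           + C * sqrt (L2\<Omega>_norm P (H1_xnorm M) (\<lambda>\<omega> x. y1 \<omega> x T - y2 \<omega> x T))
           + C * L2\<Omega>_norm P (L2_norm_star M T N)
                 (\<lambda>\<omega> x t. dx M * (Dt (dt T N) (Dx (dx M) (y1 \<omega>)) x t
                                 - Dt (dt T N) (Dx (dx M) (y2 \<omega>)) x t))"
proof -
  have T1: "1 < T"
  proof -
    \<comment> \<open>A point so close to \<open>0\<close> that its distance to \<open>xs\<close> still exceeds \<open>1\<close>.\<close>
    define x where "x = min (1 / 2) ((xs - 1) / 2)"
    have x: "x \<in> {0<..<1}" "1 < xs - x" using assms(3) by (auto simp: x_def min_def field_simps)
    have "bdd_above ((\<lambda>x. \<bar>x - xs\<bar>) ` {0<..<1})"
      using assms(3) by (intro bdd_aboveI[of _ "xs"]) auto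
    then have "\<bar>x - xs\<bar> \<le> (SUP x\<in>{0<..<1}. \<bar>x - xs\<bar>)" by (rule cSUP_upper2[OF _ x(1)]) simp
    then have "1 < (SUP x\<in>{0<..<1}. \<bar>x - xs\<bar>)" using x(2) by linarith
    moreover have "(SUP x\<in>{0<..<1}. \<bar>x - xs\<bar>) < T * \<beta>" using assms(1,5) by (simp add: divide_less_eq)
    moreover have "T * \<beta> \<le> T * 1" using assms(2,4) by (intro mult_left_mono) auto
    ultimately show ?thesis by linarith
  qed
  define \<gamma> where "\<gamma> = (1 + T) / 2"
  have \<gamma>: "1 < \<gamma>" "\<gamma> < T" using T1 by (auto simp: \<gamma>_def)
  define L where "L = 5 / 2 * K + 1 + 4 * (1 + K) * exp (2 * (4 * K + 1) * T) / (T - \<gamma>)"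
  have "0 \<le> 4 * (1 + K) * exp (2 * (4 * K + 1) * T) / (T - \<gamma>)" using assms(9) \<gamma> by simp
  then have L: "0 < L" using assms(9) by (simp add: L_def)
  \<comment> \<open>Large enough to absorb the lower-order and the bottom terms.\<close>
  define \<rho> where "\<rho> = 4 * L / (\<gamma> - 1)"
  have \<rho>: "0 < \<rho>" "L = \<rho> * (\<gamma> - 1) / 4" using L \<gamma> by (auto simp: \<rho>_def)
  define H where "H = min (min (1 / (2 * (4 * K + 1))) (1 / \<rho>)) (min ((\<gamma> - 1) / (2 * (\<rho> * (\<gamma>\<^sup>2 + 1)))) ((T - \<gamma>) / 2))"
  have \<gamma>2: "0 < \<gamma>\<^sup>2 + 1" by (simp add: add_nonneg_pos)
  have H: "0 < H" unfolding H_def using assms(9) \<rho>(1) \<gamma> \<gamma>2 by auto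
  have small: "(4 * K + 1) * x \<le> 1 / 2" "\<rho> * x \<le> 1" "\<rho> * (\<gamma>\<^sup>2 + 1) * x \<le> (\<gamma> - 1) / 2" "x \<le> (T - \<gamma>) / 2"
    if "x \<le> H" for x
  proof -
    have "x \<le> 1 / (2 * (4 * K + 1))" "x \<le> 1 / \<rho>" "x \<le> (\<gamma> - 1) / (2 * (\<rho> * (\<gamma>\<^sup>2 + 1)))" "x \<le> (T - \<gamma>) / 2"
      using that by (auto simp: H_def)
    moreover have "0 < 2 * (4 * K + 1)" "0 < 2 * (\<rho> * (\<gamma>\<^sup>2 + 1))" using assms(9) \<rho>(1) \<gamma>2 by simp_all
    ultimately show "(4 * K + 1) * x \<le> 1 / 2" "\<rho> * x \<le> 1" "\<rho> * (\<gamma>\<^sup>2 + 1) * x \<le> (\<gamma> - 1) / 2" "x \<le> (T - \<gamma>) / 2"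
      using \<rho>(1) by (simp_all only: pos_le_divide_eq) (simp_all add: mult_ac)
  qed
  define c0 where "c0 = (exp (\<rho> * \<gamma>) + 2 * exp (2 * (4 * K + 1) * T) / (T - \<gamma>)) * (exp (\<rho> * T) * (1 + \<rho> * \<gamma>)) + 1"
  define c1 where "c1 = 4 * (1 + (4 * K + 1) * T + K\<^sup>2 * T) * c0"
  define Q where "Q = sqrt (28 * exp ((2 + 4 * K + 8 * K\<^sup>2) * T)) * R"
  define C where "C = 3 * sqrt c1 * (1 + sqrt (2 * Q)) + 1"
  have C: "0 < C"
  proof -
    have "0 \<le> c0" unfolding c0_def using \<gamma> \<rho>
      by (intro add_nonneg_nonneg mult_nonneg_nonneg divide_nonneg_nonneg) auto
    then have "0 \<le> c1" unfolding c1_def using assms(4,9) by simp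
    moreover have "0 \<le> Q" using assms(8) by (simp add: Q_def)
    ultimately have "0 \<le> 3 * sqrt c1 * (1 + sqrt (2 * Q))" by simp
    then show ?thesis unfolding C_def by linarith
  qed
  show ?thesis
  proof (rule exI[of _ C], intro conjI C, rule exI[of _ H], intro conjI H, rule exI[of _ "1 / (4 * C0)"],
      intro conjI allI impI, goal_cases)
    case 1
    show ?case using assms(10) by simp
  next
    case (2 P B M N a b c d gbar g1 g2 y01 y02 y11 y12 y1 y2)
    then have h: "dx M \<le> H" and k: "4 * dt T N \<le> (dx M)\<^sup>2" using assms(10) by auto
    note sm = small[OF h]
    show ?case
      unfolding C_def c1_def c0_def Q_def
      by (rule difference_estimate[where a = a and b = b and c = c and d = d and gbar = gbar and \<gamma> = \<gamma> and \<rho> = \<rho>])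
        (use 2 k sm \<gamma> \<rho> assms(8,9) in \<open>auto simp: L_def\<close>)
  qed
qed

end
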